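(* Let $\mu,\nu$ be two probability measures on $\mathbb R^d$ with $\nu$ being compactly supported. (a) If $\mu$ is compactly supported, then the following are equivalent: (i) $\mu\le_{phc}\nu$; (ii) there exists a nonnegative kernel $q$ such that $\mu q=\nu$ and $\int y\,q^x(dy)=x$ for $\mu$-almost every $x$; (iii) there exist a probability measure $\eta$ absolutely continuous with respect to $\mu$, with density denoted by $N$, and a couple of random vectors $(U,V)$ with $U\sim\eta$, $V\sim\nu$ such that $N(U)\,\mathbb E[V\mid U]=U$ almost surely. (b) The same conclusion (the equivalence of (i), (ii) and (iii)) holds if $\mu$ has a finite moment of order $1$ and the convex hull of the support of $\nu$ does not contain $0$.
   Context: A nonnegative kernel is a family $q=(q^x)_{x}$ of finite nonnegative Borel measures (not necessarily of mass $1$) on $\mathbb R^d$ such that $x\mapsto q^x(A)$ is measurable for every Borel set $A$; $\mu q(dy):=\int q^x(dy)\,\mu(dx)$. A function $\varphi:\mathbb R^d\to\mathbb R$ is positively $1$-homogenous if $\varphi(tx)=t\varphi(x)$ for all $t\ge0$, $x\in\mathbb R^d$. For probability measures $\mu,\nu$ on $\mathbb R^d$ with finite first moments, $\mu\le_{phc}\nu$ (domination in the positively $1$-homogenous convex order) means $\int\varphi\,d\mu\le\int\varphi\,d\nu$ for all convex positively $1$-homogenous $\varphi:\mathbb R^d\to\mathbb R$.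
   Formalization: Condition (iii) additionally requires that x = 0 for μ-almost every x with N(x) = 0; without it (iii) does not imply (i), e.g. μ = (δ_1+δ_5)/2, ν = δ_{1/2}, η = δ_1. *)

theory Defs
  imports "HOL-Probability.Probability"
begin

definition measure_support :: "'a::topological_space measure \<Rightarrow> 'a set" where
  "measure_support \<mu> = {x. \<forall>U. open U \<and> x \<in> U \<longrightarrow> emeasure \<mu> U > 0}"

text \<open>The masses of the \<open>q x\<close> need be neither 1 nor bounded in \<open>x\<close>, so the library's kernels
  (measurable maps into \<open>prob_algebra\<close> or \<open>subprob_algebra\<close>) and \<open>bind\<close> do not apply.\<close>

definition nonneg_kernel :: "('a::topological_space \<Rightarrow> 'a measure) \<Rightarrow> bool" where
  "nonneg_kernel q \<longleftrightarrow>
     (\<forall>x. finite_measure (q x) \<and> sets (q x) = sets borel) \<and>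
     (\<forall>A\<in>sets borel. (\<lambda>x. emeasure (q x) A) \<in> borel_measurable borel)"

definition kernel_comp :: "'a measure \<Rightarrow> ('a::topological_space \<Rightarrow> 'a measure) \<Rightarrow> 'a measure" where
  "kernel_comp \<mu> q = measure_of UNIV (sets borel) (\<lambda>A. \<integral>\<^sup>+ x. emeasure (q x) A \<partial>\<mu>)"

lemma sets_kernel_comp [simp]: "sets (kernel_comp \<mu> q) = sets borel"
  unfolding kernel_comp_def
  using sigma_algebra.sets_measure_of_eq[OF sets.sigma_algebra_axioms, of borel] by simp

lemma emeasure_kernel_comp:
  assumes q: "nonneg_kernel q" and \<mu>: "sets \<mu> = sets borel" and A: "A \<in> sets borel"
  shows "emeasure (kernel_comp \<mu> q) A = (\<integral>\<^sup>+ x. emeasure (q x) A \<partial>\<mu>)"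
proof (rule emeasure_measure_of[OF kernel_comp_def])
  show "sets borel \<subseteq> Pow (UNIV :: 'a set)" by simp
  show "A \<in> sets (kernel_comp \<mu> q)" using A by simp
  show "positive (sets (kernel_comp \<mu> q)) (\<lambda>A. \<integral>\<^sup>+ x. emeasure (q x) A \<partial>\<mu>)"
    by (simp add: positive_def)
  show "countably_additive (sets (kernel_comp \<mu> q)) (\<lambda>A. \<integral>\<^sup>+ x. emeasure (q x) A \<partial>\<mu>)"
  proof (rule countably_additiveI)
    fix B :: "nat \<Rightarrow> 'a set"
    assume B: "range B \<subseteq> sets (kernel_comp \<mu> q)" "disjoint_family B"
    have m: "(\<lambda>x. emeasure (q x) (B i)) \<in> borel_measurable \<mu>" for i
      using q B \<mu> by (auto simp: nonneg_kernel_def cong: measurable_cong_sets)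
    have "(\<Sum>i. emeasure (q x) (B i)) = emeasure (q x) (\<Union>i. B i)" for x
      using q B by (intro suminf_emeasure) (auto simp: nonneg_kernel_def)
    then show "(\<Sum>i. \<integral>\<^sup>+ x. emeasure (q x) (B i) \<partial>\<mu>) = (\<integral>\<^sup>+ x. emeasure (q x) (\<Union>i. B i) \<partial>\<mu>)"
      using m by (simp flip: nn_integral_suminf)
  qed
qed

definition pos_homogeneous :: "('a::real_vector \<Rightarrow> real) \<Rightarrow> bool" where
  "pos_homogeneous \<phi> \<longleftrightarrow> (\<forall>t\<ge>0. \<forall>x. \<phi> (t *\<^sub>R x) = t * \<phi> x)"

text \<open>Only meaningful for \<open>\<mu>\<close>, \<open>\<nu>\<close> with finite first moments: then every such \<open>\<phi>\<close>, being Lipschitz,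
  is integrable.\<close>

definition phc_le :: "'a::euclidean_space measure \<Rightarrow> 'a measure \<Rightarrow> bool" where
  "phc_le \<mu> \<nu> \<longleftrightarrow>
     (\<forall>\<phi>. convex_on UNIV \<phi> \<and> pos_homogeneous \<phi> \<longrightarrow> (\<integral>x. \<phi> x \<partial>\<mu>) \<le> (\<integral>x. \<phi> x \<partial>\<nu>))"

text \<open>\<open>has_bochner_integral\<close> rather than an equation between integrals: the integral of a
  non-integrable function is 0 by convention, which must not count as a barycenter.\<close>

definition has_barycentric_kernel :: "'a::euclidean_space measure \<Rightarrow> 'a measure \<Rightarrow> bool" where
  "has_barycentric_kernel \<mu> \<nu> \<longleftrightarrow>
     (\<exists>q. nonneg_kernel q \<and> kernel_comp \<mu> q = \<nu> \<and>
          (AE x in \<mu>. has_bochner_integral (q x) (\<lambda>y. y) x))"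

text \<open>The library has conditional expectations of real random variables only; vectors are
  conditioned coordinatewise, here on the sigma-algebra generated by \<open>U\<close>.\<close>

definition vec_cond_exp :: "'w measure \<Rightarrow> ('w \<Rightarrow> 'b::topological_space) \<Rightarrow>
    ('w \<Rightarrow> 'a::euclidean_space) \<Rightarrow> 'w \<Rightarrow> 'a" where
  "vec_cond_exp M U V = (\<lambda>\<omega>. \<Sum>b\<in>Basis.
     real_cond_exp M (vimage_algebra (space M) U borel) (\<lambda>\<omega>'. V \<omega>' \<bullet> b) \<omega> *\<^sub>R b)"

text \<open>Taking the underlying probability space on the type \<open>'a \<times> 'a\<close> loses nothing: the condition
  depends only on the joint law of \<open>(U, V)\<close>, a measure on that type.

  The clause \<open>AE x in \<mu>. N x = 0 \<longrightarrow> x = 0\<close> makes the equation \<open>N(U) E[V | U] = U\<close> hold at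
  \<open>\<mu>\<close>-almost every point instead of only \<open>\<eta>\<close>-almost every point: where \<open>N\<close> vanishes, the
  left-hand side is 0, and the almost sure equation under \<open>U \<sim> \<eta>\<close> says nothing there. Without
  this clause the condition would not imply \<open>phc_le \<mu> \<nu>\<close>. On the line, let \<open>\<mu>\<close> have mass 1/2 at
  each of 1 and 5, let \<open>\<nu>\<close> be the Dirac mass at 1/2 and \<open>\<eta>\<close> the Dirac mass at 1, so that
  \<open>N 1 = 2\<close> and \<open>N 5 = 0\<close>. Then \<open>U = 1\<close> and \<open>V = 1/2\<close> satisfy the equation, whereas
  the test function \<open>\<phi> x = x\<close> has integral 3 under \<open>\<mu>\<close> and 1/2 under \<open>\<nu>\<close>. One cannot ask for
  \<open>N > 0\<close> everywhere either: for \<open>\<mu>\<close> of mass 1/2 at each of 0 and 1 and the same \<open>\<nu>\<close>,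
  \<open>phc_le \<mu> \<nu>\<close> holds and \<open>N 0 = 0\<close> is forced.\<close>

definition has_density_coupling :: "'a::euclidean_space measure \<Rightarrow> 'a measure \<Rightarrow> bool" where
  "has_density_coupling \<mu> \<nu> \<longleftrightarrow>
     (\<exists>(\<eta> :: 'a measure) (N :: 'a \<Rightarrow> real) (M :: ('a \<times> 'a) measure) (U :: 'a \<times> 'a \<Rightarrow> 'a) (V :: 'a \<times> 'a \<Rightarrow> 'a).
        prob_space \<eta> \<and> sets \<eta> = sets borel \<and> absolutely_continuous \<mu> \<eta> \<and>
        N \<in> borel_measurable borel \<and> (\<forall>x. 0 \<le> N x) \<and> \<eta> = density \<mu> (\<lambda>x. ennreal (N x)) \<and>
        (AE x in \<mu>. N x = 0 \<longrightarrow> x = 0) \<and>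
        prob_space M \<and> U \<in> measurable M borel \<and> V \<in> measurable M borel \<and>
        distr M borel U = \<eta> \<and> distr M borel V = \<nu> \<and>
        (AE \<omega> in M. N (U \<omega>) *\<^sub>R vec_cond_exp M U V \<omega> = U \<omega>))"

end

theory Submission
  imports Defs
begin

text \<open>Both parts are instances of one equivalence, for \<open>\<mu>\<close> with finite first moment and \<open>\<nu>\<close> carried by
  a compact set (\<open>phc_kernel_coupling_equivalence\<close>). It is proved as a cycle: order, kernel,
  coupling, order.

  Coupling to order. A sublinear function is a supremum of countably many linear functionals, so it
  satisfies a conditional Jensen inequality. By homogeneity \<open>N(U) E[V | U] = U\<close> gives
  \<open>\<phi>(U) / N(U) = \<phi>(E[V | U])\<close>, and \<open>\<phi>(U) / N(U)\<close> has the expectation \<open>\<integral>\<phi> d\<mu>\<close>.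

  Kernel to coupling. \<open>N x\<close> is the mass of \<open>q x\<close>, and the joint law of \<open>(U, V)\<close> is
  \<open>\<mu>(dx) q x (dy)\<close>.

  Order to kernel is the substantial direction. Consider kernels \<open>k x y \<nu>(dy)\<close> with
  \<open>\<integral>k x y \<mu>(dx) = 1\<close> for all \<open>y\<close>; they carry \<open>\<mu>\<close> to \<open>\<nu>\<close>. When \<open>\<mu>\<close> is cut into finitely many cells,
  such kernels can have barycenters as close to \<open>x\<close> as desired in \<open>L\<^sup>1(\<mu>)\<close>: by duality, the only
  obstruction would be a maximum of finitely many linear functionals violating the order
  (\<open>finite_transport_duality\<close>, \<open>near_barycentric_nonempty\<close>).

  The masses of such kernels need not be uniformly integrable under \<open>\<mu>\<close>, so a weak limit of the joint
  laws may have a first marginal that is not absolutely continuous with respect to \<open>\<mu>\<close>. Instead the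
  limit is taken for each \<open>x\<close> separately. The approximately barycentric kernels form a convex set, and
  nearly minimising the strictly convex functional \<open>\<integral>exp (- a) d\<mu>\<close> along a decreasing sequence of
  such sets produces kernels whose integrals against countably many test functions converge for
  almost every \<open>x\<close> (\<open>komlos_type_convergence\<close>, \<open>barycentric_sequence\<close>). Weak compactness of measures
  on a compact set turns these limits into measures \<open>q x\<close> with barycenter exactly \<open>x\<close>.

  Mass may be lost on the way: Fatou's lemma only yields \<open>\<mu>q \<le> \<nu>\<close>. The lost mass \<open>\<nu> - \<mu>q\<close> has
  barycenter \<open>0\<close>, because the order, tested with a linear functional and its negative, forces \<open>\<mu>\<close> and
  \<open>\<nu>\<close> to have the same barycenter. Adding it to every \<open>q x\<close> therefore keeps the barycenters and
  gives \<open>\<mu>q = \<nu>\<close> (\<open>barycentric_kernel_of_subkernel\<close>).\<close>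

section \<open>Sublinear functions\<close>

lemma pos_homogeneous_zero: "pos_homogeneous \<phi> \<Longrightarrow> \<phi> 0 = 0"
  unfolding pos_homogeneous_def by (metis mult_zero_left order_refl scale_zero_left)

lemma sublinear_norm_bound:
  fixes \<phi> :: "'a::euclidean_space \<Rightarrow> real"
  assumes "convex_on UNIV \<phi>" and hom: "pos_homogeneous \<phi>"
  obtains L where "\<And>z. \<bar>\<phi> z\<bar> \<le> L * norm z"
proof -
  have "compact (\<phi> ` sphere 0 1)"
    using convex_on_continuous[OF open_UNIV assms(1)]
    by (intro compact_continuous_image) (auto intro: continuous_on_subset)
  then obtain L where L: "\<And>z. norm z = 1 \<Longrightarrow> \<bar>\<phi> z\<bar> \<le> L"
    by (fastforce dest!: compact_imp_bounded simp: bounded_iff)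
  have "\<bar>\<phi> z\<bar> \<le> L * norm z" for z
  proof (cases "z = 0")
    case True
    then show ?thesis using pos_homogeneous_zero[OF hom] by simp
  next
    case False
    have "\<phi> z = \<phi> (norm z *\<^sub>R (z /\<^sub>R norm z))" using False by simp
    also have "\<dots> = norm z * \<phi> (z /\<^sub>R norm z)"
      using hom unfolding pos_homogeneous_def by (metis norm_ge_zero)
    finally show ?thesis using L[of "z /\<^sub>R norm z"] False
      by (simp add: abs_mult mult.commute mult_left_mono)
  qed
  then show ?thesis using that by blast
qed

text \<open>Separate the point \<open>(z, \<phi> z - e)\<close> from the epigraph. The epigraph is a closed convex cone, so the
  separating hyperplane may be moved to the origin, where it is the graph of a linear functional.\<close>

lemma sublinear_approx_minorant:
  fixes \<phi> :: "'a::euclidean_space \<Rightarrow> real"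
  assumes conv: "convex_on UNIV \<phi>" and hom: "pos_homogeneous \<phi>" and e: "e > 0"
  shows "\<exists>a. (\<forall>y. a \<bullet> y \<le> \<phi> y) \<and> \<phi> z - e < a \<bullet> z"
proof -
  let ?E = "epigraph UNIV \<phi>"
  have c: "convex ?E" using conv by (rule convex_epigraphI)
  have "?E = {p. \<phi> (fst p) \<le> snd p}" by (auto simp: epigraph_def)
  moreover have "closed {p. \<phi> (fst p) \<le> snd p}"
    by (intro closed_Collect_le continuous_on_compose2[OF convex_on_continuous[OF open_UNIV conv]]
        continuous_on_fst continuous_on_snd continuous_on_id subset_UNIV)
  ultimately have cl: "closed ?E" by simp
  have nin: "(z, \<phi> z - e) \<notin> ?E" using e by (simp add: epigraph_def)
  obtain p b where pb: "p \<bullet> (z, \<phi> z - e) < b" "\<And>x. x \<in> ?E \<Longrightarrow> p \<bullet> x > b"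
    using separating_hyperplane_closed_point[OF c cl nin] by blast
  obtain w r where p: "p = (w, r)" by (cases p)
  have z0: "\<phi> 0 = 0" by (rule pos_homogeneous_zero[OF hom])
  have b0: "b < 0" using pb(2)[of 0] z0 by (simp add: epigraph_def)
  \<comment> \<open>If the functional were negative somewhere on the cone, scaling would bring it down to \<open>b\<close>.\<close>
  have E: "w \<bullet> y + r * s \<ge> 0" if "\<phi> y \<le> s" for y s
  proof (rule ccontr)
    assume "\<not> ?thesis"
    then have neg: "w \<bullet> y + r * s < 0" by simp
    define t where "t = b / (w \<bullet> y + r * s)"
    have t: "t \<ge> 0" unfolding t_def using b0 neg by (simp add: divide_nonpos_neg less_imp_le)
    have "\<phi> (t *\<^sub>R y) = t * \<phi> y" using hom t by (simp add: pos_homogeneous_def)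
    then have "(t *\<^sub>R y, t * s) \<in> ?E"
      using that t by (simp add: epigraph_def mult_left_mono)
    from pb(2)[OF this] have "t * (w \<bullet> y + r * s) > b" by (simp add: p algebra_simps)
    then show False using neg by (simp add: t_def)
  qed
  have r: "r > 0"
  proof -
    have "r * e > 0" using E[of z "\<phi> z"] pb(1) b0 by (simp add: p algebra_simps)
    then show ?thesis using e by (simp add: zero_less_mult_iff)
  qed
  show ?thesis
  proof (intro exI conjI allI)
    fix y
    show "((- 1 / r) *\<^sub>R w) \<bullet> y \<le> \<phi> y" using E[of y "\<phi> y"] r
      by (simp add: field_simps)
  next
    show "\<phi> z - e < ((- 1 / r) *\<^sub>R w) \<bullet> z" using pb(1) b0 r
      by (simp add: p field_simps)
  qed
qed

text \<open>A countable dense subset of the set of all linear minorants has the same supremum.\<close>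

lemma sublinear_countable_minorants:
  fixes \<phi> :: "'a::euclidean_space \<Rightarrow> real"
  assumes conv: "convex_on UNIV \<phi>" and hom: "pos_homogeneous \<phi>"
  obtains D where "countable D" "\<And>a z. a \<in> D \<Longrightarrow> a \<bullet> z \<le> \<phi> z"
    "\<And>z c. (\<And>a. a \<in> D \<Longrightarrow> a \<bullet> z \<le> c) \<Longrightarrow> \<phi> z \<le> c"
proof -
  define A where "A = {a. \<forall>z. a \<bullet> z \<le> \<phi> z}"
  obtain D where D: "countable D" "D \<subseteq> A" "A \<subseteq> closure D"
    using separable[of A] by blast
  show ?thesis
  proof
    show "countable D" by fact
    show "a \<bullet> z \<le> \<phi> z" if "a \<in> D" for a z using D(2) that by (auto simp: A_def)
    show "\<phi> z \<le> c" if le: "\<And>a. a \<in> D \<Longrightarrow> a \<bullet> z \<le> c" for z c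
    proof -
      have "D \<subseteq> {a. a \<bullet> z \<le> c}" using le by blast
      moreover have "closed {a. a \<bullet> z \<le> c}"
        by (intro closed_Collect_le continuous_intros)
      ultimately have cl: "A \<subseteq> {a. a \<bullet> z \<le> c}"
        using closure_minimal D(3) by blast
      show ?thesis
      proof (rule field_le_epsilon)
        fix e :: real assume "e > 0"
        from sublinear_approx_minorant[OF conv hom this, of z]
        obtain a where "a \<in> A" "\<phi> z - e < a \<bullet> z" unfolding A_def by blast
        then show "\<phi> z \<le> c + e" using cl by force
      qed
    qed
  qed
qed


lemma Max_inner_sublinear:
  fixes u :: "'i \<Rightarrow> 'a::euclidean_space"
  assumes I: "finite I" "I \<noteq> {}"
  shows "convex_on UNIV (\<lambda>y. Max ((\<lambda>i. u i \<bullet> y) ` I))"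
    and "pos_homogeneous (\<lambda>y. Max ((\<lambda>i. u i \<bullet> y) ` I))"
proof -
  show "convex_on UNIV (\<lambda>y. Max ((\<lambda>i. u i \<bullet> y) ` I))"
  proof (rule convex_onI)
    fix t :: real and x y :: 'a assume t: "0 < t" "t < 1"
    have "u i \<bullet> ((1 - t) *\<^sub>R x + t *\<^sub>R y)
        \<le> (1 - t) * Max ((\<lambda>i. u i \<bullet> x) ` I) + t * Max ((\<lambda>i. u i \<bullet> y) ` I)" if "i \<in> I" for i
      unfolding inner_add_right inner_scaleR_right
      using t that I by (intro add_mono mult_left_mono Max_ge) auto
    then show "Max ((\<lambda>i. u i \<bullet> ((1 - t) *\<^sub>R x + t *\<^sub>R y)) ` I)
        \<le> (1 - t) * Max ((\<lambda>i. u i \<bullet> x) ` I) + t * Max ((\<lambda>i. u i \<bullet> y) ` I)"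
      using I by (subst Max_le_iff) auto
  qed simp
  show "pos_homogeneous (\<lambda>y. Max ((\<lambda>i. u i \<bullet> y) ` I))"
    unfolding pos_homogeneous_def
  proof (intro allI impI)
    fix t :: real and x :: 'a assume "0 \<le> t"
    then have "mono ((*) t)" by (auto intro!: monoI mult_left_mono)
    then have "t * Max ((\<lambda>i. u i \<bullet> x) ` I) = Max ((*) t ` (\<lambda>i. u i \<bullet> x) ` I)"
      using I by (intro mono_Max_commute) auto
    then show "Max ((\<lambda>i. u i \<bullet> t *\<^sub>R x) ` I) = t * Max ((\<lambda>i. u i \<bullet> x) ` I)"
      by (simp add: image_image)
  qed
qed

lemma linear_functional_sublinear:
  fixes b :: "'a::euclidean_space"
  shows "convex_on UNIV (\<lambda>y. y \<bullet> b)" and "pos_homogeneous (\<lambda>y. y \<bullet> b)"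
  by (auto intro!: convex_onI simp: pos_homogeneous_def inner_add_left)

lemma phc_le_barycenter_eq:
  fixes \<mu> \<nu> :: "'a::euclidean_space measure"
  assumes "phc_le \<mu> \<nu>"
  shows "(\<integral>x. x \<bullet> b \<partial>\<mu>) = (\<integral>y. y \<bullet> b \<partial>\<nu>)"
proof -
  have le: "(\<integral>x. x \<bullet> c \<partial>\<mu>) \<le> (\<integral>y. y \<bullet> c \<partial>\<nu>)" for c
    using assms linear_functional_sublinear[of c] unfolding phc_le_def by blast
  from le[of b] le[of "- b"] show ?thesis by simp
qed

section \<open>From the coupling to the order\<close>

text \<open>The complement of the support is a union of open null sets; by the Lindelof property countably
  many of them suffice.\<close>

lemma AE_measure_support:
  fixes \<nu> :: "'a::second_countable_topology measure"
  assumes sets: "sets \<nu> = sets borel"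
  shows "AE y in \<nu>. y \<in> measure_support \<nu>"
proof -
  define \<U> where "\<U> = {U. open U \<and> emeasure \<nu> U = 0}"
  have op: "\<And>U. U \<in> \<U> \<Longrightarrow> open U" by (simp add: \<U>_def)
  obtain \<V> where V: "\<V> \<subseteq> \<U>" "countable \<V>" "\<Union>\<V> = \<Union>\<U>"
    by (rule Lindelof[OF op])
  have "(\<Union>U\<in>\<V>. U) \<in> null_sets \<nu>"
    using V sets by (intro null_sets_UN') (auto simp: \<U>_def null_sets_def)
  moreover have "- measure_support \<nu> = \<Union>\<U>"
    by (auto simp: measure_support_def \<U>_def zero_less_iff_neq_zero)
  ultimately have "- measure_support \<nu> \<in> null_sets \<nu>" using V by simp
  then show ?thesis by (rule AE_not_in[THEN AE_mp]) auto
qed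

text \<open>Conditional Jensen: every linear minorant \<open>a\<close> of \<open>\<phi>\<close> satisfies
  \<open>a \<bullet> E[V | U] = E[a \<bullet> V | U] \<le> E[\<phi>(V) | U]\<close>, and the supremum over countably many \<open>a\<close> gives
  \<open>\<phi>(E[V | U]) \<le> E[\<phi>(V) | U]\<close>. The left-hand side is \<open>\<phi>(U) / N(U)\<close>, whose expectation is the integral
  of \<open>\<phi>\<close> under \<open>\<mu>\<close>.\<close>

lemma density_coupling_imp_phc_le:
  fixes \<mu> \<nu> :: "'a::euclidean_space measure"
  assumes \<mu>: "sets \<mu> = sets borel"
    and K: "compact K" "AE y in \<nu>. y \<in> K"
    and "has_density_coupling \<mu> \<nu>"
  shows "phc_le \<mu> \<nu>"
  unfolding phc_le_def
proof (intro allI impI, elim conjE)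
  fix \<phi> :: "'a \<Rightarrow> real" assume conv: "convex_on UNIV \<phi>" and hom: "pos_homogeneous \<phi>"
  obtain \<eta> N and M :: "('a \<times> 'a) measure" and U V where
    prob: "prob_space M" and \<eta>: "\<eta> = density \<mu> (\<lambda>x. ennreal (N x))"
    and Nm: "N \<in> borel_measurable borel" and N0: "\<And>x. 0 \<le> N x" and Nz: "AE x in \<mu>. N x = 0 \<longrightarrow> x = 0"
    and U[measurable]: "U \<in> measurable M borel" and V[measurable]: "V \<in> measurable M borel"
    and dU: "distr M borel U = \<eta>" and dV: "distr M borel V = \<nu>"
    and eq: "AE \<omega> in M. N (U \<omega>) *\<^sub>R vec_cond_exp M U V \<omega> = U \<omega>"
    using assms(4) unfolding has_density_coupling_def by blast
  interpret prob_space M by fact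
  have [measurable]: "\<phi> \<in> borel_measurable borel"
    using convex_on_continuous[OF open_UNIV conv] by (rule borel_measurable_continuous_onI)
  note [measurable] = Nm
  have Nm\<mu>[measurable]: "N \<in> borel_measurable \<mu>" "\<phi> \<in> borel_measurable \<mu>"
    using \<mu> by (simp_all cong: measurable_cong_sets)
  define F where "F = vimage_algebra (space M) U borel"
  have sub: "subalgebra M F"
    unfolding subalgebra_def F_def sets_vimage_algebra space_vimage_algebra
    using U by (intro conjI refl sets.sigma_sets_subset) (auto intro: measurable_sets)
  interpret F: finite_measure_subalgebra M F
    by unfold_locales (rule sub)
  define W where "W = vec_cond_exp M U V"
  have W: "W \<omega> = (\<Sum>b\<in>Basis. real_cond_exp M F (\<lambda>\<omega>'. V \<omega>' \<bullet> b) \<omega> *\<^sub>R b)" for \<omega>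
    by (simp add: W_def vec_cond_exp_def F_def)
  have [measurable]: "W \<in> borel_measurable M" unfolding W
    by (intro borel_measurable_sum borel_measurable_scaleR borel_measurable_cond_exp2 borel_measurable_const)
  have VK: "AE \<omega> in M. V \<omega> \<in> K"
    using K(2) unfolding dV[symmetric] by (rule AE_distrD[OF V])
  obtain R where R: "\<And>y. y \<in> K \<Longrightarrow> norm y \<le> R"
    using compact_imp_bounded[OF K(1)] unfolding bounded_iff by blast
  have VR: "AE \<omega> in M. norm (V \<omega>) \<le> R" using VK R by auto
  have Vint: "integrable M V" using VR by (rule integrable_const_bound) simp
  have Va: "integrable M (\<lambda>\<omega>. V \<omega> \<bullet> a)" for a using Vint by simp
  have ce: "AE \<omega> in M. real_cond_exp M F (\<lambda>\<omega>. V \<omega> \<bullet> a) \<omega> = W \<omega> \<bullet> a" for a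
  proof -
    have eq: "(\<lambda>\<omega>. \<Sum>b\<in>Basis. (a \<bullet> b) * (V \<omega> \<bullet> b)) = (\<lambda>\<omega>. V \<omega> \<bullet> a)"
      by (auto simp: euclidean_inner[of _ a] mult.commute)
    have "AE \<omega> in M. real_cond_exp M F (\<lambda>\<omega>. \<Sum>b\<in>Basis. (a \<bullet> b) * (V \<omega> \<bullet> b)) \<omega>
        = (\<Sum>b\<in>Basis. real_cond_exp M F (\<lambda>\<omega>. (a \<bullet> b) * (V \<omega> \<bullet> b)) \<omega>)"
      using Va by (intro F.real_cond_exp_sum) auto
    moreover have "AE \<omega> in M. \<forall>b\<in>Basis. real_cond_exp M F (\<lambda>\<omega>. (a \<bullet> b) * (V \<omega> \<bullet> b)) \<omega>
        = (a \<bullet> b) * real_cond_exp M F (\<lambda>\<omega>. V \<omega> \<bullet> b) \<omega>"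
      using Va by (intro AE_finite_allI F.real_cond_exp_cmult) auto
    ultimately show ?thesis unfolding eq
      by eventually_elim (simp add: W inner_sum_left inner_commute[of a] mult.commute)
  qed
  obtain L where L: "\<And>z. \<bar>\<phi> z\<bar> \<le> L * norm z" by (rule sublinear_norm_bound[OF conv hom]) blast
  have \<phi>V: "integrable M (\<lambda>\<omega>. \<phi> (V \<omega>))"
  proof (rule Bochner_Integration.integrable_bound)
    show "integrable M (\<lambda>\<omega>. L * norm (V \<omega>))" using Vint by simp
    show "AE \<omega> in M. norm (\<phi> (V \<omega>)) \<le> norm (L * norm (V \<omega>))" using L by (auto intro: order_trans[OF L abs_ge_self])
  qed simp
  have Wint: "integrable M W"
    unfolding W using Va F.real_cond_exp_int(1) by (intro Bochner_Integration.integrable_sum integrable_scaleR_left) auto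
  have \<phi>W: "integrable M (\<lambda>\<omega>. \<phi> (W \<omega>))"
  proof (rule Bochner_Integration.integrable_bound)
    show "integrable M (\<lambda>\<omega>. L * norm (W \<omega>))" using Wint by simp
    show "AE \<omega> in M. norm (\<phi> (W \<omega>)) \<le> norm (L * norm (W \<omega>))" using L by (auto intro: order_trans[OF L abs_ge_self])
  qed simp
  obtain D where D: "countable D" "\<And>a z. a \<in> D \<Longrightarrow> a \<bullet> z \<le> \<phi> z"
    "\<And>z c. (\<And>a. a \<in> D \<Longrightarrow> a \<bullet> z \<le> c) \<Longrightarrow> \<phi> z \<le> c"
    by (rule sublinear_countable_minorants[OF conv hom]) blast
  have jensen: "AE \<omega> in M. \<phi> (W \<omega>) \<le> real_cond_exp M F (\<lambda>\<omega>. \<phi> (V \<omega>)) \<omega>"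
  proof -
    have "AE \<omega> in M. \<forall>a\<in>D. a \<bullet> W \<omega> \<le> real_cond_exp M F (\<lambda>\<omega>. \<phi> (V \<omega>)) \<omega>"
    proof (rule AE_ball_countable')
      fix a assume "a \<in> D"
      then have "AE \<omega> in M. real_cond_exp M F (\<lambda>\<omega>. V \<omega> \<bullet> a) \<omega> \<le> real_cond_exp M F (\<lambda>\<omega>. \<phi> (V \<omega>)) \<omega>"
        by (intro F.real_cond_exp_mono AE_I2 Va \<phi>V) (simp add: D(2) inner_commute[of _ a])
      with ce[of a] show "AE \<omega> in M. a \<bullet> W \<omega> \<le> real_cond_exp M F (\<lambda>\<omega>. \<phi> (V \<omega>)) \<omega>"
        by eventually_elim (simp add: inner_commute)
    qed fact
    then show ?thesis by eventually_elim (auto intro: D(3))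
  qed
  have NU: "AE \<omega> in M. 0 < N (U \<omega>)"
  proof -
    have "AE x in \<eta>. 0 < N x" unfolding \<eta> by (subst AE_density) auto
    then show ?thesis unfolding dU[symmetric] by (rule AE_distrD[OF U])
  qed
  \<comment> \<open>Where \<open>N\<close> vanishes, \<open>x = 0\<close> for \<open>\<mu>\<close>-almost every \<open>x\<close>, and \<open>\<phi> 0 = 0\<close>.\<close>
  have "(\<integral>x. \<phi> x \<partial>\<mu>) = (\<integral>x. N x *\<^sub>R (\<phi> x / N x) \<partial>\<mu>)"
    using Nz by (intro integral_cong_AE) (auto simp: pos_homogeneous_zero[OF hom] elim!: AE_mp)
  also have "\<dots> = (\<integral>x. \<phi> x / N x \<partial>\<eta>)"
    unfolding \<eta> using N0 by (intro integral_density[symmetric]) auto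
  also have "\<dots> = (\<integral>\<omega>. \<phi> (U \<omega>) / N (U \<omega>) \<partial>M)"
    unfolding dU[symmetric] by (rule integral_distr) auto
  also have "\<dots> = (\<integral>\<omega>. \<phi> (W \<omega>) \<partial>M)"
  proof (rule integral_cong_AE)
    show "AE \<omega> in M. \<phi> (U \<omega>) / N (U \<omega>) = \<phi> (W \<omega>)"
      using eq NU
    proof eventually_elim
      case (elim \<omega>)
      have "\<phi> (U \<omega>) = N (U \<omega>) * \<phi> (W \<omega>)"
        using hom N0[of "U \<omega>"] elim(1) unfolding pos_homogeneous_def W_def by metis
      then show ?case using elim(2) by simp
    qed
  qed auto
  also have "\<dots> \<le> (\<integral>\<omega>. real_cond_exp M F (\<lambda>\<omega>. \<phi> (V \<omega>)) \<omega> \<partial>M)"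
    using jensen \<phi>W \<phi>V by (intro integral_mono_AE F.real_cond_exp_int(1))
  also have "\<dots> = (\<integral>\<omega>. \<phi> (V \<omega>) \<partial>M)" using \<phi>V by (rule F.real_cond_exp_int(2))
  also have "\<dots> = (\<integral>y. \<phi> y \<partial>\<nu>)" unfolding dV[symmetric] by (rule integral_distr[symmetric]) auto
  finally show "(\<integral>x. \<phi> x \<partial>\<mu>) \<le> (\<integral>y. \<phi> y \<partial>\<nu>)" .
qed

section \<open>Mixtures and sums of measures\<close>

lemma has_bochner_integral_componentwise:
  fixes f :: "'b \<Rightarrow> 'a::euclidean_space"
  assumes "\<And>b. b \<in> Basis \<Longrightarrow> has_bochner_integral M (\<lambda>x. f x \<bullet> b) (z \<bullet> b)"
  shows "has_bochner_integral M f z"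
proof -
  have "has_bochner_integral M (\<lambda>x. \<Sum>b\<in>Basis. (f x \<bullet> b) *\<^sub>R b) (\<Sum>b\<in>Basis. (z \<bullet> b) *\<^sub>R b)"
    by (intro has_bochner_integral_sum has_bochner_integral_scaleR_left assms)
  then show ?thesis by (simp add: euclidean_representation)
qed

definition mixture :: "'x measure \<Rightarrow> ('x \<Rightarrow> 'a measure) \<Rightarrow> 'a measure \<Rightarrow> 'a measure" where
  "mixture P \<kappa> N = measure_of (space N) (sets N) (\<lambda>A. \<integral>\<^sup>+ x. emeasure (\<kappa> x) A \<partial>P)"

text \<open>A common form for \<open>\<mu>q\<close>, for the joint law \<open>\<mu>(dx) q x (dy)\<close> and for the sum of two measures, so that
  integration against all three is reduced to one lemma.\<close>

definition is_mixture :: "'x measure \<Rightarrow> ('x \<Rightarrow> 'a measure) \<Rightarrow> 'a measure \<Rightarrow> bool" where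
  "is_mixture P \<kappa> M \<longleftrightarrow> (\<forall>x. sets (\<kappa> x) = sets M) \<and>
    (\<forall>A\<in>sets M. (\<lambda>x. emeasure (\<kappa> x) A) \<in> borel_measurable P \<and>
       emeasure M A = (\<integral>\<^sup>+ x. emeasure (\<kappa> x) A \<partial>P))"

lemma sets_mixture [simp]: "sets (mixture P \<kappa> N) = sets N"
  and space_mixture [simp]: "space (mixture P \<kappa> N) = space N"
  by (simp_all add: mixture_def)

lemma is_mixture_mixture:
  assumes sets: "\<And>x. sets (\<kappa> x) = sets N"
    and meas: "\<And>A. A \<in> sets N \<Longrightarrow> (\<lambda>x. emeasure (\<kappa> x) A) \<in> borel_measurable P"
  shows "is_mixture P \<kappa> (mixture P \<kappa> N)"
proof -
  have "emeasure (mixture P \<kappa> N) A = (\<integral>\<^sup>+ x. emeasure (\<kappa> x) A \<partial>P)" if A: "A \<in> sets N" for A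
  proof (rule emeasure_measure_of[OF mixture_def])
    show "sets N \<subseteq> Pow (space N)" by (rule sets.space_closed)
    show "A \<in> sets (mixture P \<kappa> N)" using A by simp
    show "positive (sets (mixture P \<kappa> N)) (\<lambda>A. \<integral>\<^sup>+ x. emeasure (\<kappa> x) A \<partial>P)"
      by (simp add: positive_def)
    show "countably_additive (sets (mixture P \<kappa> N)) (\<lambda>A. \<integral>\<^sup>+ x. emeasure (\<kappa> x) A \<partial>P)"
    proof (rule countably_additiveI)
      fix B :: "nat \<Rightarrow> 'b set"
      assume B: "range B \<subseteq> sets (mixture P \<kappa> N)" "disjoint_family B"
      have "(\<Sum>i. emeasure (\<kappa> x) (B i)) = emeasure (\<kappa> x) (\<Union>i. B i)" for x
        using B by (intro suminf_emeasure) (auto simp: sets)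
      moreover have "(\<lambda>x. emeasure (\<kappa> x) (B i)) \<in> borel_measurable P" for i
        using B meas by auto
      ultimately show "(\<Sum>i. \<integral>\<^sup>+ x. emeasure (\<kappa> x) (B i) \<partial>P) = (\<integral>\<^sup>+ x. emeasure (\<kappa> x) (\<Union>i. B i) \<partial>P)"
        by (simp flip: nn_integral_suminf)
    qed
  qed
  then show ?thesis using sets meas by (simp add: is_mixture_def)
qed

lemma is_mixture_kernel_comp:
  assumes q: "nonneg_kernel q" and \<mu>: "sets \<mu> = sets borel"
  shows "is_mixture \<mu> q (kernel_comp \<mu> q)"
  using q \<mu> emeasure_kernel_comp[OF q \<mu>]
  by (auto simp: is_mixture_def nonneg_kernel_def cong: measurable_cong_sets)

text \<open>Tonelli's theorem for a mixture, by approximation from indicators.\<close>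

lemma nn_integral_is_mixture:
  assumes mix: "is_mixture P \<kappa> M" and f: "f \<in> borel_measurable M"
  shows "(\<lambda>x. \<integral>\<^sup>+ y. f y \<partial>\<kappa> x) \<in> borel_measurable P \<and>
    (\<integral>\<^sup>+ y. f y \<partial>M) = (\<integral>\<^sup>+ x. \<integral>\<^sup>+ y. f y \<partial>\<kappa> x \<partial>P)"
proof -
  have sets: "sets (\<kappa> x) = sets M" for x using mix by (simp add: is_mixture_def)
  have meas: "g \<in> borel_measurable (\<kappa> x) \<longleftrightarrow> g \<in> borel_measurable M" for x and g :: "'b \<Rightarrow> ennreal"
    using sets[of x] by (simp cong: measurable_cong_sets)
  have sp: "space (\<kappa> x) = space M" for x using sets by (rule sets_eq_imp_space_eq)
  show ?thesis
    using f
  proof (induction rule: borel_measurable_induct)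
    case (cong f g)
    then have "(\<integral>\<^sup>+ y. f y \<partial>\<kappa> x) = (\<integral>\<^sup>+ y. g y \<partial>\<kappa> x)" for x
      by (intro nn_integral_cong) (simp add: sp)
    moreover have "(\<integral>\<^sup>+ y. f y \<partial>M) = (\<integral>\<^sup>+ y. g y \<partial>M)"
      using cong by (intro nn_integral_cong) simp
    ultimately show ?case using cong by simp
  next
    case (set A)
    then show ?case using mix by (simp add: is_mixture_def sets)
  next
    case (mult u c)
    from mult have [measurable]: "(\<lambda>x. \<integral>\<^sup>+ y. u y \<partial>\<kappa> x) \<in> borel_measurable P" by simp
    show ?case using mult by (simp add: nn_integral_cmult meas)
  next
    case (add u v)
    from add have [measurable]: "(\<lambda>x. \<integral>\<^sup>+ y. u y \<partial>\<kappa> x) \<in> borel_measurable P"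
      "(\<lambda>x. \<integral>\<^sup>+ y. v y \<partial>\<kappa> x) \<in> borel_measurable P" by simp_all
    show ?case using add by (simp add: nn_integral_add meas)
  next
    case (seq U)
    from seq have [measurable]: "(\<lambda>x. \<integral>\<^sup>+ y. U i y \<partial>\<kappa> x) \<in> borel_measurable P" for i by simp
    have "(\<integral>\<^sup>+ y. (SUP i. U i) y \<partial>\<kappa> x) = (SUP i. \<integral>\<^sup>+ y. U i y \<partial>\<kappa> x)" for x
      unfolding SUP_apply using seq by (intro nn_integral_monotone_convergence_SUP) (auto simp: meas)
    moreover have "(\<integral>\<^sup>+ y. (SUP i. U i) y \<partial>M) = (SUP i. \<integral>\<^sup>+ y. U i y \<partial>M)"
      unfolding SUP_apply using seq by (intro nn_integral_monotone_convergence_SUP) auto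
    moreover have "(\<integral>\<^sup>+ x. (SUP i. \<integral>\<^sup>+ y. U i y \<partial>\<kappa> x) \<partial>P) = (SUP i. \<integral>\<^sup>+ x. \<integral>\<^sup>+ y. U i y \<partial>\<kappa> x \<partial>P)"
      using seq by (intro nn_integral_monotone_convergence_SUP)
        (auto simp: incseq_def le_fun_def intro!: nn_integral_mono)
    ultimately show ?case using seq by (simp add: image_comp)
  qed
qed

text \<open>Fubini's theorem for a mixture: the integral over \<open>\<kappa> x\<close> may fail to exist on a null set of \<open>x\<close>,
  where the Bochner integral is \<open>0\<close> by convention.\<close>

lemma integral_is_mixture:
  fixes f :: "'a \<Rightarrow> real"
  assumes mix: "is_mixture P \<kappa> M" and f: "integrable M f"
  shows "AE x in P. integrable (\<kappa> x) f"
    and "has_bochner_integral P (\<lambda>x. \<integral>y. f y \<partial>\<kappa> x) (\<integral>y. f y \<partial>M)"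
proof -
  have sets: "sets (\<kappa> x) = sets M" for x using mix by (simp add: is_mixture_def)
  have fM[measurable]: "f \<in> borel_measurable M" using f by simp
  have fm: "f \<in> borel_measurable (\<kappa> x)" for x using fM sets[of x] by (simp cong: measurable_cong_sets)
  define A where "A x = (\<integral>\<^sup>+ y. ennreal (f y) \<partial>\<kappa> x)" for x
  define B where "B x = (\<integral>\<^sup>+ y. ennreal (- f y) \<partial>\<kappa> x)" for x
  have A: "A \<in> borel_measurable P" "(\<integral>\<^sup>+ y. ennreal (f y) \<partial>M) = (\<integral>\<^sup>+ x. A x \<partial>P)"
    using nn_integral_is_mixture[OF mix, of "\<lambda>y. ennreal (f y)"] by (simp_all add: A_def[abs_def])
  have B: "B \<in> borel_measurable P" "(\<integral>\<^sup>+ y. ennreal (- f y) \<partial>M) = (\<integral>\<^sup>+ x. B x \<partial>P)"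
    using nn_integral_is_mixture[OF mix, of "\<lambda>y. ennreal (- f y)"] by (simp_all add: B_def[abs_def])
  have fin: "(\<integral>\<^sup>+ x. A x \<partial>P) \<noteq> \<infinity>" "(\<integral>\<^sup>+ x. B x \<partial>P) \<noteq> \<infinity>"
    using f unfolding real_integrable_def by (auto simp: A(2) B(2))
  have AE: "AE x in P. A x \<noteq> \<infinity>" "AE x in P. B x \<noteq> \<infinity>"
    using nn_integral_PInf_AE A(1) B(1) fin by blast+
  then show I: "AE x in P. integrable (\<kappa> x) f"
    by eventually_elim (simp add: real_integrable_def fm flip: A_def B_def)
  have part: "has_bochner_integral P (\<lambda>x. enn2real (D x)) (enn2real (\<integral>\<^sup>+ x. D x \<partial>P))"
    if [measurable]: "D \<in> borel_measurable P" and "(\<integral>\<^sup>+ x. D x \<partial>P) \<noteq> \<infinity>" for D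
  proof -
    have "AE x in P. D x \<noteq> \<infinity>" using that by (rule nn_integral_PInf_AE)
    then have "(\<integral>\<^sup>+ x. ennreal (enn2real (D x)) \<partial>P) = (\<integral>\<^sup>+ x. D x \<partial>P)"
      by (intro nn_integral_cong_AE) (auto simp: less_top)
    then show ?thesis using that
      by (intro has_bochner_integral_nn_integral) (auto simp: less_top)
  qed
  have "has_bochner_integral P (\<lambda>x. enn2real (A x) - enn2real (B x))
      (enn2real (\<integral>\<^sup>+ x. A x \<partial>P) - enn2real (\<integral>\<^sup>+ x. B x \<partial>P))"
    using A(1) B(1) fin by (intro has_bochner_integral_diff part)
  also have "enn2real (\<integral>\<^sup>+ x. A x \<partial>P) - enn2real (\<integral>\<^sup>+ x. B x \<partial>P) = (\<integral>y. f y \<partial>M)"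
    using f by (simp add: real_lebesgue_integral_def A(2) B(2))
  finally have D: "has_bochner_integral P (\<lambda>x. enn2real (A x) - enn2real (B x)) (\<integral>y. f y \<partial>M)" .
  have meas: "(\<lambda>x. \<integral>y. f y \<partial>\<kappa> x) \<in> borel_measurable P"
  proof -
    have "(\<integral>y. f y \<partial>\<kappa> x) = (if A x = \<infinity> \<or> B x = \<infinity> then 0 else enn2real (A x) - enn2real (B x))" for x
    proof (cases "integrable (\<kappa> x) f")
      case True
      then have "A x \<noteq> \<infinity>" "B x \<noteq> \<infinity>" by (auto simp: real_integrable_def A_def B_def)
      then show ?thesis using True by (simp add: real_lebesgue_integral_def A_def B_def)
    next
      case False
      then have "A x = \<infinity> \<or> B x = \<infinity>" by (auto simp: real_integrable_def fm A_def B_def)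
      then show ?thesis using False by (simp add: not_integrable_integral_eq)
    qed
    then show ?thesis using A(1) B(1) by (simp cong: if_cong)
  qed
  show "has_bochner_integral P (\<lambda>x. \<integral>y. f y \<partial>\<kappa> x) (\<integral>y. f y \<partial>M)"
  proof (rule has_bochner_integral_cong_AE[THEN iffD1, OF _ meas _ D])
    show "(\<lambda>x. enn2real (A x) - enn2real (B x)) \<in> borel_measurable P" using A(1) B(1) by simp
    show "AE x in P. enn2real (A x) - enn2real (B x) = (\<integral>y. f y \<partial>\<kappa> x)"
      using I by eventually_elim (simp add: real_lebesgue_integral_def A_def B_def)
  qed
qed

definition add_measure :: "'a measure \<Rightarrow> 'a measure \<Rightarrow> 'a measure" where
  "add_measure A B = mixture (count_space UNIV) (\<lambda>i. if i then A else B) A"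

lemma sets_add_measure [simp]: "sets (add_measure A B) = sets A"
  by (simp add: add_measure_def)

lemma is_mixture_add_measure:
  assumes "sets A = sets B"
  shows "is_mixture (count_space UNIV) (\<lambda>i. if i then A else B) (add_measure A B)"
  unfolding add_measure_def using assms by (intro is_mixture_mixture) auto

lemma nn_integral_bool: "(\<integral>\<^sup>+ i. f i \<partial>count_space UNIV) = f True + f False"
  by (simp add: nn_integral_count_space_finite UNIV_bool add.commute)

lemma emeasure_add_measure:
  assumes "sets A = sets B" "X \<in> sets A"
  shows "emeasure (add_measure A B) X = emeasure A X + emeasure B X"
  using is_mixture_add_measure[OF assms(1)] assms by (simp add: is_mixture_def nn_integral_bool)

lemma has_bochner_integral_add_measure:
  fixes f :: "'a \<Rightarrow> real"
  assumes sets: "sets A = sets B" and f: "integrable A f" "integrable B f"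
  shows "has_bochner_integral (add_measure A B) f ((\<integral>y. f y \<partial>A) + (\<integral>y. f y \<partial>B))"
proof -
  note mix = is_mixture_add_measure[OF sets]
  have fm: "f \<in> borel_measurable (add_measure A B)"
    using f by (simp cong: measurable_cong_sets)
  have "(\<integral>\<^sup>+ y. ennreal (norm (f y)) \<partial>add_measure A B) < \<infinity>"
    using nn_integral_is_mixture[OF mix, of "\<lambda>y. ennreal (norm (f y))"] f fm
    by (simp add: nn_integral_bool integrable_iff_bounded)
  with fm have int: "integrable (add_measure A B) f" by (simp add: integrable_iff_bounded)
  have "(\<integral>i. (\<integral>y. f y \<partial>(if i then A else B)) \<partial>count_space UNIV) = (\<integral>y. f y \<partial>add_measure A B)"
    using integral_is_mixture(2)[OF mix int] by (rule has_bochner_integral_integral_eq)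
  then have "(\<integral>y. f y \<partial>add_measure A B) = (\<integral>y. f y \<partial>A) + (\<integral>y. f y \<partial>B)"
    by (simp add: lebesgue_integral_count_space_finite UNIV_bool add.commute)
  with int show ?thesis by (simp add: has_bochner_integral_iff)
qed

section \<open>From the kernel to the coupling\<close>

lemma borel_measurable_kernel_mass:
  assumes "nonneg_kernel q"
  shows "(\<lambda>x. measure (q x) UNIV) \<in> borel_measurable borel"
proof -
  have [measurable]: "(\<lambda>x. emeasure (q x) UNIV) \<in> borel_measurable borel"
    using assms by (simp add: nonneg_kernel_def)
  show ?thesis unfolding measure_def by measurable
qed

lemma emeasure_kernel_mass:
  assumes "nonneg_kernel q"
  shows "emeasure (q x) UNIV = ennreal (measure (q x) UNIV)"
  using assms finite_measure.emeasure_eq_measure[of "q x" UNIV] unfolding nonneg_kernel_def by simp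

text \<open>After division by one plus the mass, the kernel takes values in subprobability measures, where
  the measurability of sections is known.\<close>

lemma measurable_emeasure_kernel_section:
  fixes q :: "'a::second_countable_topology \<Rightarrow> 'a measure"
  assumes q: "nonneg_kernel q" and C: "C \<in> sets (borel \<Otimes>\<^sub>M borel)"
  shows "(\<lambda>x. emeasure (distr (q x) (borel \<Otimes>\<^sub>M borel) (Pair x)) C) \<in> borel_measurable borel"
proof -
  have sets: "sets (q x) = sets borel" for x using q by (simp add: nonneg_kernel_def)
  have sp: "space (q x) = UNIV" for x using sets_eq_imp_space_eq[OF sets[of x]] by simp
  define N where "N x = measure (q x) UNIV" for x
  have N0: "0 \<le> N x" for x by (simp add: N_def)
  have Nm[measurable]: "N \<in> borel_measurable borel" unfolding N_def by (rule borel_measurable_kernel_mass[OF q])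
  define p where "p x = scale_measure (ennreal (1 / (1 + N x))) (q x)" for x
  have setsp: "sets (p x) = sets borel" for x by (simp add: p_def sets)
  have spp: "space (p x) = UNIV" for x using sets_eq_imp_space_eq[OF setsp[of x]] by simp
  have p: "p \<in> measurable borel (subprob_algebra borel)"
  proof (rule measurable_subprob_algebra)
    show "sets (p x) = sets borel" for x by (rule setsp)
    show "(\<lambda>x. emeasure (p x) A) \<in> borel_measurable borel" if "A \<in> sets borel" for A
    proof -
      have [measurable]: "(\<lambda>x. emeasure (q x) A) \<in> borel_measurable borel"
        using q that by (simp add: nonneg_kernel_def)
      show ?thesis unfolding p_def emeasure_scale_measure by measurable
    qed
    fix x
    have "emeasure (p x) (space (p x)) = ennreal (1 / (1 + N x)) * ennreal (N x)"
      unfolding spp unfolding p_def using emeasure_kernel_mass[OF q, of x] by (simp add: N_def)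
    also have "\<dots> = ennreal (N x / (1 + N x))" using N0[of x] by (simp flip: ennreal_mult)
    also have "\<dots> \<le> 1" using N0[of x] by simp
    finally show "subprob_space (p x)" by (intro subprob_spaceI) (auto simp: spp)
  qed
  have Pair: "(\<lambda>(x, y). (x, y)) \<in> measurable (borel \<Otimes>\<^sub>M borel) (borel \<Otimes>\<^sub>M (borel :: 'a measure))" by simp
  have "(\<lambda>x. distr (p x) (borel \<Otimes>\<^sub>M borel) (Pair x)) \<in> measurable borel (subprob_algebra (borel \<Otimes>\<^sub>M borel))"
    using Pair p by (intro measurable_distr2) auto
  from measurable_emeasure_kernel[OF this C]
  have m: "(\<lambda>x. emeasure (distr (p x) (borel \<Otimes>\<^sub>M borel) (Pair x)) C) \<in> borel_measurable borel" .
  have "emeasure (distr (q x) (borel \<Otimes>\<^sub>M borel) (Pair x)) C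
      = ennreal (1 + N x) * emeasure (distr (p x) (borel \<Otimes>\<^sub>M borel) (Pair x)) C" for x
  proof -
    have Px: "Pair x \<in> measurable (q x) (borel \<Otimes>\<^sub>M borel)" "Pair x \<in> measurable (p x) (borel \<Otimes>\<^sub>M borel)"
      using sets by (simp_all add: p_def cong: measurable_cong_sets)
    have one: "ennreal (1 + N x) * ennreal (1 / (1 + N x)) = 1"
      using N0[of x] by (subst ennreal_mult[symmetric]) auto
    show ?thesis unfolding emeasure_distr[OF Px(1) C] emeasure_distr[OF Px(2) C] sp spp
      by (simp add: p_def one flip: mult.assoc)
  qed
  then show ?thesis using m by simp
qed

text \<open>Take \<open>N x\<close> to be the mass of \<open>q x\<close>, and let \<open>M\<close> be the measure \<open>\<mu>(dx) q x (dy)\<close> on pairs, with \<open>U\<close>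
  and \<open>V\<close> the two coordinates. Integrating \<open>V\<close> over the event \<open>U \<in> A\<close> gives \<open>\<integral> 1\<^sub>A(x) x \<mu>(dx)\<close>, which
  identifies \<open>E[V | U]\<close> as \<open>U / N(U)\<close>.\<close>

lemma barycentric_kernel_imp_density_coupling:
  fixes \<mu> \<nu> :: "'a::euclidean_space measure"
  assumes \<mu>: "prob_space \<mu>" "sets \<mu> = sets borel"
    and \<nu>: "prob_space \<nu>" "sets \<nu> = sets borel"
    and R: "AE y in \<nu>. norm y \<le> R"
    and "has_barycentric_kernel \<mu> \<nu>"
  shows "has_density_coupling \<mu> \<nu>"
proof -
  obtain q where q: "nonneg_kernel q" and comp: "kernel_comp \<mu> q = \<nu>"
    and bary: "AE x in \<mu>. has_bochner_integral (q x) (\<lambda>y. y) x"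
    using assms(6) unfolding has_barycentric_kernel_def by blast
  have sets: "sets (q x) = sets borel" for x using q by (simp add: nonneg_kernel_def)
  have sp: "space (q x) = UNIV" for x using sets_eq_imp_space_eq[OF sets[of x]] by simp
  have sp\<mu>: "space \<mu> = UNIV" using sets_eq_imp_space_eq[OF \<mu>(2)] by simp
  have em\<nu>: "emeasure \<nu> A = (\<integral>\<^sup>+ x. emeasure (q x) A \<partial>\<mu>)" if "A \<in> sets borel" for A
    using emeasure_kernel_comp[OF q \<mu>(2) that] by (simp add: comp)
  define N where "N x = measure (q x) UNIV" for x
  have N0: "0 \<le> N x" for x by (simp add: N_def)
  have Nm[measurable]: "N \<in> borel_measurable borel" unfolding N_def by (rule borel_measurable_kernel_mass[OF q])
  have Nm\<mu>[measurable]: "N \<in> borel_measurable \<mu>" using \<mu>(2) Nm by (simp cong: measurable_cong_sets)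
  have id\<mu>[measurable]: "(\<lambda>x. x) \<in> measurable \<mu> borel" using \<mu>(2) by (simp cong: measurable_cong_sets)
  have emq: "emeasure (q x) UNIV = ennreal (N x)" for x
    unfolding N_def by (rule emeasure_kernel_mass[OF q])
  \<comment> \<open>A null measure has barycenter \<open>0\<close>.\<close>
  have Nz: "AE x in \<mu>. N x = 0 \<longrightarrow> x = 0"
    using bary
  proof eventually_elim
    case (elim x)
    show ?case
    proof
      assume "N x = 0"
      then have "UNIV \<in> null_sets (q x)" using emq[of x] by (simp add: null_sets_def sets)
      then have "AE y in q x. y = 0" by (rule AE_I') simp
      then have "(\<integral>y. y \<partial>q x) = 0" by (rule integral_eq_zero_AE)
      then show "x = 0" using has_bochner_integral_integral_eq[OF elim] by simp
    qed
  qed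
  define \<eta> where "\<eta> = density \<mu> (\<lambda>x. ennreal (N x))"
  have s\<eta>: "sets \<eta> = sets borel" by (simp add: \<eta>_def \<mu>(2))
  let ?B = "borel \<Otimes>\<^sub>M borel :: ('a \<times> 'a) measure"
  define \<kappa> where "\<kappa> x = distr (q x) ?B (Pair x)" for x
  define M where "M = mixture \<mu> \<kappa> ?B"
  have Px[measurable]: "Pair x \<in> measurable (q x) ?B" for x
    using sets by (simp cong: measurable_cong_sets)
  have "is_mixture \<mu> \<kappa> (mixture \<mu> \<kappa> ?B)"
  proof (rule is_mixture_mixture)
    show "sets (\<kappa> x) = sets ?B" for x by (simp add: \<kappa>_def)
    show "(\<lambda>x. emeasure (\<kappa> x) A) \<in> borel_measurable \<mu>" if "A \<in> sets ?B" for A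
      using measurable_emeasure_kernel_section[OF q that] \<mu>(2) by (simp add: \<kappa>_def cong: measurable_cong_sets)
  qed
  then have mix: "is_mixture \<mu> \<kappa> M" by (simp add: M_def)
  have sM: "sets M = sets ?B" by (simp add: M_def)
  have spM: "space M = UNIV" by (simp add: M_def space_pair_measure)
  have emM: "emeasure M A = (\<integral>\<^sup>+ x. emeasure (q x) (Pair x -` A) \<partial>\<mu>)" if "A \<in> sets ?B" for A
  proof -
    have "emeasure M A = (\<integral>\<^sup>+ x. emeasure (\<kappa> x) A \<partial>\<mu>)" using mix that by (simp add: is_mixture_def sM)
    also have "\<dots> = (\<integral>\<^sup>+ x. emeasure (q x) (Pair x -` A) \<partial>\<mu>)"
      using that by (simp add: \<kappa>_def emeasure_distr sp)
    finally show ?thesis .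
  qed
  have fst: "fst \<in> measurable M borel" and snd: "snd \<in> measurable M borel"
    using sM by (simp_all cong: measurable_cong_sets)
  have vim: "fst -` A \<in> sets ?B" "snd -` A \<in> sets ?B" if "A \<in> sets borel" for A :: "'a set"
    using measurable_sets[OF fst that] measurable_sets[OF snd that] by (simp_all add: sM spM)
  have dU: "distr M borel fst = \<eta>"
  proof (rule measure_eqI)
    fix A assume "A \<in> sets (distr M borel fst)"
    then have A: "A \<in> sets borel" by simp
    have "emeasure (distr M borel fst) A = (\<integral>\<^sup>+ x. emeasure (q x) (Pair x -` (fst -` A)) \<partial>\<mu>)"
      unfolding emeasure_distr[OF fst A] spM Int_UNIV_right by (rule emM[OF vim(1)[OF A]])
    also have "\<dots> = (\<integral>\<^sup>+ x. ennreal (N x) * indicator A x \<partial>\<mu>)"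
      by (intro nn_integral_cong) (auto simp: indicator_def emq vimage_def)
    also have "\<dots> = emeasure \<eta> A" unfolding \<eta>_def using A \<mu>(2) by (simp add: emeasure_density)
    finally show "emeasure (distr M borel fst) A = emeasure \<eta> A" .
  qed (simp add: s\<eta>)
  have dV: "distr M borel snd = \<nu>"
  proof (rule measure_eqI)
    fix A assume "A \<in> sets (distr M borel snd)"
    then have A: "A \<in> sets borel" by simp
    have "emeasure (distr M borel snd) A = (\<integral>\<^sup>+ x. emeasure (q x) (Pair x -` (snd -` A)) \<partial>\<mu>)"
      unfolding emeasure_distr[OF snd A] spM Int_UNIV_right by (rule emM[OF vim(2)[OF A]])
    also have "\<dots> = emeasure \<nu> A" by (simp add: em\<nu>[OF A] vimage_def)
    finally show "emeasure (distr M borel snd) A = emeasure \<nu> A" .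
  qed (simp add: \<nu>(2))
  have pM: "prob_space M" using \<nu>(1) snd unfolding dV[symmetric] by (rule prob_space_distrD[rotated])
  interpret M: prob_space M by fact
  have p\<eta>: "prob_space \<eta>" unfolding dU[symmetric] by (rule M.prob_space_distr[OF fst])
  define F where "F = vimage_algebra (space M) fst (borel :: 'a measure)"
  have sub: "subalgebra M F"
    unfolding subalgebra_def F_def sets_vimage_algebra space_vimage_algebra
    by (intro conjI refl sets.sigma_sets_subset subsetI)
      (elim CollectE exE conjE, simp only: measurable_sets[OF fst])
  interpret F: finite_measure_subalgebra M F
    by unfold_locales (rule sub)
  have VR: "AE \<omega> in M. norm (snd \<omega>) \<le> R"
    using R unfolding dV[symmetric] by (rule AE_distrD[OF snd])
  have Vb: "integrable M (\<lambda>\<omega>. snd \<omega> \<bullet> b)" for b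
  proof -
    have "integrable M snd" by (rule M.integrable_const_bound[OF VR snd])
    then show ?thesis by simp
  qed
  have inner_int: "(\<integral>\<omega>. f \<omega> \<partial>\<kappa> x) = (\<integral>y. f (x, y) \<partial>q x)" if "f \<in> borel_measurable ?B" for f :: "'a \<times> 'a \<Rightarrow> real" and x
    unfolding \<kappa>_def using that by (intro integral_distr) auto
  have set_int: "has_bochner_integral \<mu> (\<lambda>x. indicator A x * (x \<bullet> b)) (\<integral>\<omega>. indicator A (fst \<omega>) * (snd \<omega> \<bullet> b) \<partial>M)"
    if A: "A \<in> sets borel" for A b
  proof -
    have [measurable]: "A \<in> sets borel" by fact
    have int: "integrable M (\<lambda>\<omega>. indicator A (fst \<omega>) * (snd \<omega> \<bullet> b))"
    proof (rule Bochner_Integration.integrable_bound[OF Vb[of b]])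
      have "(\<lambda>\<omega>. indicator A (fst \<omega>) * (snd \<omega> \<bullet> b)) \<in> borel_measurable ?B" by measurable
      then show "(\<lambda>\<omega>. indicator A (fst \<omega>) * (snd \<omega> \<bullet> b)) \<in> borel_measurable M"
        using sM by (simp cong: measurable_cong_sets)
      show "AE \<omega> in M. norm (indicator A (fst \<omega>) * (snd \<omega> \<bullet> b)) \<le> norm (snd \<omega> \<bullet> b)"
        by (rule AE_I2) (simp add: indicator_def)
    qed
    show ?thesis
    proof (rule has_bochner_integral_cong_AE[THEN iffD1, OF _ _ _ integral_is_mixture(2)[OF mix int]])
      show "(\<lambda>x. indicator A x * (x \<bullet> b)) \<in> borel_measurable \<mu>" by measurable
      show "(\<lambda>x. \<integral>\<omega>. indicator A (fst \<omega>) * (snd \<omega> \<bullet> b) \<partial>\<kappa> x) \<in> borel_measurable \<mu>"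
        by (rule borel_measurable_has_bochner_integral[OF integral_is_mixture(2)[OF mix int]])
      show "AE x in \<mu>. (\<integral>\<omega>. indicator A (fst \<omega>) * (snd \<omega> \<bullet> b) \<partial>\<kappa> x) = indicator A x * (x \<bullet> b)"
        using bary
      proof eventually_elim
        case (elim x)
        have "(\<integral>\<omega>. indicator A (fst \<omega>) * (snd \<omega> \<bullet> b) \<partial>\<kappa> x)
            = (\<integral>y. indicator A (fst (x, y)) * (snd (x, y) \<bullet> b) \<partial>q x)"
          by (rule inner_int) measurable
        also have "\<dots> = (\<integral>y. indicator A x * (y \<bullet> b) \<partial>q x)" by (simp only: fst_conv snd_conv)
        also have "\<dots> = indicator A x * (x \<bullet> b)"
          using has_bochner_integral_integral_eq[OF has_bochner_integral_inner_left[OF elim, of b]]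
          by simp
        finally show ?case .
      qed
    qed
  qed
  have \<mu>b: "integrable \<mu> (\<lambda>x. x \<bullet> b)" for b
    using integrable.intros[OF set_int[of UNIV b]] by simp
  have dens: "AE x in \<mu>. N x * (x \<bullet> b / N x) = x \<bullet> b" for b
    using Nz by eventually_elim auto
  have Ub: "integrable M (\<lambda>\<omega>. fst \<omega> \<bullet> b / N (fst \<omega>))" for b
  proof -
    have "integrable \<mu> (\<lambda>x. N x * (x \<bullet> b / N x))"
      by (rule integrable_cong_AE[THEN iffD2, OF _ _ dens \<mu>b]) measurable
    then have "integrable \<eta> (\<lambda>x. x \<bullet> b / N x)"
      unfolding \<eta>_def by (subst integrable_density) (auto simp: N0)
    then show ?thesis unfolding dU[symmetric] by (subst (asm) integrable_distr_eq[OF fst]) auto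
  qed
  have ce: "AE \<omega> in M. real_cond_exp M F (\<lambda>\<omega>. snd \<omega> \<bullet> b) \<omega> = fst \<omega> \<bullet> b / N (fst \<omega>)" for b
  proof (rule F.real_cond_exp_charact[OF _ Vb Ub])
    have "fst \<in> measurable F borel" unfolding F_def by (rule measurable_vimage_algebra1) simp
    then show "(\<lambda>\<omega>. fst \<omega> \<bullet> b / N (fst \<omega>)) \<in> borel_measurable F" by measurable
    fix X assume "X \<in> sets F"
    then obtain A where A[measurable]: "A \<in> sets borel" and X: "X = fst -` A"
      unfolding F_def by (auto simp: sets_vimage_algebra2 spM)
    have ind: "indicator X \<omega> = (indicator A (fst \<omega>) :: real)" for \<omega> by (simp add: X indicator_def)
    have "(\<integral>\<omega>\<in>X. snd \<omega> \<bullet> b \<partial>M) = (\<integral>x. indicator A x * (x \<bullet> b) \<partial>\<mu>)"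
      using has_bochner_integral_integral_eq[OF set_int[OF A, of b]]
      by (simp add: set_lebesgue_integral_def ind)
    also have "\<dots> = (\<integral>x. N x *\<^sub>R (indicator A x * (x \<bullet> b / N x)) \<partial>\<mu>)"
    proof (rule integral_cong_AE)
      show "AE x in \<mu>. indicator A x * (x \<bullet> b) = N x *\<^sub>R (indicator A x * (x \<bullet> b / N x))"
        using dens[of b] by eventually_elim (auto simp: mult.left_commute)
    qed auto
    also have "\<dots> = (\<integral>x. indicator A x * (x \<bullet> b / N x) \<partial>\<eta>)"
      unfolding \<eta>_def using N0 by (intro integral_density[symmetric]) auto
    also have "\<dots> = (\<integral>\<omega>. indicator A (fst \<omega>) * (fst \<omega> \<bullet> b / N (fst \<omega>)) \<partial>M)"
      unfolding dU[symmetric] by (rule integral_distr[OF fst]) measurable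
    also have "\<dots> = (\<integral>\<omega>\<in>X. fst \<omega> \<bullet> b / N (fst \<omega>) \<partial>M)"
      by (simp add: set_lebesgue_integral_def ind)
    finally show "(\<integral>\<omega>\<in>X. snd \<omega> \<bullet> b \<partial>M) = (\<integral>\<omega>\<in>X. fst \<omega> \<bullet> b / N (fst \<omega>) \<partial>M)" .
  qed
  have Npos: "AE \<omega> in M. N (fst \<omega>) \<noteq> 0"
  proof -
    have "AE x in \<eta>. N x \<noteq> 0" unfolding \<eta>_def by (subst AE_density) auto
    then show ?thesis unfolding dU[symmetric] by (rule AE_distrD[OF fst])
  qed
  have "AE \<omega> in M. \<forall>b\<in>Basis. real_cond_exp M F (\<lambda>\<omega>. snd \<omega> \<bullet> b) \<omega> = fst \<omega> \<bullet> b / N (fst \<omega>)"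
    using ce by (intro AE_finite_allI) auto
  with Npos have "AE \<omega> in M. N (fst \<omega>) *\<^sub>R vec_cond_exp M fst snd \<omega> = fst \<omega>"
  proof eventually_elim
    case (elim \<omega>)
    have "N (fst \<omega>) *\<^sub>R vec_cond_exp M fst snd \<omega> = (\<Sum>b\<in>Basis. (fst \<omega> \<bullet> b) *\<^sub>R b)"
      using elim by (simp add: vec_cond_exp_def scaleR_sum_right flip: F_def)
    then show ?case by (simp add: euclidean_representation)
  qed
  moreover have "absolutely_continuous \<mu> \<eta>"
    unfolding \<eta>_def by (rule absolutely_continuousI_density) simp
  ultimately show ?thesis
    unfolding has_density_coupling_def
    using p\<eta> s\<eta> Nm N0 Nz pM fst snd dU dV \<eta>_def by blast
qed

section \<open>Almost everywhere convergence by convexity\<close>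

lemma AE_summable_of_summable_integrals:
  fixes d :: "nat \<Rightarrow> 'a \<Rightarrow> real"
  assumes [measurable]: "\<And>n. d n \<in> borel_measurable M"
    and le: "\<And>n. (\<integral>\<^sup>+ x. ennreal \<bar>d n x\<bar> \<partial>M) \<le> ennreal (c n)"
    and c: "summable c" "\<And>n. 0 \<le> c n"
  shows "AE x in M. summable (\<lambda>n. \<bar>d n x\<bar>)"
proof -
  have "(\<integral>\<^sup>+ x. (\<Sum>n. ennreal \<bar>d n x\<bar>) \<partial>M) = (\<Sum>n. \<integral>\<^sup>+ x. ennreal \<bar>d n x\<bar> \<partial>M)"
    by (intro nn_integral_suminf) measurable
  also have "\<dots> \<le> (\<Sum>n. ennreal (c n))" by (intro suminf_le le) auto
  also have "\<dots> = ennreal (\<Sum>n. c n)" using c by (intro suminf_ennreal2) auto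
  also have "\<dots> < \<infinity>" by simp
  finally have "AE x in M. (\<Sum>n. ennreal \<bar>d n x\<bar>) \<noteq> \<infinity>"
    by (intro nn_integral_PInf_AE) auto
  then show ?thesis
  proof eventually_elim
    case (elim x)
    then show ?case by (intro summable_suminf_not_top) auto
  qed
qed

lemma convergent_of_summable_differences:
  fixes f :: "nat \<Rightarrow> real"
  assumes "summable (\<lambda>n. \<bar>f (Suc n) - f n\<bar>)"
  shows "convergent f"
proof -
  have "summable (\<lambda>n. f (Suc n) - f n)"
    using assms by (rule summable_rabs_cancel)
  then have "convergent (\<lambda>n. \<Sum>i<n. f (Suc i) - f i)"
    by (simp add: summable_iff_convergent)
  then have "convergent (\<lambda>n. (f n - f 0) + f 0)"
    unfolding sum_lessThan_telescope by (intro convergent_add convergent_const)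
  then show ?thesis by simp
qed

text \<open>Twice the defect in the convexity of \<open>exp (- a)\<close> at a midpoint, as a perfect square.\<close>

lemma exp_midpoint_gap:
  fixes a b :: real
  shows "(exp (- a / 2) - exp (- b / 2))\<^sup>2 = exp (- a) + exp (- b) - 2 * exp (- ((a + b) / 2))"
proof -
  have "exp (- a) = exp (- a / 2) * exp (- a / 2)" "exp (- b) = exp (- b / 2) * exp (- b / 2)"
    "exp (- ((a + b) / 2)) = exp (- a / 2) * exp (- b / 2)"
    by (simp_all flip: exp_add add: field_simps)
  then show ?thesis by (simp add: power2_eq_square algebra_simps)
qed

text \<open>A Komlos-type lemma. Pick \<open>a n\<close> in the \<open>n\<close>-th set nearly minimising \<open>\<integral>exp (- a)\<close>. The midpoint of two
  near-minimisers cannot do much better than either, so by \<open>exp_midpoint_gap\<close> the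
  functions \<open>exp (- a n / 2)\<close> form a Cauchy sequence in \<open>L\<^sup>2\<close>. Along indices chosen to grow fast enough
  their differences are summable almost everywhere.\<close>

lemma komlos_type_convergence:
  fixes C :: "nat \<Rightarrow> ('a \<Rightarrow> real) set"
  assumes "prob_space M"
    and ne: "\<And>n. C n \<noteq> {}"
    and meas: "\<And>n a. a \<in> C n \<Longrightarrow> a \<in> borel_measurable M"
    and nonneg: "\<And>n a x. a \<in> C n \<Longrightarrow> 0 \<le> a x"
    and dec: "decseq C"
    and mid: "\<And>n a b. a \<in> C n \<Longrightarrow> b \<in> C n \<Longrightarrow> (\<lambda>x. (a x + b x) / 2) \<in> C n"
  shows "\<exists>a. (\<forall>n. a n \<in> C n) \<and> (AE x in M. convergent (\<lambda>n. exp (- a n x / 2)))"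
proof -
  interpret prob_space M by fact
  define J where "J a = (\<integral>x. exp (- a x) \<partial>M)" for a :: "'a \<Rightarrow> real"
  have int: "integrable M (\<lambda>x. exp (- a x))" if "a \<in> C n" for a n
    using meas[OF that] nonneg[OF that] by (intro integrable_const_bound[where B=1]) auto
  have J01: "0 \<le> J a" "J a \<le> 1" if "a \<in> C n" for a n
  proof -
    show "0 \<le> J a" unfolding J_def by (intro integral_nonneg_AE) simp
    have "J a \<le> (\<integral>x. 1 \<partial>M)" unfolding J_def
      using nonneg[OF that] by (intro integral_mono int[OF that]) auto
    then show "J a \<le> 1" by (simp add: prob_space)
  qed
  define I where "I n = (INF a\<in>C n. J a)" for n
  have bdd: "bdd_below (J ` C n)" for n using J01(1) by (auto intro!: bdd_belowI[of _ 0])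
  have I_le: "I n \<le> J a" if "a \<in> C n" for a n
    unfolding I_def using bdd that by (intro cINF_lower)
  have "incseq I"
    unfolding I_def using dec ne bdd
    by (intro incseq_SucI cINF_superset_mono) (auto simp: decseq_Suc_iff)
  moreover have "I n \<le> 1" for n
  proof -
    obtain a where "a \<in> C n" using ne by blast
    then show ?thesis using I_le[of a n] J01(2)[of a n] by simp
  qed
  ultimately obtain L where "I \<longlonglongrightarrow> L" "\<forall>n. I n \<le> L"
    by (metis incseq_convergent)
  then have L: "I \<longlonglongrightarrow> L" "\<And>n. I n \<le> L" by auto
  have "\<exists>s. \<forall>n\<ge>s. L - I n < (1/4)^k" for k
  proof -
    have "eventually (\<lambda>n. dist (I n) L < (1/4)^k) sequentially"
      using L(1) by (intro tendstoD) simp_all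
    then show ?thesis using L(2) by (force simp: eventually_sequentially dist_real_def)
  qed
  then obtain s where s: "\<And>k n. n \<ge> s k \<Longrightarrow> L - I n < (1/4)^k" by metis
  \<comment> \<open>Monotone indices, at least as large as the thresholds \<open>s n\<close>.\<close>
  define r where "r n = n + (\<Sum>i\<le>n. s i)" for n
  have r: "r n \<ge> n" "r n \<ge> s n" "r n \<le> r (Suc n)" for n
    unfolding r_def using member_le_sum[of n "{..n}" s] by auto
  have "\<exists>a. a \<in> C (r n) \<and> J a < I (r n) + (1/4)^n" for n
  proof -
    have "(INF a\<in>C (r n). J a) < I (r n) + (1/4)^n" unfolding I_def by simp
    then show ?thesis using ne bdd by (subst (asm) cINF_less_iff) auto
  qed
  then obtain a where a: "\<And>n. a n \<in> C (r n)" "\<And>n. J (a n) < I (r n) + (1/4)^n" by metis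
  have sub: "C n \<subseteq> C m" if "m \<le> n" for m n using dec that by (auto dest: decseqD)
  have aC: "a n \<in> C n" for n using a(1) sub[OF r(1)] by blast
  have aS: "a (Suc n) \<in> C (r n)" for n using a(1)[of "Suc n"] sub[OF r(3)] by blast
  have [measurable]: "a n \<in> borel_measurable M" for n using meas aC by blast
  define d where "d n x = exp (- a (Suc n) x / 2) - exp (- a n x / 2)" for n x
  have [measurable]: "d n \<in> borel_measurable M" for n unfolding d_def by measurable
  define m where "m n x = (a (Suc n) x + a n x) / 2" for n x
  have m: "m n \<in> C (r n)" for n unfolding m_def using mid aS a(1) by blast
  have d2: "(d n x)\<^sup>2 = exp (- a (Suc n) x) + exp (- a n x) - 2 * exp (- m n x)" for n x
    unfolding d_def m_def by (rule exp_midpoint_gap)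
  have d2int: "integrable M (\<lambda>x. (d n x)\<^sup>2)" for n
    unfolding d2 using int[OF aC] int[OF m] by simp
  have d2le: "(\<integral>x. (d n x)\<^sup>2 \<partial>M) \<le> 3 * (1/4)^n" for n
  proof -
    have "(\<integral>x. (d n x)\<^sup>2 \<partial>M) = J (a (Suc n)) + J (a n) - 2 * J (m n)"
      unfolding d2 J_def using int[OF aC] int[OF m] by simp
    moreover have "I (r n) \<le> J (m n)" by (rule I_le[OF m])
    moreover have "J (a (Suc n)) \<le> I (r (Suc n)) + (1/4)^Suc n" using a(2)[of "Suc n"] by simp
    moreover have "I (r (Suc n)) \<le> L" by (rule L(2))
    moreover have "L - I (r n) < (1/4)^n" by (rule s[OF r(2)])
    moreover have "J (a n) < I (r n) + (1/4)^n" by (rule a(2))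
    moreover have "(1/4::real)^Suc n \<le> (1/4)^n" by simp
    ultimately show ?thesis by linarith
  qed
  \<comment> \<open>The inequality of arithmetic and geometric means replaces the Cauchy-Schwarz inequality.\<close>
  have amgm: "\<bar>t\<bar> \<le> ((1/2)^n + 2^n * t\<^sup>2) / 2" for t :: real and n :: nat
  proof -
    have "0 \<le> (\<bar>t\<bar> * 2^n - 1)\<^sup>2 * (1/2)^n" by simp
    also have "\<dots> = t\<^sup>2 * 2^n * (2^n * (1/2)^n) - 2 * \<bar>t\<bar> * (2^n * (1/2)^n) + (1/2)^n"
      by (simp add: power2_eq_square algebra_simps)
    also have "2^n * (1/2)^n = (1::real)" by (simp flip: power_mult_distrib)
    finally show ?thesis by (simp add: mult.commute)
  qed
  have le: "(\<integral>\<^sup>+ x. ennreal \<bar>d n x\<bar> \<partial>M) \<le> ennreal (2 * (1/2)^n)" for n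
  proof -
    have i: "integrable M (\<lambda>x. ((1/2)^n + 2^n * (d n x)\<^sup>2) / 2)" using d2int by simp
    have "(\<integral>\<^sup>+ x. ennreal \<bar>d n x\<bar> \<partial>M) \<le> (\<integral>\<^sup>+ x. ennreal (((1/2)^n + 2^n * (d n x)\<^sup>2) / 2) \<partial>M)"
      by (intro nn_integral_mono ennreal_leI amgm)
    also have "\<dots> = ennreal (\<integral>x. ((1/2)^n + 2^n * (d n x)\<^sup>2) / 2 \<partial>M)"
      using i by (intro nn_integral_eq_integral) auto
    also have "(\<integral>x. ((1/2)^n + 2^n * (d n x)\<^sup>2) / 2 \<partial>M) = ((1/2)^n + 2^n * (\<integral>x. (d n x)\<^sup>2 \<partial>M)) / 2"
      using d2int by (simp add: prob_space)
    also have "\<dots> \<le> ((1/2)^n + 2^n * (3 * (1/4)^n)) / 2"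
      using d2le by (intro divide_right_mono add_left_mono mult_left_mono) auto
    also have "2^n * (3 * (1/4)^n) = 3 * (1/2::real)^n"
      by (simp flip: power_mult_distrib)
    also have "((1/2)^n + 3 * (1/2)^n) / 2 = 2 * (1/2::real)^n" by simp
    finally show ?thesis by (simp add: ennreal_leI)
  qed
  have "AE x in M. summable (\<lambda>n. \<bar>d n x\<bar>)"
    by (rule AE_summable_of_summable_integrals[OF _ le]) (auto intro!: summable_mult summable_geometric)
  then have "AE x in M. convergent (\<lambda>n. exp (- a n x / 2))"
    unfolding d_def by eventually_elim (rule convergent_of_summable_differences)
  with aC show ?thesis by blast
qed

text \<open>The only obstruction to convergence of the exponents is escape to infinity.\<close>

lemma convergent_of_exp_convergent:
  fixes a :: "nat \<Rightarrow> real"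
  assumes "convergent (\<lambda>n. exp (- a n / 2))" and "\<not> (\<lambda>n. exp (- a n / 2)) \<longlonglongrightarrow> 0"
  shows "convergent a"
proof -
  obtain l where l: "(\<lambda>n. exp (- a n / 2)) \<longlonglongrightarrow> l" using assms(1) by (auto simp: convergent_def)
  have "l \<noteq> 0" using l assms(2) by blast
  with l have "(\<lambda>n. ln (exp (- a n / 2))) \<longlonglongrightarrow> ln l" by (rule tendsto_ln)
  then have "(\<lambda>n. (-2) * (- a n / 2)) \<longlonglongrightarrow> (-2) * ln l" unfolding ln_exp by (rule tendsto_mult_left)
  then show ?thesis by (auto simp: convergent_def)
qed

section \<open>Duality for finitely many cells\<close>

text \<open>Each \<open>m i\<close> is to be approximated by the barycenter \<open>\<beta> f i\<close> that the weight \<open>f i\<close> cuts out of \<open>\<nu>\<close>.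
  Take a partition of unity \<open>f\<close> almost minimising the squared distance \<open>F f\<close>, put
  \<open>u i = m i - \<beta> f i\<close>, and move from \<open>f\<close> a little towards the partition \<open>g\<close> that assigns \<open>y\<close> to the
  indices maximising \<open>u i \<bullet> y\<close>. Near-minimality bounds the first-order gain
  \<open>\<Sum>i. u i \<bullet> (\<beta> g i - \<beta> f i)\<close> from above, whereas the hypothesis, applied to \<open>u\<close>, bounds it from below by
  \<open>F f\<close>.\<close>

lemma finite_transport_duality:
  fixes m :: "'i \<Rightarrow> 'a::euclidean_space" and \<nu> :: "'a measure"
  assumes "prob_space \<nu>" and sets: "sets \<nu> = sets borel"
    and R: "AE y in \<nu>. norm y \<le> R" "0 \<le> R"
    and I: "finite I" "I \<noteq> {}"
    and dual: "\<And>u. (\<Sum>i\<in>I. u i \<bullet> m i) \<le> (\<integral>y. Max ((\<lambda>i. u i \<bullet> y) ` I) \<partial>\<nu>)"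
    and e: "0 < (e::real)"
  shows "\<exists>f. (\<forall>i\<in>I. f i \<in> borel_measurable borel) \<and> (\<forall>i\<in>I. \<forall>y. 0 \<le> f i y) \<and>
    (\<forall>y. (\<Sum>i\<in>I. f i y) = 1) \<and> (\<Sum>i\<in>I. (norm ((\<integral>y. f i y *\<^sub>R y \<partial>\<nu>) - m i))\<^sup>2) \<le> e"
proof -
  interpret prob_space \<nu> by fact
  have id[measurable]: "(\<lambda>y. y) \<in> borel_measurable \<nu>"
    using sets by (simp cong: measurable_cong_sets)
  define P where "P = {f. (\<forall>i\<in>I. f i \<in> borel_measurable borel) \<and> (\<forall>i\<in>I. \<forall>y::'a. 0 \<le> f i y) \<and>
    (\<forall>y. (\<Sum>i\<in>I. f i y) = (1::real))}"
  define \<beta> where "\<beta> f i = (\<integral>y. f i y *\<^sub>R y \<partial>\<nu>)" for f :: "'i \<Rightarrow> 'a \<Rightarrow> real" and i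
  define F where "F f = (\<Sum>i\<in>I. (norm (\<beta> f i - m i))\<^sup>2)" for f
  have Pm: "f i \<in> borel_measurable \<nu>" if "f \<in> P" "i \<in> I" for f i
    using that sets by (auto simp: P_def cong: measurable_cong_sets)
  have P0: "0 \<le> f i y" if "f \<in> P" "i \<in> I" for f i y using that by (auto simp: P_def)
  have P1: "f i y \<le> 1" if "f \<in> P" "i \<in> I" for f i y
    using member_le_sum[of i I "\<lambda>i. f i y"] that I P0[OF that(1)] by (auto simp: P_def)
  have bd: "AE y in \<nu>. norm (f i y *\<^sub>R y) \<le> R" if "f \<in> P" "i \<in> I" for f i
    using R(1)
  proof eventually_elim
    case (elim y)
    have "\<bar>f i y\<bar> * norm y \<le> 1 * R" using P0[OF that, of y] P1[OF that, of y] elim by (intro mult_mono) auto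
    then show ?case by simp
  qed
  have int: "integrable \<nu> (\<lambda>y. f i y *\<^sub>R y)" if "f \<in> P" "i \<in> I" for f i
    using bd[OF that] Pm[OF that] by (intro integrable_const_bound) auto
  have \<beta>R: "norm (\<beta> f i) \<le> R" if "f \<in> P" "i \<in> I" for f i
  proof -
    have "norm (\<beta> f i) \<le> (\<integral>y. norm (f i y *\<^sub>R y) \<partial>\<nu>)"
      unfolding \<beta>_def by (rule integral_norm_bound)
    also have "\<dots> \<le> (\<integral>y. R \<partial>\<nu>)" using bd[OF that] int[OF that] by (intro integral_mono_AE integrable_norm) auto
    finally show ?thesis by (simp add: prob_space)
  qed
  define C where "C = real (card I) * (2 * R)\<^sup>2"
  have C0: "0 \<le> C" by (simp add: C_def)
  \<comment> \<open>The step size. \<open>C\<close> bounds the second-order term, and \<open>t * C \<le> e\<close>.\<close>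
  define t where "t = min 1 (e / (C + 1))"
  have t: "0 < t" "t \<le> 1" using e C0 by (auto simp: t_def)
  have tC: "t * C \<le> e"
  proof -
    have "t * C \<le> e / (C + 1) * (C + 1)" using C0 e by (intro mult_mono) (auto simp: t_def)
    then show ?thesis using C0 by simp
  qed
  have F0: "0 \<le> F f" for f unfolding F_def by (intro sum_nonneg) simp
  have bdd: "bdd_below (F ` P)" using F0 by (auto intro!: bdd_belowI[of _ 0])
  have "(\<lambda>i y. 1 / real (card I)) \<in> P" using I by (auto simp: P_def)
  then have Pne: "P \<noteq> {}" by blast
  have "(INF f\<in>P. F f) < (INF f\<in>P. F f) + t * e" using t e by simp
  then obtain f where f: "f \<in> P" and Ff: "F f < (INF f\<in>P. F f) + t * e"
    by (subst (asm) cINF_less_iff[OF Pne bdd]) auto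
  define u where "u i = m i - \<beta> f i" for i
  define \<phi> where "\<phi> y = Max ((\<lambda>i. u i \<bullet> y) ` I)" for y
  have [measurable]: "\<phi> \<in> borel_measurable borel"
    unfolding \<phi>_def using I by (intro borel_measurable_Max) auto
  define a where "a i y = (if u i \<bullet> y = \<phi> y then 1 else 0 :: real)" for i y
  \<comment> \<open>Ties are shared equally, which avoids a choice among the maximising indices.\<close>
  define g where "g i y = a i y / (\<Sum>j\<in>I. a j y)" for i y
  have am[measurable]: "a i \<in> borel_measurable borel" for i unfolding a_def by measurable
  have apos: "0 < (\<Sum>j\<in>I. a j y)" for y
  proof -
    have "\<phi> y \<in> (\<lambda>i. u i \<bullet> y) ` I" unfolding \<phi>_def using I by (intro Max_in) auto
    then obtain i where "i \<in> I" "\<phi> y = u i \<bullet> y" by blast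
    then show ?thesis using I by (intro sum_pos2[of I i]) (auto simp: a_def)
  qed
  have g: "g \<in> P"
    unfolding P_def
  proof (intro CollectI conjI ballI allI)
    show "g i \<in> borel_measurable borel" if "i \<in> I" for i unfolding g_def by measurable
    show "0 \<le> g i y" if "i \<in> I" for i y unfolding g_def using apos[of y] by (auto simp: a_def)
    show "(\<Sum>i\<in>I. g i y) = 1" for y
      unfolding g_def using apos[of y] by (simp flip: sum_divide_distrib)
  qed
  have ug: "(\<Sum>i\<in>I. u i \<bullet> (g i y *\<^sub>R y)) = \<phi> y" for y
  proof -
    have "(\<Sum>i\<in>I. u i \<bullet> (g i y *\<^sub>R y)) = (\<Sum>i\<in>I. \<phi> y * g i y)"
      by (intro sum.cong refl) (auto simp: g_def a_def)
    also have "\<dots> = \<phi> y * (\<Sum>i\<in>I. g i y)" by (simp add: sum_distrib_left)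
    finally show ?thesis using g by (auto simp: P_def)
  qed
  have "(\<Sum>i\<in>I. u i \<bullet> \<beta> g i) = (\<Sum>i\<in>I. \<integral>y. u i \<bullet> (g i y *\<^sub>R y) \<partial>\<nu>)"
    unfolding \<beta>_def using int[OF g] by (intro sum.cong refl integral_inner_right[symmetric]) auto
  also have "\<dots> = (\<integral>y. (\<Sum>i\<in>I. u i \<bullet> (g i y *\<^sub>R y)) \<partial>\<nu>)"
    using int[OF g] by (intro Bochner_Integration.integral_sum[symmetric] integrable_inner_right) auto
  also have "\<dots> = (\<integral>y. \<phi> y \<partial>\<nu>)" by (simp only: ug)
  finally have ubg: "(\<Sum>i\<in>I. u i \<bullet> m i) \<le> (\<Sum>i\<in>I. u i \<bullet> \<beta> g i)" using dual[of u] by (simp add: \<phi>_def)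
  define w where "w i = \<beta> g i - \<beta> f i" for i
  have "F f = (\<Sum>i\<in>I. u i \<bullet> u i)"
    unfolding F_def u_def by (simp add: power2_norm_eq_inner norm_minus_commute[of "\<beta> f _"])
  also have "\<dots> = (\<Sum>i\<in>I. u i \<bullet> m i) - (\<Sum>i\<in>I. u i \<bullet> \<beta> f i)"
    unfolding sum_subtractf[symmetric] by (simp add: u_def inner_diff_right)
  also have "\<dots> \<le> (\<Sum>i\<in>I. u i \<bullet> w i)"
    using ubg by (simp add: w_def inner_diff_right sum_subtractf)
  finally have Fle: "F f \<le> (\<Sum>i\<in>I. u i \<bullet> w i)" .
  have wC: "(\<Sum>i\<in>I. (norm (w i))\<^sup>2) \<le> C"
  proof -
    have "(norm (w i))\<^sup>2 \<le> (2 * R)\<^sup>2" if "i \<in> I" for i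
    proof (rule power_mono)
      have "norm (w i) \<le> norm (\<beta> g i) + norm (\<beta> f i)" unfolding w_def by (rule norm_triangle_ineq4)
      then show "norm (w i) \<le> 2 * R" using \<beta>R[OF g that] \<beta>R[OF f that] by simp
    qed simp
    then have "(\<Sum>i\<in>I. (norm (w i))\<^sup>2) \<le> (\<Sum>i\<in>I. (2 * R)\<^sup>2)" by (rule sum_mono)
    then show ?thesis by (simp add: C_def)
  qed
  define h where "h i y = (1 - t) * f i y + t * g i y" for i y
  have h: "h \<in> P"
    unfolding P_def
  proof (intro CollectI conjI ballI allI)
    show "h i \<in> borel_measurable borel" if "i \<in> I" for i
    proof -
      have [measurable]: "f i \<in> borel_measurable borel" "g i \<in> borel_measurable borel"
        using f g that by (auto simp: P_def)
      show ?thesis unfolding h_def by measurable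
    qed
    show "0 \<le> h i y" if "i \<in> I" for i y
      unfolding h_def using t P0[OF f that] P0[OF g that] by simp
    have "(\<Sum>i\<in>I. h i y) = (1 - t) * (\<Sum>i\<in>I. f i y) + t * (\<Sum>i\<in>I. g i y)" for y
      unfolding h_def by (simp add: sum.distrib sum_distrib_left)
    then show "(\<Sum>i\<in>I. h i y) = 1" for y using f g by (simp add: P_def)
  qed
  have \<beta>h: "\<beta> h i - m i = t *\<^sub>R w i - u i" if "i \<in> I" for i
  proof -
    have "\<beta> h i = (\<integral>y. (1 - t) *\<^sub>R (f i y *\<^sub>R y) + t *\<^sub>R (g i y *\<^sub>R y) \<partial>\<nu>)"
      unfolding \<beta>_def h_def by (simp add: scaleR_add_left)
    also have "\<dots> = (1 - t) *\<^sub>R \<beta> f i + t *\<^sub>R \<beta> g i"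
      unfolding \<beta>_def using int[OF f that] int[OF g that] by (simp del: scaleR_scaleR)
    finally show ?thesis by (simp add: w_def u_def algebra_simps)
  qed
  have "F h = (\<Sum>i\<in>I. t\<^sup>2 * (norm (w i))\<^sup>2 - 2 * t * (u i \<bullet> w i) + (norm (\<beta> f i - m i))\<^sup>2)"
    unfolding F_def
  proof (intro sum.cong refl)
    fix i assume i: "i \<in> I"
    have "(norm (\<beta> h i - m i))\<^sup>2 = (t *\<^sub>R w i - u i) \<bullet> (t *\<^sub>R w i - u i)"
      unfolding \<beta>h[OF i] by (rule power2_norm_eq_inner)
    also have "\<dots> = t\<^sup>2 * (w i \<bullet> w i) - 2 * t * (u i \<bullet> w i) + u i \<bullet> u i"
      by (simp add: inner_diff_left inner_diff_right inner_commute[of "w i" "u i"] power2_eq_square algebra_simps)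
    also have "u i \<bullet> u i = (norm (\<beta> f i - m i))\<^sup>2"
      unfolding u_def by (simp add: power2_norm_eq_inner norm_minus_commute[of "\<beta> f i"])
    finally show "(norm (\<beta> h i - m i))\<^sup>2 = t\<^sup>2 * (norm (w i))\<^sup>2 - 2 * t * (u i \<bullet> w i) + (norm (\<beta> f i - m i))\<^sup>2"
      by (simp add: power2_norm_eq_inner)
  qed
  also have "\<dots> = t\<^sup>2 * (\<Sum>i\<in>I. (norm (w i))\<^sup>2) - 2 * t * (\<Sum>i\<in>I. u i \<bullet> w i) + F f"
    unfolding F_def by (simp add: sum.distrib sum_subtractf sum_distrib_left)
  finally have Fh: "F h = t\<^sup>2 * (\<Sum>i\<in>I. (norm (w i))\<^sup>2) - 2 * t * (\<Sum>i\<in>I. u i \<bullet> w i) + F f" .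
  have "(INF f\<in>P. F f) \<le> F h" using bdd h by (rule cINF_lower)
  then have "2 * t * (\<Sum>i\<in>I. u i \<bullet> w i) \<le> t * e + t\<^sup>2 * (\<Sum>i\<in>I. (norm (w i))\<^sup>2)"
    using Ff Fh by linarith
  also have "\<dots> \<le> t * e + t\<^sup>2 * C" using wC by (intro add_left_mono mult_left_mono) auto
  also have "\<dots> = t * (e + t * C)" by (simp add: power2_eq_square algebra_simps)
  also have "\<dots> \<le> t * (2 * e)" using t tC by (intro mult_left_mono) auto
  finally have "t * (\<Sum>i\<in>I. u i \<bullet> w i) \<le> t * e" by simp
  then have "(\<Sum>i\<in>I. u i \<bullet> w i) \<le> e" using t by simp
  with Fle have "F f \<le> e" by simp
  then show ?thesis using f unfolding P_def F_def \<beta>_def by blast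
qed

section \<open>Weak compactness on a compact set\<close>

lemma summable_bounded_times_ternary:
  fixes d :: "nat \<Rightarrow> real"
  assumes "\<And>i. \<bar>d i\<bar> \<le> 1"
  shows "summable (\<lambda>i. d i * (1/3)^i)"
proof (rule summable_comparison_test')
  show "summable (\<lambda>i. (1/3::real)^i)" by (intro summable_geometric) simp
  show "norm (d i * (1/3)^i) \<le> (1/3)^i" if "0 \<le> i" for i
    using assms[of i] by (simp add: abs_mult mult_left_le_one_le)
qed

text \<open>The first nonzero digit outweighs all later ones together by half of its own weight.\<close>

lemma ternary_series_separates:
  fixes d :: "nat \<Rightarrow> real"
  assumes d: "\<And>i. d i \<in> {-1, 0, 1}"
    and less: "\<bar>\<Sum>i. d i * (1/3)^i\<bar> < (1/3)^N / 2"
  shows "\<forall>i<N. d i = 0"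
proof (rule ccontr)
  assume "\<not> ?thesis"
  then obtain k where k: "k < N" "d k \<noteq> 0" by blast
  define i where "i = (LEAST k. d k \<noteq> 0)"
  have di: "d i \<noteq> 0" unfolding i_def using k(2) by (rule LeastI)
  have iN: "i < N" unfolding i_def using Least_le[of "\<lambda>k. d k \<noteq> 0", OF k(2)] k(1) by simp
  have z: "d j = 0" if "j < i" for j using not_less_Least[of j "\<lambda>k. d k \<noteq> 0"] that by (auto simp: i_def)
  have d1: "\<bar>d j\<bar> \<le> 1" for j using d[of j] by auto
  have sm: "summable (\<lambda>i. d i * (1/3)^i)" using d1 by (rule summable_bounded_times_ternary)
  have head: "(\<Sum>j<Suc i. d j * (1/3)^j) = d i * (1/3)^i" using z by simp
  have split: "(\<Sum>i. d i * (1/3)^i) = (\<Sum>n. d (n + Suc i) * (1/3)^(n + Suc i)) + d i * (1/3)^i"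
    using suminf_split_initial_segment[OF sm, of "Suc i"] unfolding head .
  have geo: "(\<lambda>n. (1/3::real)^(n + Suc i)) sums ((1/3)^i / 2)"
  proof -
    have "(\<lambda>n. (1/3::real)^Suc i * (1/3)^n) sums ((1/3)^Suc i * (1 / (1 - 1/3)))"
      by (intro sums_mult geometric_sums) simp
    then show ?thesis by (simp add: power_add mult.commute)
  qed
  have "\<bar>\<Sum>n. d (n + Suc i) * (1/3)^(n + Suc i)\<bar> \<le> (\<Sum>n. (1/3)^(n + Suc i))"
  proof (rule order_trans[OF summable_rabs suminf_le])
    show "summable (\<lambda>n. \<bar>d (n + Suc i) * (1/3)^(n + Suc i)\<bar>)"
    proof (rule summable_comparison_test'[of _ 0, OF sums_summable[OF geo]])
      show "norm \<bar>d (n + Suc i) * (1/3)^(n + Suc i)\<bar> \<le> (1/3)^(n + Suc i)" for n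
        using d1[of "n + Suc i"] by (simp add: abs_mult mult_left_le_one_le del: power_Suc)
    qed
    then show "summable (\<lambda>n. \<bar>d (n + Suc i) * (1/3)^(n + Suc i)\<bar>)" .
    show "\<bar>d (n + Suc i) * (1/3)^(n + Suc i)\<bar> \<le> (1/3)^(n + Suc i)" for n
      using d1[of "n + Suc i"] by (simp add: abs_mult mult_left_le_one_le del: power_Suc)
    show "summable (\<lambda>n. (1/3::real)^(n + Suc i))" using geo by (rule sums_summable)
  qed
  also have "\<dots> = (1/3)^i / 2" using sums_unique[OF geo] by simp
  finally have tail: "\<bar>\<Sum>n. d (n + Suc i) * (1/3)^(n + Suc i)\<bar> \<le> (1/3)^i / 2" .
  have "\<bar>d i * (1/3)^i\<bar> = (1/3)^i" using di d[of i] by (auto simp: abs_mult)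
  then have "(1/3)^i / 2 \<le> \<bar>\<Sum>i. d i * (1/3)^i\<bar>" using split tail by linarith
  moreover have "(1/3::real)^N \<le> (1/3)^i" using iN by (intro power_decreasing) auto
  ultimately show False using less by linarith
qed

text \<open>A compact set is coded by real numbers whose ternary digits record membership in the sets of a
  countable basis. The code is only Borel, but its inverse is uniformly continuous: by compactness,
  finitely many digits determine a point up to \<open>e\<close>. So the inverse extends to a continuous map on
  the whole line.\<close>

lemma compact_borel_coding:
  fixes K :: "'a::euclidean_space set"
  assumes K: "compact K" "K \<subseteq> cball 0 R" and R: "0 \<le> R"
  obtains c :: "'a \<Rightarrow> real" and \<gamma> :: "real \<Rightarrow> 'a"
  where "c \<in> borel_measurable borel" "\<And>y. 0 \<le> c y \<and> c y \<le> 2"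
    "continuous_on UNIV \<gamma>" "\<And>z. norm (\<gamma> z) \<le> R" "\<And>y. y \<in> K \<Longrightarrow> \<gamma> (c y) = y"
proof -
  obtain \<B> :: "'a set set" where \<B>: "countable \<B>" "topological_basis \<B>"
    using ex_countable_basis by blast
  have \<B>ne: "\<B> \<noteq> {}"
    using topological_basisE[OF \<B>(2) open_UNIV UNIV_I] by blast
  define B where "B = from_nat_into \<B>"
  have Bin: "B i \<in> \<B>" for i unfolding B_def using \<B>ne by (rule from_nat_into)
  have Bop: "open (B i)" for i using topological_basis_open[OF \<B>(2) Bin] .
  have Bsurj: "\<exists>i. B i = U" if "U \<in> \<B>" for U
    unfolding B_def using from_nat_into_surj[OF \<B>(1) that] .
  define c where "c y = (\<Sum>i. indicator (B i) y * (1/3::real)^i)" for y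
  have sm: "summable (\<lambda>i. indicator (B i) y * (1/3::real)^i)" for y
    by (rule summable_bounded_times_ternary) (simp add: indicator_def)
  have cm: "c \<in> borel_measurable borel"
    unfolding c_def using Bop by (intro borel_measurable_suminf borel_measurable_times borel_measurable_indicator) auto
  have c02: "0 \<le> c y \<and> c y \<le> 2" for y
  proof
    show "0 \<le> c y" unfolding c_def by (intro suminf_nonneg sm) simp
    have "c y \<le> (\<Sum>i. (1/3::real)^i)"
      unfolding c_def by (intro suminf_le sm summable_geometric) (auto simp: indicator_def)
    also have "\<dots> = 3/2" by (subst suminf_geometric) auto
    finally show "c y \<le> 2" by simp
  qed
  \<comment> \<open>Uniform continuity of the inverse: \<open>K\<close> is covered by finitely many basis sets of diameter at
    most \<open>e\<close>, and agreement of the first \<open>N\<close> digits includes membership in these.\<close>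
  have uc: "\<exists>d>0. \<forall>y\<in>K. \<forall>y'\<in>K. dist (c y) (c y') < d \<longrightarrow> dist y y' < e" if e: "e > 0" for e
  proof -
    have "\<exists>i. y \<in> B i \<and> B i \<subseteq> ball y (e/2)" for y
    proof -
      have "y \<in> ball y (e/2)" using e by simp
      from topological_basisE[OF \<B>(2) open_ball this]
      obtain U where "U \<in> \<B>" "y \<in> U" "U \<subseteq> ball y (e/2)" by blast
      then show ?thesis using Bsurj by blast
    qed
    then obtain j where j: "\<And>y. y \<in> B (j y)" "\<And>y. B (j y) \<subseteq> ball y (e/2)" by metis
    have "K \<subseteq> (\<Union>y\<in>K. B (j y))" using j(1) by blast
    then obtain F where F: "F \<subseteq> K" "finite F" "K \<subseteq> (\<Union>y\<in>F. B (j y))"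
      by (rule compactE_image[OF K(1) Bop])
    define N where "N = Suc (\<Sum>y\<in>F. j y)"
    have jN: "j y < N" if "y \<in> F" for y
      using member_le_sum[of y F j] that F(2) by (simp add: N_def)
    show ?thesis
    proof (intro exI[of _ "(1/3)^N / 2"] conjI ballI impI)
      fix y y' assume y: "y \<in> K" "y' \<in> K" and d: "dist (c y) (c y') < (1/3)^N / 2"
      define \<delta> where "\<delta> i = indicator (B i) y - (indicator (B i) y' :: real)" for i
      have "c y - c y' = (\<Sum>i. \<delta> i * (1/3)^i)"
        unfolding c_def \<delta>_def by (subst suminf_diff[OF sm sm]) (simp add: left_diff_distrib)
      then have "\<forall>i<N. \<delta> i = 0"
        using d by (intro ternary_series_separates) (auto simp: \<delta>_def indicator_def dist_real_def)
      then have same: "y \<in> B i \<longleftrightarrow> y' \<in> B i" if "i < N" for i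
        using that by (force simp: \<delta>_def indicator_def split: if_splits)
      obtain z where z: "z \<in> F" "y \<in> B (j z)" using F(3) y(1) by blast
      then have "y' \<in> B (j z)" using same jN by blast
      then have "dist z y < e/2" "dist z y' < e/2" using z j(2)[of z] by auto
      then show "dist y y' < e" by (metis dist_commute dist_triangle_half_r)
    qed simp
  qed
  define \<gamma>0 where "\<gamma>0 = inv_into K c"
  have "inj_on c K"
  proof (rule inj_onI)
    fix y y' assume y: "y \<in> K" "y' \<in> K" "c y = c y'"
    show "y = y'"
    proof (rule ccontr)
      assume "y \<noteq> y'"
      then have "dist y y' > 0" by simp
      from uc[OF this] y show False by force
    qed
  qed
  then have inv: "\<gamma>0 (c y) = y" if "y \<in> K" for y using that by (simp add: \<gamma>0_def)
  have "uniformly_continuous_on (c ` K) \<gamma>0"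
    unfolding uniformly_continuous_on_def
  proof (intro allI impI)
    fix e :: real assume "0 < e"
    from uc[OF this] obtain d where d: "d > 0" "\<And>y y'. y \<in> K \<Longrightarrow> y' \<in> K \<Longrightarrow> dist (c y) (c y') < d \<Longrightarrow> dist y y' < e"
      by blast
    then show "\<exists>d>0. \<forall>x\<in>c ` K. \<forall>x'\<in>c ` K. dist x' x < d \<longrightarrow> dist (\<gamma>0 x') (\<gamma>0 x) < e"
      by (intro exI[of _ d]) (auto simp: inv)
  qed
  then obtain \<gamma>1 where \<gamma>1: "uniformly_continuous_on (closure (c ` K)) \<gamma>1" "\<And>x. x \<in> c ` K \<Longrightarrow> \<gamma>0 x = \<gamma>1 x"
    by (rule uniformly_continuous_on_extension_on_closure) blast
  have cont: "continuous_on (closure (c ` K)) \<gamma>1" using \<gamma>1(1) by (rule uniformly_continuous_imp_continuous)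
  have "\<gamma>1 ` closure (c ` K) \<subseteq> cball 0 R"
  proof (rule image_closure_subset[OF cont closed_cball])
    show "\<gamma>1 ` (c ` K) \<subseteq> cball 0 R" using K(2) \<gamma>1(2) inv by fastforce
  qed
  then have bd: "norm (\<gamma>1 z) \<le> R" if "z \<in> closure (c ` K)" for z using that by auto
  obtain \<gamma> where \<gamma>: "continuous_on UNIV \<gamma>" "\<And>z. z \<in> closure (c ` K) \<Longrightarrow> \<gamma> z = \<gamma>1 z"
    "\<And>z. z \<in> UNIV \<Longrightarrow> norm (\<gamma> z) \<le> R"
    by (rule Tietze[OF cont _ R bd, of UNIV]) auto
  show ?thesis
  proof (rule that[OF cm c02 \<gamma>(1)])
    show "norm (\<gamma> z) \<le> R" for z using \<gamma>(3) by simp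
    show "\<gamma> (c y) = y" if "y \<in> K" for y
      using \<gamma>(2)[of "c y"] \<gamma>1(2)[of "c y"] inv[OF that] that closure_subset[of "c ` K"] by auto
  qed
qed

text \<open>The coding transports the measures to the line, where Helly's selection theorem applies. Since the
  decoding map is continuous, weak convergence on the line gives weak convergence in the
  original space.\<close>

lemma compact_weak_subsequence:
  fixes m :: "nat \<Rightarrow> 'a::euclidean_space measure"
  assumes K: "compact K" "K \<subseteq> cball 0 R" and R: "0 \<le> R"
    and prob: "\<And>n. prob_space (m n)" and sets: "\<And>n. sets (m n) = sets borel"
    and mK: "\<And>n. AE y in m n. y \<in> K"
  obtains r and L :: "'a measure" where "strict_mono (r :: nat \<Rightarrow> nat)" "prob_space L" "sets L = sets borel"
    "AE y in L. norm y \<le> R"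
    "\<And>g :: 'a \<Rightarrow> real. continuous_on UNIV g \<Longrightarrow> (\<lambda>n. \<integral>y. g y \<partial>m (r n)) \<longlonglongrightarrow> (\<integral>y. g y \<partial>L)"
proof -
  obtain c :: "'a \<Rightarrow> real" and \<gamma> :: "real \<Rightarrow> 'a"
    where cm[measurable]: "c \<in> borel_measurable borel" and c02: "\<And>y. 0 \<le> c y \<and> c y \<le> 2"
    and \<gamma>: "continuous_on UNIV \<gamma>" "\<And>z. norm (\<gamma> z) \<le> R" "\<And>y. y \<in> K \<Longrightarrow> \<gamma> (c y) = y"
    by (rule compact_borel_coding[OF K R]) blast
  have \<gamma>m[measurable]: "\<gamma> \<in> borel_measurable borel" using \<gamma>(1) by (rule borel_measurable_continuous_onI)
  have cmn: "c \<in> measurable (m n) borel" for n using sets cm by (simp cong: measurable_cong_sets)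
  define p where "p n = distr (m n) borel c" for n
  have rd: "real_distribution (p n)" for n
    unfolding real_distribution_def real_distribution_axioms_def p_def
    using prob_space.prob_space_distr[OF prob cmn] by simp
  have "tight p"
    unfolding tight_def
  proof (intro conjI allI impI rd)
    fix \<epsilon> :: real assume \<epsilon>: "\<epsilon> > 0"
    have "measure (p n) {-1<..3} = 1" for n
    proof -
      have "-1 < c y" "c y \<le> 3" for y using c02[of y] by linarith+
      then have eq: "c -` {-1<..3} = UNIV" by auto
      have "measure (p n) {-1<..3} = measure (m n) (space (m n))"
        unfolding p_def using cmn by (subst measure_distr) (auto simp: eq)
      then show ?thesis using prob_space.prob_space[OF prob] by simp
    qed
    then show "\<exists>a b. a < b \<and> (\<forall>n. 1 - \<epsilon> < measure (p n) {a<..b})"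
      using \<epsilon> by (intro exI[of _ "-1"] exI[of _ 3]) auto
  qed
  from tight_imp_convergent_subsubsequence[OF this strict_mono_id]
  obtain r M where r: "strict_mono (r :: nat \<Rightarrow> nat)" and M: "real_distribution M" and wc: "weak_conv_m (p \<circ> id \<circ> r) M"
    by blast
  interpret M: real_distribution M by fact
  have \<gamma>M: "\<gamma> \<in> measurable M borel" using \<gamma>m by (simp cong: measurable_cong_sets)
  define L where "L = distr M borel \<gamma>"
  show ?thesis
  proof (rule that[OF r])
    show "prob_space L" unfolding L_def using \<gamma>M by (rule M.prob_space_distr)
    show "sets L = sets borel" by (simp add: L_def)
    show "AE y in L. norm y \<le> R" unfolding L_def using \<gamma>M \<gamma>(2) by (subst AE_distr_iff) auto
    fix g :: "'a \<Rightarrow> real" assume g: "continuous_on UNIV g"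
    have gm[measurable]: "g \<in> borel_measurable borel" using g by (rule borel_measurable_continuous_onI)
    have "compact (g ` cball 0 R)"
      using g by (intro compact_continuous_image) (auto intro: continuous_on_subset)
    then have "bounded (g ` cball 0 R)" by (rule compact_imp_bounded)
    then obtain B where B: "\<And>y. norm y \<le> R \<Longrightarrow> norm (g y) \<le> B"
      unfolding bounded_iff by fastforce
    have "continuous_on UNIV (\<lambda>z. g (\<gamma> z))"
      by (rule continuous_on_compose2[OF g \<gamma>(1)]) simp
    then have ic: "isCont (\<lambda>z. g (\<gamma> z)) z" for z by (simp add: continuous_on_eq_continuous_at)
    have "(\<lambda>n. \<integral>z. g (\<gamma> z) \<partial>p (r n)) \<longlonglongrightarrow> (\<integral>z. g (\<gamma> z) \<partial>M)"
    proof -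
      have "(\<lambda>n. \<integral>z. g (\<gamma> z) \<partial>(p \<circ> id \<circ> r) n) \<longlonglongrightarrow> (\<integral>z. g (\<gamma> z) \<partial>M)"
        using rd by (intro weak_conv_imp_integral_bdd_continuous_conv[OF _ M wc ic B] \<gamma>(2)) simp
      then show ?thesis by simp
    qed
    moreover have "(\<integral>z. g (\<gamma> z) \<partial>p n) = (\<integral>y. g y \<partial>m n)" for n
    proof -
      have "(\<integral>z. g (\<gamma> z) \<partial>p n) = (\<integral>y. g (\<gamma> (c y)) \<partial>m n)"
        unfolding p_def using cmn by (intro integral_distr) auto
      also have "\<dots> = (\<integral>y. g y \<partial>m n)"
      proof (rule integral_cong_AE)
        show "AE y in m n. g (\<gamma> (c y)) = g y" using mK[of n] by eventually_elim (simp add: \<gamma>(3))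
      qed (use sets in \<open>simp_all cong: measurable_cong_sets\<close>)
      finally show ?thesis .
    qed
    moreover have "(\<integral>z. g (\<gamma> z) \<partial>M) = (\<integral>y. g y \<partial>L)"
      unfolding L_def using \<gamma>M by (intro integral_distr[symmetric]) auto
    ultimately show "(\<lambda>n. \<integral>y. g y \<partial>m (r n)) \<longlonglongrightarrow> (\<integral>y. g y \<partial>L)" by simp
  qed
qed

section \<open>Approximately barycentric kernels\<close>

text \<open>Such simple functions are part of the definition of the Bochner integral.\<close>

lemma (in finite_measure) simple_approximation_L1:
  fixes f :: "'a \<Rightarrow> 'b::{banach, second_countable_topology}"
  assumes f: "integrable M f" and e: "0 < e"
  shows "\<exists>s. simple_function M s \<and> integrable M (\<lambda>x. norm (f x - s x)) \<and> (\<integral>x. norm (f x - s x) \<partial>M) \<le> e"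
proof -
  obtain s where s: "\<And>i. Bochner_Integration.simple_bochner_integrable M (s i)"
    and lim: "(\<lambda>i. \<integral>\<^sup>+ x. norm (f x - s i x) \<partial>M) \<longlonglongrightarrow> 0"
    using has_bochner_integral_integrable[OF f] by (cases) blast
  have "eventually (\<lambda>i. (\<integral>\<^sup>+ x. norm (f x - s i x) \<partial>M) < ennreal e) sequentially"
    using lim e by (intro order_tendstoD(2)) auto
  then obtain i where i: "(\<integral>\<^sup>+ x. norm (f x - s i x) \<partial>M) < ennreal e"
    by (auto simp: eventually_sequentially)
  have sf: "simple_function M (s i)" using s[of i] by (auto elim: Bochner_Integration.simple_bochner_integrable.cases)
  have [measurable]: "s i \<in> borel_measurable M" "f \<in> borel_measurable M"
    using sf f by (auto intro: borel_measurable_simple_function)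
  have int: "integrable M (\<lambda>x. norm (f x - s i x))"
    using i by (intro integrableI_bounded) (auto intro: less_trans)
  have "ennreal (\<integral>x. norm (f x - s i x) \<partial>M) < ennreal e"
    using i int by (subst nn_integral_eq_integral[symmetric]) auto
  then show ?thesis using sf int e by (auto simp: ennreal_less_iff intro!: exI[of _ "s i"])
qed

locale transport_setting =
  fixes \<mu> \<nu> :: "'a::euclidean_space measure" and K :: "'a set" and R :: real
  assumes prob_\<mu>: "prob_space \<mu>" and sets_\<mu>: "sets \<mu> = sets borel"
    and int_\<mu>: "integrable \<mu> (\<lambda>x. x)"
    and prob_\<nu>: "prob_space \<nu>" and sets_\<nu>: "sets \<nu> = sets borel"
    and K: "compact K" "K \<subseteq> cball 0 R" and R: "0 \<le> R"
    and AE_K: "AE y in \<nu>. y \<in> K"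
begin

sublocale \<mu>: prob_space \<mu> by (rule prob_\<mu>)
sublocale \<nu>: prob_space \<nu> by (rule prob_\<nu>)
sublocale pair_sigma_finite \<mu> \<nu> ..

lemma space_\<mu> [simp]: "space \<mu> = UNIV" and space_\<nu> [simp]: "space \<nu> = UNIV"
  using sets_eq_imp_space_eq[OF sets_\<mu>] sets_eq_imp_space_eq[OF sets_\<nu>] by simp_all

lemma measurable_\<mu>: "f \<in> measurable \<mu> N \<longleftrightarrow> f \<in> measurable borel N"
  using sets_\<mu> by (simp cong: measurable_cong_sets)

lemma measurable_\<nu>: "f \<in> measurable \<nu> N \<longleftrightarrow> f \<in> measurable borel N"
  using sets_\<nu> by (simp cong: measurable_cong_sets)

lemma AE_R: "AE y in \<nu>. norm y \<le> R"
  using AE_K by eventually_elim (use K(2) in auto)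

lemma prob_UNIV [simp]: "measure \<mu> UNIV = 1" "measure \<nu> UNIV = 1"
  using \<mu>.prob_space \<nu>.prob_space by simp_all

text \<open>Kernels of the form \<open>k x y \<nu>(dy)\<close>; boundedness makes every integral below finite.\<close>

definition bounded_density :: "('a \<Rightarrow> 'a \<Rightarrow> real) \<Rightarrow> bool" where
  "bounded_density k \<longleftrightarrow> case_prod k \<in> borel_measurable (borel \<Otimes>\<^sub>M borel) \<and>
     (\<forall>x y. 0 \<le> k x y) \<and> (\<exists>C. \<forall>x y. k x y \<le> C)"

lemma bounded_density_sections:
  assumes "bounded_density k"
  shows "(\<lambda>y. k x y) \<in> borel_measurable borel" "(\<lambda>x. k x y) \<in> borel_measurable borel"
proof -
  have k: "case_prod k \<in> borel_measurable (borel \<Otimes>\<^sub>M borel)"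
    using assms by (simp add: bounded_density_def)
  show "(\<lambda>y. k x y) \<in> borel_measurable borel"
    using measurable_compose[OF measurable_Pair1' k, of x] by simp
  show "(\<lambda>x. k x y) \<in> borel_measurable borel"
    using measurable_compose[OF measurable_Pair2' k, of y] by simp
qed

lemma integrable_density_left:
  assumes "bounded_density k"
  shows "integrable \<mu> (\<lambda>x. k x y)"
proof -
  obtain C where "\<And>x y. k x y \<le> C" "\<And>x y. 0 \<le> k x y"
    using assms unfolding bounded_density_def by blast
  then show ?thesis using bounded_density_sections(2)[OF assms]
    by (intro \<mu>.integrable_const_bound[of _ C]) (auto simp: measurable_\<mu>)
qed

text \<open>Stated for vector-valued \<open>h\<close>, so that it covers test functions, masses and barycenters at once.\<close>

lemma density_section:
  fixes h :: "'a \<Rightarrow> 'b::{banach, second_countable_topology}"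
  assumes k: "bounded_density k"
    and h: "h \<in> borel_measurable borel" "AE y in \<nu>. norm (h y) \<le> B" and B: "0 \<le> B"
  shows "integrable \<nu> (\<lambda>y. k x y *\<^sub>R h y)"
    and "norm (\<integral>y. k x y *\<^sub>R h y \<partial>\<nu>) \<le> B * (\<integral>y. k x y \<partial>\<nu>)"
    and "(\<lambda>x. \<integral>y. k x y *\<^sub>R h y \<partial>\<nu>) \<in> borel_measurable borel"
    and "\<exists>C. \<forall>x. norm (\<integral>y. k x y *\<^sub>R h y \<partial>\<nu>) \<le> C"
proof -
  obtain C where C: "\<And>x y. k x y \<le> C" and k0: "\<And>x y. 0 \<le> k x y"
    using k unfolding bounded_density_def by blast
  have ks: "(\<lambda>y. k x y) \<in> borel_measurable \<nu>" for x
    using bounded_density_sections(1)[OF k] by (simp add: measurable_\<nu>)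
  have hm: "h \<in> borel_measurable \<nu>" using h(1) by (simp add: measurable_\<nu>)
  have ik: "integrable \<nu> (\<lambda>y. k x y)" for x
    using ks C k0 by (intro \<nu>.integrable_const_bound[of _ C]) auto
  have ikC: "(\<integral>y. k x y \<partial>\<nu>) \<le> C" for x
  proof -
    have "(\<integral>y. k x y \<partial>\<nu>) \<le> (\<integral>y. C \<partial>\<nu>)" using C ik by (intro integral_mono) auto
    then show ?thesis by simp
  qed
  have bd: "AE y in \<nu>. norm (k x y *\<^sub>R h y) \<le> B * k x y" for x
    using h(2) by eventually_elim (use k0[of x] in \<open>simp add: mult.commute[of "k x _"] mult_right_mono\<close>)
  show int: "integrable \<nu> (\<lambda>y. k x y *\<^sub>R h y)" for x
  proof (rule Bochner_Integration.integrable_bound)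
    show "integrable \<nu> (\<lambda>y. B * k x y)" using ik by simp
    show "(\<lambda>y. k x y *\<^sub>R h y) \<in> borel_measurable \<nu>" using ks hm by (rule borel_measurable_scaleR)
    show "AE y in \<nu>. norm (k x y *\<^sub>R h y) \<le> norm (B * k x y)"
      using bd[of x] by eventually_elim simp
  qed
  show le: "norm (\<integral>y. k x y *\<^sub>R h y \<partial>\<nu>) \<le> B * (\<integral>y. k x y \<partial>\<nu>)" for x
  proof -
    have "norm (\<integral>y. k x y *\<^sub>R h y \<partial>\<nu>) \<le> (\<integral>y. norm (k x y *\<^sub>R h y) \<partial>\<nu>)" by (rule integral_norm_bound)
    also have "\<dots> \<le> (\<integral>y. B * k x y \<partial>\<nu>)" using bd int ik by (intro integral_mono_AE integrable_norm) auto
    finally show ?thesis by simp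
  qed
  show "\<exists>C. \<forall>x. norm (\<integral>y. k x y *\<^sub>R h y \<partial>\<nu>) \<le> C"
    using order_trans[OF le mult_left_mono[OF ikC B]] by blast
  have [measurable]: "case_prod k \<in> borel_measurable (borel \<Otimes>\<^sub>M borel)" "h \<in> borel_measurable borel"
    using k h(1) by (simp_all add: bounded_density_def)
  have "(\<lambda>p. case_prod k p *\<^sub>R h (snd p)) \<in> borel_measurable (borel \<Otimes>\<^sub>M borel)" by measurable
  then have "(\<lambda>(x, y). k x y *\<^sub>R h y) \<in> borel_measurable (borel \<Otimes>\<^sub>M \<nu>)"
    using sets_\<nu> by (simp add: case_prod_beta' cong: measurable_cong_sets sets_pair_measure_cong)
  then show "(\<lambda>x. \<integral>y. k x y *\<^sub>R h y \<partial>\<nu>) \<in> borel_measurable borel"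
    by (rule \<nu>.borel_measurable_lebesgue_integral)
qed

lemma density_mass_integrable:
  assumes "bounded_density k"
  shows "integrable \<nu> (\<lambda>y. k x y)" "(\<lambda>x. \<integral>y. k x y \<partial>\<nu>) \<in> borel_measurable borel"
proof -
  note * = density_section[OF assms, of "\<lambda>_. 1 :: real" 1]
  show "integrable \<nu> (\<lambda>y. k x y)" using *(1) by simp
  show "(\<lambda>x. \<integral>y. k x y \<partial>\<nu>) \<in> borel_measurable borel" using *(3) by simp
qed

definition bary :: "('a \<Rightarrow> 'a \<Rightarrow> real) \<Rightarrow> 'a \<Rightarrow> 'a" where
  "bary k x = (\<integral>y. k x y *\<^sub>R y \<partial>\<nu>)"

lemma integrable_bary_error:
  assumes "bounded_density k"
  shows "integrable \<mu> (\<lambda>x. norm (bary k x - x))"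
    and "integrable \<nu> (\<lambda>y. k x y *\<^sub>R y)"
proof -
  note * = density_section[OF assms measurable_ident_sets[OF refl] AE_R R]
  have m: "bary k \<in> borel_measurable borel" unfolding bary_def[abs_def] using *(3) by simp
  obtain C where C: "\<And>x. norm (bary k x) \<le> C" using *(4) unfolding bary_def by auto
  have "integrable \<mu> (bary k)"
    using C m by (intro \<mu>.integrable_const_bound[of _ C]) (auto simp: measurable_\<mu>)
  then show "integrable \<mu> (\<lambda>x. norm (bary k x - x))" using int_\<mu> by simp
  show "integrable \<nu> (\<lambda>y. k x y *\<^sub>R y)" using *(1) by simp
qed

text \<open>The condition \<open>\<integral>k x y \<mu>(dx) = 1\<close> says that the kernel carries \<open>\<mu>\<close> to \<open>\<nu>\<close>. The barycenter condition is
  relaxed in \<open>L\<^sup>1(\<mu>)\<close>, which keeps the set convex.\<close>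

definition near_barycentric :: "real \<Rightarrow> ('a \<Rightarrow> 'a \<Rightarrow> real) set" where
  "near_barycentric e = {k. bounded_density k \<and> (\<forall>y. (\<integral>x. k x y \<partial>\<mu>) = 1) \<and>
     (\<integral>x. norm (bary k x - x) \<partial>\<mu>) \<le> e}"

lemma near_barycentric_midpoint:
  assumes "k \<in> near_barycentric e" "k' \<in> near_barycentric e"
  shows "(\<lambda>x y. (k x y + k' x y) / 2) \<in> near_barycentric e"
proof -
  let ?m = "\<lambda>x y. (k x y + k' x y) / 2"
  have b: "bounded_density k" "bounded_density k'" using assms by (auto simp: near_barycentric_def)
  obtain C C' where C: "\<And>x y. k x y \<le> C" "\<And>x y. k' x y \<le> C'" "\<And>x y. 0 \<le> k x y" "\<And>x y. 0 \<le> k' x y"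
    using b unfolding bounded_density_def by blast
  have [measurable]: "case_prod k \<in> borel_measurable (borel \<Otimes>\<^sub>M borel)"
    "case_prod k' \<in> borel_measurable (borel \<Otimes>\<^sub>M borel)"
    using b by (simp_all add: bounded_density_def)
  have "(\<lambda>p. (case_prod k p + case_prod k' p) / 2) \<in> borel_measurable (borel \<Otimes>\<^sub>M borel)" by measurable
  then have "case_prod ?m \<in> borel_measurable (borel \<Otimes>\<^sub>M borel)" by (simp add: case_prod_beta')
  moreover have "?m x y \<le> (C + C') / 2" "0 \<le> ?m x y" for x y
    using C(1,2)[of x y] C(3,4)[of x y] by (auto intro: divide_right_mono add_mono)
  ultimately have m: "bounded_density ?m" unfolding bounded_density_def by blast
  have one: "(\<integral>x. ?m x y \<partial>\<mu>) = 1" for y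
    using assms integrable_density_left[OF b(1), of y] integrable_density_left[OF b(2), of y]
    by (simp add: near_barycentric_def)
  have bm: "bary ?m x - x = (1/2) *\<^sub>R (bary k x - x) + (1/2) *\<^sub>R (bary k' x - x)" for x
  proof -
    have "bary ?m x = (\<integral>y. (1/2) *\<^sub>R (k x y *\<^sub>R y) + (1/2) *\<^sub>R (k' x y *\<^sub>R y) \<partial>\<nu>)"
      unfolding bary_def by (simp add: scaleR_add_left add_divide_distrib)
    also have "\<dots> = (1/2) *\<^sub>R bary k x + (1/2) *\<^sub>R bary k' x"
      unfolding bary_def using integrable_bary_error(2)[OF b(1)] integrable_bary_error(2)[OF b(2)]
      by (simp del: scaleR_scaleR)
    finally have "bary ?m x = (1/2) *\<^sub>R bary k x + (1/2) *\<^sub>R bary k' x" .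
    moreover have "x = (1/2) *\<^sub>R x + (1/2) *\<^sub>R x" by (simp flip: scaleR_add_left)
    ultimately show ?thesis by (metis (no_types, lifting) add_diff_add scaleR_diff_right)
  qed
  have "(\<integral>x. norm (bary ?m x - x) \<partial>\<mu>) \<le> (\<integral>x. (1/2) * norm (bary k x - x) + (1/2) * norm (bary k' x - x) \<partial>\<mu>)"
  proof (rule integral_mono)
    show "norm (bary ?m x - x) \<le> (1/2) * norm (bary k x - x) + (1/2) * norm (bary k' x - x)" for x
      unfolding bm by (rule norm_triangle_le) simp
  qed (use integrable_bary_error(1)[OF m] integrable_bary_error(1)[OF b(1)] integrable_bary_error(1)[OF b(2)] in simp_all)
  also have "\<dots> = (1/2) * (\<integral>x. norm (bary k x - x) \<partial>\<mu>) + (1/2) * (\<integral>x. norm (bary k' x - x) \<partial>\<mu>)"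
    using integrable_bary_error(1)[OF b(1)] integrable_bary_error(1)[OF b(2)] by simp
  also have "\<dots> \<le> e" using assms by (simp add: near_barycentric_def)
  finally show ?thesis using m one by (simp add: near_barycentric_def)
qed

text \<open>The measure \<open>\<mu>q\<close> of the kernel is \<open>\<nu>\<close>.\<close>

lemma nn_integral_density_swap:
  assumes k: "k \<in> near_barycentric e" and [measurable]: "g \<in> borel_measurable borel" and g0: "\<And>y. 0 \<le> g y"
  shows "(\<integral>\<^sup>+ x. \<integral>\<^sup>+ y. ennreal (k x y * g y) \<partial>\<nu> \<partial>\<mu>) = (\<integral>\<^sup>+ y. ennreal (g y) \<partial>\<nu>)"
proof -
  have b: "bounded_density k" using k by (simp add: near_barycentric_def)
  have k0: "0 \<le> k x y" for x y using b by (simp add: bounded_density_def)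
  have [measurable]: "case_prod k \<in> borel_measurable (borel \<Otimes>\<^sub>M borel)"
    using b by (simp add: bounded_density_def)
  have "(\<lambda>p. ennreal (case_prod k p * g (snd p))) \<in> borel_measurable (borel \<Otimes>\<^sub>M borel)" by measurable
  then have "(\<lambda>(x, y). ennreal (k x y * g y)) \<in> borel_measurable (\<mu> \<Otimes>\<^sub>M \<nu>)"
    using sets_\<nu> sets_\<mu> by (simp add: case_prod_beta' cong: measurable_cong_sets sets_pair_measure_cong)
  then have "(\<integral>\<^sup>+ x. \<integral>\<^sup>+ y. ennreal (k x y * g y) \<partial>\<nu> \<partial>\<mu>) = (\<integral>\<^sup>+ y. \<integral>\<^sup>+ x. ennreal (k x y * g y) \<partial>\<mu> \<partial>\<nu>)"
    by (rule Fubini'[symmetric])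
  also have "\<dots> = (\<integral>\<^sup>+ y. ennreal (g y) \<partial>\<nu>)"
  proof (rule nn_integral_cong)
    fix y
    have "(\<integral>\<^sup>+ x. ennreal (k x y * g y) \<partial>\<mu>) = ennreal (\<integral>x. k x y * g y \<partial>\<mu>)"
      using integrable_density_left[OF b, of y] k0 g0 by (intro nn_integral_eq_integral) auto
    also have "(\<integral>x. k x y * g y \<partial>\<mu>) = g y" using k by (simp add: near_barycentric_def)
    finally show "(\<integral>\<^sup>+ x. ennreal (k x y * g y) \<partial>\<mu>) = ennreal (g y)" .
  qed
  finally show ?thesis .
qed

text \<open>Cut \<open>\<mu>\<close> into the level sets \<open>A i\<close> of a simple function \<open>s\<close> close to the identity, and give all points
  of a cell the same measure, proportional to \<open>f i y \<nu>(dy)\<close>, where \<open>f\<close> is a partition of unity for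
  which \<open>\<beta> i = \<integral>f i y y \<nu>(dy)\<close> approximates \<open>m i = \<integral>\<^sub>A\<^sub>i x \<mu>(dx)\<close>. The hypothesis of the finite duality is
  the order tested with \<open>\<phi> = max\<^sub>i u i \<bullet> y\<close>: on the cell \<open>A i\<close> one has \<open>u i \<bullet> x \<le> \<phi> x\<close>.\<close>

lemma near_barycentric_nonempty:
  assumes phc: "phc_le \<mu> \<nu>" and e: "0 < e"
  shows "near_barycentric e \<noteq> {}"
proof -
  obtain s where s: "simple_function \<mu> s" and si: "integrable \<mu> (\<lambda>x. norm (x - s x))"
    and se: "(\<integral>x. norm (x - s x) \<partial>\<mu>) \<le> e / 4"
    using \<mu>.simple_approximation_L1[OF int_\<mu>, of "e / 4"] e by auto
  have sm: "s \<in> borel_measurable borel"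
    using borel_measurable_simple_function[OF s] by (simp add: measurable_\<mu>)
  define A where "A i = s -` {i}" for i
  have Ab[measurable]: "A i \<in> sets borel" for i
    unfolding A_def using measurable_sets[OF sm, of "{i}"] by simp
  have A\<mu>[measurable]: "A i \<in> sets \<mu>" for i using Ab by (simp add: sets_\<mu>)
  define p where "p i = measure \<mu> (A i)" for i
  define I where "I = {i \<in> range s. p i \<noteq> 0}"
  have fin: "finite I" unfolding I_def using simple_functionD(1)[OF s] by simp
  have p: "0 < p i" if "i \<in> I" for i using that by (simp add: I_def p_def less_le)
  have AE_I: "AE x in \<mu>. s x \<in> I"
  proof -
    have "AE x in \<mu>. \<forall>i\<in>range s - I. x \<notin> A i"
    proof (rule AE_finite_allI)
      show "finite (range s - I)" using simple_functionD(1)[OF s] by simp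
      fix i assume "i \<in> range s - I"
      then have "emeasure \<mu> (A i) = 0" by (auto simp: I_def p_def \<mu>.emeasure_eq_measure)
      then show "AE x in \<mu>. x \<notin> A i" using A\<mu> by (intro AE_not_in) (simp add: null_sets_def)
    qed
    then show ?thesis by eventually_elim (auto simp: A_def)
  qed
  have ne: "I \<noteq> {}"
  proof
    assume "I = {}"
    then have "AE x in \<mu>. False" using AE_I by simp
    then show False using \<mu>.AE_False by simp
  qed
  have sum_ind: "(\<Sum>i\<in>I. indicator (A i) x *\<^sub>R v i) = (if s x \<in> I then v (s x) else 0)"
    for x and v :: "'a \<Rightarrow> 'c::real_vector"
  proof -
    have "(\<Sum>i\<in>I. indicator (A i) x *\<^sub>R v i) = (\<Sum>i\<in>I. if s x = i then v i else 0)"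
      by (intro sum.cong refl) (auto simp: A_def indicator_def)
    then show ?thesis using fin by (simp add: sum.delta)
  qed
  define m where "m i = (\<integral>x. indicator (A i) x *\<^sub>R x \<partial>\<mu>)" for i
  have im: "integrable \<mu> (\<lambda>x. indicator (A i) x *\<^sub>R x)" for i
    using int_\<mu> A\<mu> by (rule integrable_mult_indicator[rotated])
  have dual: "(\<Sum>i\<in>I. u i \<bullet> m i) \<le> (\<integral>y. Max ((\<lambda>i. u i \<bullet> y) ` I) \<partial>\<nu>)" for u
  proof -
    define \<phi> where "\<phi> y = Max ((\<lambda>i. u i \<bullet> y) ` I)" for y
    have \<phi>: "convex_on UNIV \<phi>" "pos_homogeneous \<phi>"
      unfolding \<phi>_def using Max_inner_sublinear[OF fin ne, of u] by auto
    obtain L where L: "\<And>z. \<bar>\<phi> z\<bar> \<le> L * norm z" by (rule sublinear_norm_bound[OF \<phi>]) blast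
    have \<phi>i: "integrable \<mu> \<phi>"
    proof (rule Bochner_Integration.integrable_bound)
      show "integrable \<mu> (\<lambda>x. L * norm x)" using int_\<mu> by simp
      show "\<phi> \<in> borel_measurable \<mu>" unfolding measurable_\<mu>
        using convex_on_continuous[OF open_UNIV \<phi>(1)] by (rule borel_measurable_continuous_onI)
      show "AE x in \<mu>. norm (\<phi> x) \<le> norm (L * norm x)" using L by (auto intro: order_trans[OF L abs_ge_self])
    qed
    have iu: "integrable \<mu> (\<lambda>x. u i \<bullet> (indicator (A i) x *\<^sub>R x))" for i
      using im by (rule integrable_inner_right)
    have "(\<Sum>i\<in>I. u i \<bullet> m i) = (\<Sum>i\<in>I. \<integral>x. u i \<bullet> (indicator (A i) x *\<^sub>R x) \<partial>\<mu>)"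
      unfolding m_def using im by (intro sum.cong refl integral_inner_right[symmetric])
    also have "\<dots> = (\<integral>x. (\<Sum>i\<in>I. u i \<bullet> (indicator (A i) x *\<^sub>R x)) \<partial>\<mu>)"
      using iu by (intro Bochner_Integration.integral_sum[symmetric])
    also have "\<dots> \<le> (\<integral>x. \<phi> x \<partial>\<mu>)"
    proof (rule integral_mono_AE[OF Bochner_Integration.integrable_sum[OF iu] \<phi>i])
      show "AE x in \<mu>. (\<Sum>i\<in>I. u i \<bullet> (indicator (A i) x *\<^sub>R x)) \<le> \<phi> x"
        using AE_I
      proof eventually_elim
        case (elim x)
        have "(\<Sum>i\<in>I. u i \<bullet> (indicator (A i) x *\<^sub>R x)) = (\<Sum>i\<in>I. indicator (A i) x *\<^sub>R (u i \<bullet> x))" by simp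
        also have "\<dots> = u (s x) \<bullet> x" unfolding sum_ind using elim by simp
        also have "\<dots> \<le> \<phi> x" unfolding \<phi>_def using elim fin by (intro Max_ge) auto
        finally show ?case .
      qed
    qed
    also have "\<dots> \<le> (\<integral>y. \<phi> y \<partial>\<nu>)" using phc \<phi> by (simp add: phc_le_def)
    finally show ?thesis by (simp add: \<phi>_def)
  qed
  \<comment> \<open>Half of the error \<open>e\<close> is shared by the cells; the other half covers \<open>\<integral>norm (x - s x)\<close>, which
    enters twice, within the cells and through their centers of mass.\<close>
  define c where "c = e / (2 * real (card I))"
  have c: "0 < c" using e fin ne by (simp add: c_def card_gt_0_iff)
  obtain f where fm: "\<And>i. i \<in> I \<Longrightarrow> f i \<in> borel_measurable borel" and f0: "\<And>i y. i \<in> I \<Longrightarrow> 0 \<le> f i y"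
    and f1: "\<And>y. (\<Sum>i\<in>I. f i y) = 1"
    and fe: "(\<Sum>i\<in>I. (norm ((\<integral>y. f i y *\<^sub>R y \<partial>\<nu>) - m i))\<^sup>2) \<le> c\<^sup>2"
    using finite_transport_duality[OF prob_\<nu> sets_\<nu> AE_R R fin ne dual, of "c\<^sup>2"] c by auto
  define \<beta> where "\<beta> i = (\<integral>y. f i y *\<^sub>R y \<partial>\<nu>)" for i
  have \<beta>m: "norm (\<beta> i - m i) \<le> c" if "i \<in> I" for i
  proof -
    have "(norm (\<beta> i - m i))\<^sup>2 \<le> c\<^sup>2"
      using member_le_sum[OF that, of "\<lambda>i. (norm (\<beta> i - m i))\<^sup>2"] fin fe by (simp add: \<beta>_def)
    then show ?thesis using c by (simp add: power2_le_iff_abs_le)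
  qed
  have f_le: "f i y \<le> 1" if "i \<in> I" for i y
    using member_le_sum[OF that, of "\<lambda>i. f i y"] fin f0 f1[of y] by simp
  define k where "k x y = (\<Sum>i\<in>I. indicator (A i) x * (f i y / p i))" for x y
  have kb: "bounded_density k"
    unfolding bounded_density_def
  proof (intro conjI allI exI)
    have "(\<lambda>p'. \<Sum>i\<in>I. indicator (A i) (fst p') * (f i (snd p') / p i)) \<in> borel_measurable (borel \<Otimes>\<^sub>M borel)"
    proof (rule borel_measurable_sum)
      fix i assume "i \<in> I"
      then have [measurable]: "f i \<in> borel_measurable borel" by (rule fm)
      show "(\<lambda>p'. indicator (A i) (fst p') * (f i (snd p') / p i)) \<in> borel_measurable (borel \<Otimes>\<^sub>M borel)"
        by measurable
    qed
    then show "case_prod k \<in> borel_measurable (borel \<Otimes>\<^sub>M borel)"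
      by (simp add: case_prod_beta' k_def)
    show "0 \<le> k x y" for x y unfolding k_def
      using f0 p by (intro sum_nonneg mult_nonneg_nonneg divide_nonneg_pos) auto
    show "k x y \<le> (\<Sum>i\<in>I. 1 / p i)" for x y unfolding k_def
    proof (rule sum_mono)
      fix i assume i: "i \<in> I"
      have "f i y / p i \<le> 1 / p i" "0 \<le> f i y / p i" using f_le[OF i, of y] f0[OF i, of y] p[OF i]
        by (auto intro: divide_right_mono)
      then show "indicator (A i) x * (f i y / p i) \<le> 1 / p i" using p[OF i] by (simp add: indicator_def)
    qed
  qed
  have one: "(\<integral>x. k x y \<partial>\<mu>) = 1" for y
  proof -
    have "(\<integral>x. k x y \<partial>\<mu>) = (\<Sum>i\<in>I. \<integral>x. indicator (A i) x * (f i y / p i) \<partial>\<mu>)"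
      unfolding k_def by (intro Bochner_Integration.integral_sum integrable_mult_left)
        (simp add: \<mu>.emeasure_eq_measure)
    also have "\<dots> = (\<Sum>i\<in>I. f i y)"
      using p by (intro sum.cong refl) (force simp: p_def)
    finally show ?thesis by (simp add: f1)
  qed
  have fint: "integrable \<nu> (\<lambda>y. f i y *\<^sub>R y)" if i: "i \<in> I" for i
  proof (rule \<nu>.integrable_const_bound[of _ R])
    show "AE y in \<nu>. norm (f i y *\<^sub>R y) \<le> R"
      using AE_R
    proof eventually_elim
      case (elim y)
      have "\<bar>f i y\<bar> * norm y \<le> 1 * R" using f0[OF i, of y] f_le[OF i, of y] elim by (intro mult_mono) auto
      then show ?case by simp
    qed
    have "(\<lambda>y. f i y *\<^sub>R y) \<in> borel_measurable borel" using fm[OF i] by simp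
    then show "(\<lambda>y. f i y *\<^sub>R y) \<in> borel_measurable \<nu>" by (simp add: measurable_\<nu>)
  qed
  have bk: "bary k x = (\<Sum>i\<in>I. indicator (A i) x *\<^sub>R ((1 / p i) *\<^sub>R \<beta> i))" for x
  proof -
    have "bary k x = (\<integral>y. (\<Sum>i\<in>I. (indicator (A i) x * (1 / p i)) *\<^sub>R (f i y *\<^sub>R y)) \<partial>\<nu>)"
      unfolding bary_def k_def by (simp add: scaleR_sum_left)
    also have "\<dots> = (\<Sum>i\<in>I. \<integral>y. (indicator (A i) x * (1 / p i)) *\<^sub>R (f i y *\<^sub>R y) \<partial>\<nu>)"
      by (intro Bochner_Integration.integral_sum integrable_scaleR_right fint)
    also have "\<dots> = (\<Sum>i\<in>I. indicator (A i) x *\<^sub>R ((1 / p i) *\<^sub>R \<beta> i))"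
      unfolding \<beta>_def
    proof (intro sum.cong refl)
      fix i assume "i \<in> I"
      have "(\<integral>y. (indicator (A i) x * (1 / p i)) *\<^sub>R (f i y *\<^sub>R y) \<partial>\<nu>)
          = (indicator (A i) x * (1 / p i)) *\<^sub>R (\<integral>y. f i y *\<^sub>R y \<partial>\<nu>)"
        by (rule integral_scaleR_right)
      then show "(\<integral>y. (indicator (A i) x * (1 / p i)) *\<^sub>R (f i y *\<^sub>R y) \<partial>\<nu>)
          = indicator (A i) x *\<^sub>R ((1 / p i) *\<^sub>R (\<integral>y. f i y *\<^sub>R y \<partial>\<nu>))"
        by (simp only: scaleR_scaleR)
    qed
    finally show ?thesis .
  qed
  have cell: "p i * norm ((1 / p i) *\<^sub>R \<beta> i - i) \<le> c + (\<integral>x. indicator (A i) x * norm (x - s x) \<partial>\<mu>)" if i: "i \<in> I" for i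
  proof -
    have "p i * norm ((1 / p i) *\<^sub>R \<beta> i - i) = norm (p i *\<^sub>R ((1 / p i) *\<^sub>R \<beta> i - i))"
      using p[OF i] by simp
    also have "p i *\<^sub>R ((1 / p i) *\<^sub>R \<beta> i - i) = (\<beta> i - m i) + (m i - p i *\<^sub>R i)"
      using p[OF i] by (simp add: scaleR_diff_right)
    also have "norm \<dots> \<le> c + norm (m i - p i *\<^sub>R i)" using \<beta>m[OF i] by (intro norm_triangle_le) simp
    also have "m i - p i *\<^sub>R i = (\<integral>x. indicator (A i) x *\<^sub>R (x - s x) \<partial>\<mu>)"
    proof -
      have "(\<integral>x. indicator (A i) x *\<^sub>R (x - s x) \<partial>\<mu>) = (\<integral>x. indicator (A i) x *\<^sub>R x - indicator (A i) x *\<^sub>R i \<partial>\<mu>)"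
        by (intro Bochner_Integration.integral_cong refl) (auto simp: indicator_def A_def)
      also have "\<dots> = m i - (\<integral>x. indicator (A i) x *\<^sub>R i \<partial>\<mu>)"
        unfolding m_def by (intro Bochner_Integration.integral_diff im integrable_scaleR_left)
          (simp add: \<mu>.emeasure_eq_measure)
      also have "(\<integral>x. indicator (A i) x *\<^sub>R i \<partial>\<mu>) = p i *\<^sub>R i"
        by (subst integral_scaleR_left) (auto simp: p_def \<mu>.emeasure_eq_measure)
      finally show ?thesis by simp
    qed
    also have "norm \<dots> \<le> (\<integral>x. norm (indicator (A i) x *\<^sub>R (x - s x)) \<partial>\<mu>)" by (rule integral_norm_bound)
    also have "\<dots> = (\<integral>x. indicator (A i) x * norm (x - s x) \<partial>\<mu>)" by simp
    finally show ?thesis by simp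
  qed
  have ind_int: "integrable \<mu> (\<lambda>x. indicator (A i) x * norm (x - s x))" for i
    using integrable_mult_indicator[OF A\<mu> si, of i] by simp
  have ind_c: "integrable \<mu> (\<lambda>x. indicator (A i) x * (r :: real))" for i r
    by (intro integrable_mult_left) (simp add: \<mu>.emeasure_eq_measure)
  have "(\<integral>x. norm (bary k x - x) \<partial>\<mu>)
      \<le> (\<integral>x. (\<Sum>i\<in>I. indicator (A i) x * norm ((1 / p i) *\<^sub>R \<beta> i - i)) + norm (x - s x) \<partial>\<mu>)"
  proof (rule integral_mono_AE)
    show "AE x in \<mu>. norm (bary k x - x) \<le> (\<Sum>i\<in>I. indicator (A i) x * norm ((1 / p i) *\<^sub>R \<beta> i - i)) + norm (x - s x)"
      using AE_I
    proof eventually_elim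
      case (elim x)
      have "bary k x = (1 / p (s x)) *\<^sub>R \<beta> (s x)" unfolding bk sum_ind using elim by simp
      moreover have "(\<Sum>i\<in>I. indicator (A i) x * norm ((1 / p i) *\<^sub>R \<beta> i - i)) = norm ((1 / p (s x)) *\<^sub>R \<beta> (s x) - s x)"
        using sum_ind[of x "\<lambda>i. norm ((1 / p i) *\<^sub>R \<beta> i - i)"] elim by simp
      ultimately show ?case
        using norm_triangle_ineq[of "(1 / p (s x)) *\<^sub>R \<beta> (s x) - s x" "s x - x"]
        by (simp add: norm_minus_commute)
    qed
    show "integrable \<mu> (\<lambda>x. norm (bary k x - x))" by (rule integrable_bary_error(1)[OF kb])
    show "integrable \<mu> (\<lambda>x. (\<Sum>i\<in>I. indicator (A i) x * norm ((1 / p i) *\<^sub>R \<beta> i - i)) + norm (x - s x))"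
      by (intro Bochner_Integration.integrable_add Bochner_Integration.integrable_sum ind_c si)
  qed
  also have "\<dots> = (\<Sum>i\<in>I. p i * norm ((1 / p i) *\<^sub>R \<beta> i - i)) + (\<integral>x. norm (x - s x) \<partial>\<mu>)"
    by (subst Bochner_Integration.integral_add[OF Bochner_Integration.integrable_sum[OF ind_c] si],
        subst Bochner_Integration.integral_sum[OF ind_c]) (simp add: p_def)
  also have "(\<Sum>i\<in>I. p i * norm ((1 / p i) *\<^sub>R \<beta> i - i)) \<le> (\<Sum>i\<in>I. c + (\<integral>x. indicator (A i) x * norm (x - s x) \<partial>\<mu>))"
    by (intro sum_mono cell)
  also have "\<dots> = e / 2 + (\<integral>x. (\<Sum>i\<in>I. indicator (A i) x * norm (x - s x)) \<partial>\<mu>)"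
    using fin ne by (subst Bochner_Integration.integral_sum[OF ind_int]) (simp add: sum.distrib c_def)
  also have "(\<integral>x. (\<Sum>i\<in>I. indicator (A i) x * norm (x - s x)) \<partial>\<mu>) \<le> (\<integral>x. norm (x - s x) \<partial>\<mu>)"
  proof (rule integral_mono[OF Bochner_Integration.integrable_sum[OF ind_int] si])
    show "(\<Sum>i\<in>I. indicator (A i) x * norm (x - s x)) \<le> norm (x - s x)" for x
      using sum_ind[of x "\<lambda>_. norm (x - s x)"] by simp
  qed
  finally have "(\<integral>x. norm (bary k x - x) \<partial>\<mu>) \<le> e" using se by simp
  then show ?thesis using kb one by (auto simp: near_barycentric_def)
qed

end

section \<open>Limit kernels\<close>

text \<open>Truncated multiples of the distance to the complement increase to the indicator of an open set. To
  stay countable, they are formed for finite unions of basis sets only, and the number of sets and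
  the multiple grow together.\<close>

lemma countable_open_tests:
  obtains g :: "nat \<Rightarrow> 'a::euclidean_space \<Rightarrow> real"
  where "g 0 = (\<lambda>_. 1)" "\<And>j. continuous_on UNIV (g j)" "\<And>j y. 0 \<le> g j y \<and> g j y \<le> 1"
    "\<And>U. open U \<Longrightarrow> \<exists>j. (\<forall>n y. g (j n) y \<le> indicator U y) \<and> (\<forall>y. (\<lambda>n. g (j n) y) \<longlonglongrightarrow> indicator U y)"
proof -
  obtain \<B> :: "'a set set" where \<B>: "countable \<B>" "topological_basis \<B>"
    using ex_countable_basis by blast
  have \<B>ne: "\<B> \<noteq> {}"
    using topological_basisE[OF \<B>(2) open_UNIV UNIV_I] by blast
  define B where "B = from_nat_into \<B>"
  have Bin: "B i \<in> \<B>" for i unfolding B_def using \<B>ne by (rule from_nat_into)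
  have Bop: "open (B i)" for i using topological_basis_open[OF \<B>(2) Bin] .
  have Bsurj: "\<exists>i. B i = U" if "U \<in> \<B>" for U
    unfolding B_def using from_nat_into_surj[OF \<B>(1) that] .
  \<comment> \<open>The distance to the empty set is \<open>0\<close> by convention, so the full space is treated apart.\<close>
  define \<psi> where "\<psi> V n y = (if V = UNIV then 1 else min 1 (real n * infdist y (- V)))" for V n and y :: 'a
  define W where "W l = (\<Union>i\<in>set l. B i)" for l
  define g where "g j = (case j of 0 \<Rightarrow> (\<lambda>_. 1) | Suc m \<Rightarrow> (case from_nat m of (l, n) \<Rightarrow> \<psi> (W l) n))"
    for j
  have \<psi>01: "0 \<le> \<psi> V n y \<and> \<psi> V n y \<le> 1" for V n y
    by (auto simp: \<psi>_def infdist_nonneg)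
  have \<psi>c: "continuous_on UNIV (\<psi> V n)" for V n
  proof (cases "V = UNIV")
    case True
    then have "\<psi> V n = (\<lambda>_. 1)" by (auto simp: \<psi>_def)
    then show ?thesis by simp
  next
    case False
    then have "\<psi> V n = (\<lambda>y. min 1 (real n * infdist y (- V)))" by (intro ext) (simp add: \<psi>_def)
    then show ?thesis by (auto intro!: continuous_intros)
  qed
  show ?thesis
  proof (rule that[of g])
    show "g 0 = (\<lambda>_. 1)" by (simp add: g_def)
    show "continuous_on UNIV (g j)" for j
      using \<psi>c by (auto simp: g_def split: nat.split prod.split)
    show "0 \<le> g j y \<and> g j y \<le> 1" for j y
      using \<psi>01 by (auto simp: g_def split: nat.split prod.split)
    fix U :: "'a set" assume U: "open U"
    define l where "l n = filter (\<lambda>i. B i \<subseteq> U) [0..<n]" for n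
    define j where "j n = Suc (to_nat (l n, n))" for n
    have gj: "g (j n) = \<psi> (W (l n)) n" for n by (simp add: g_def j_def)
    have WU: "W (l n) \<subseteq> U" for n by (auto simp: W_def l_def)
    have le: "\<psi> (W (l n)) n y \<le> indicator U y" for n y
    proof (cases "y \<in> U")
      case True
      then show ?thesis using \<psi>01 by simp
    next
      case False
      then have "y \<in> - W (l n)" using WU by blast
      moreover from this have "W (l n) \<noteq> UNIV" by blast
      ultimately show ?thesis using False by (simp add: \<psi>_def)
    qed
    have conv: "(\<lambda>n. \<psi> (W (l n)) n y) \<longlonglongrightarrow> indicator U y" for y
    proof (cases "y \<in> U")
      case False
      then have "\<psi> (W (l n)) n y = 0" for n using le[of n y] \<psi>01[of "W (l n)" n y] by simp
      then show ?thesis using False by simp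
    next
      case True
      from topological_basisE[OF \<B>(2) U True] obtain U' where "U' \<in> \<B>" "y \<in> U'" "U' \<subseteq> U" by blast
      then obtain i where i: "y \<in> B i" "B i \<subseteq> U" using Bsurj by metis
      have sub: "B i \<subseteq> W (l n)" if "i < n" for n using that i by (auto simp: W_def l_def)
      have "eventually (\<lambda>n. \<psi> (W (l n)) n y = 1) sequentially"
      proof (cases "B i = UNIV")
        case True
        show ?thesis
          using eventually_gt_at_top[of i]
        proof eventually_elim
          case (elim n)
          then have "W (l n) = UNIV" using sub[of n] True by blast
          then show ?case by (simp add: \<psi>_def)
        qed
      next
        case False
        define \<delta> where "\<delta> = infdist y (- B i)"
        have \<delta>: "0 < \<delta>" unfolding \<delta>_def
          using False i Bop by (intro infdist_pos_not_in_closed) (auto simp: closed_Compl)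
        obtain n0 where n0: "1 / \<delta> < real n0" using reals_Archimedean2 by blast
        show ?thesis
          using eventually_gt_at_top[of i] eventually_ge_at_top[of n0]
        proof eventually_elim
          case (elim n)
          show ?case
          proof (cases "W (l n) = UNIV")
            case True
            then show ?thesis by (simp add: \<psi>_def)
          next
            case False
            have "\<delta> \<le> infdist y (- W (l n))"
              unfolding \<delta>_def using sub[OF elim(1)] False by (intro infdist_mono) auto
            then have "real n0 * \<delta> \<le> real n * infdist y (- W (l n))"
              using elim(2) \<delta> by (intro mult_mono) auto
            moreover have "1 < real n0 * \<delta>" using n0 \<delta> by (simp add: field_simps)
            ultimately show ?thesis using False by (simp add: \<psi>_def)
          qed
        qed
      qed
      then show ?thesis using True by (simp add: tendsto_eventually)
    qed
    show "\<exists>j. (\<forall>n y. g (j n) y \<le> indicator U y) \<and> (\<forall>y. (\<lambda>n. g (j n) y) \<longlonglongrightarrow> indicator U y)"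
      using le conv by (intro exI[of _ j]) (simp add: gj)
  qed
qed

text \<open>Open sets are stable under intersection and generate the Borel sets.\<close>

lemma kernel_measurable_of_open:
  fixes q :: "'a::topological_space \<Rightarrow> 'a measure"
  assumes fin: "\<And>x. finite_measure (q x)" and sets: "\<And>x. sets (q x) = sets borel"
    and open_meas: "\<And>U. open U \<Longrightarrow> (\<lambda>x. emeasure (q x) U) \<in> borel_measurable borel"
  shows "nonneg_kernel q"
proof -
  have "(\<lambda>x. emeasure (q x) A) \<in> borel_measurable borel" if "A \<in> sets borel" for A
  proof -
    have "Int_stable {S :: 'a set. open S}" by (auto simp: Int_stable_def)
    moreover have "{S :: 'a set. open S} \<subseteq> Pow UNIV" by simp
    moreover have "A \<in> sigma_sets UNIV {S. open S}" using that by (simp add: sets_borel)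
    ultimately show ?thesis
    proof (induction rule: sigma_sets_induct_disjoint)
      case (basic A)
      then show ?case using open_meas by simp
    next
      case empty
      then show ?case by simp
    next
      case (compl A)
      have A: "A \<in> sets borel" using compl(1) by (simp add: sets_borel)
      have "emeasure (q x) (UNIV - A) = emeasure (q x) UNIV - emeasure (q x) A" for x
        using A emeasure_compl[of A "q x"] finite_measure.emeasure_finite[OF fin[of x], of A]
        by (simp add: sets sets_eq_imp_space_eq[OF sets])
      then show ?case using compl(2) open_meas[OF open_UNIV] by simp
    next
      case (union A)
      have "range A \<subseteq> sets borel" using union(2) by (simp add: sets_borel)
      then have "emeasure (q x) (\<Union>i. A i) = (\<Sum>i. emeasure (q x) (A i))" for x
        using union(1) by (intro suminf_emeasure[symmetric]) (simp_all add: sets)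
      then show ?case using union(3) by simp
    qed
  qed
  with fin sets show ?thesis by (simp add: nonneg_kernel_def)
qed

context transport_setting
begin

text \<open>After normalisation a subsequence of the measures \<open>\<kappa> n y \<nu>(dy)\<close> converges weakly. The subsequence
  does not matter for those test functions whose integrals converge along the full sequence. If the
  masses tend to \<open>0\<close>, the limit is the null measure.\<close>

lemma limit_measure_exists:
  fixes \<kappa> :: "nat \<Rightarrow> 'a \<Rightarrow> real"
  assumes \<kappa>: "\<And>n. integrable \<nu> (\<kappa> n)" "\<And>n y. 0 \<le> \<kappa> n y"
    and mass: "(\<lambda>n. \<integral>y. \<kappa> n y \<partial>\<nu>) \<longlonglongrightarrow> c"
  shows "\<exists>L. finite_measure L \<and> sets L = sets borel \<and> (AE y in L. norm y \<le> R) \<and>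
    (\<forall>(g :: 'a \<Rightarrow> real) l. continuous_on UNIV g \<longrightarrow> (\<lambda>n. \<integral>y. \<kappa> n y *\<^sub>R g y \<partial>\<nu>) \<longlonglongrightarrow> l \<longrightarrow> (\<integral>y. g y \<partial>L) = l)"
proof -
  define m where "m n = (\<integral>y. \<kappa> n y \<partial>\<nu>)" for n
  have m: "m \<longlonglongrightarrow> c" using mass by (simp add: m_def[abs_def])
  have m0: "0 \<le> m n" for n unfolding m_def using \<kappa>(2) by (intro integral_nonneg_AE) simp
  have c0: "0 \<le> c" using m m0 by (intro LIMSEQ_le_const) auto
  have \<kappa>m: "\<kappa> n \<in> borel_measurable \<nu>" for n using \<kappa>(1) by simp
  show ?thesis
  proof (cases "c = 0")
    case True
    show ?thesis
    proof (intro exI[of _ "null_measure borel"] conjI allI impI)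
      show "finite_measure (null_measure borel :: 'a measure)" by (intro finite_measureI) simp
      show "AE y in (null_measure borel :: 'a measure). norm y \<le> R"
        by (rule AE_I[of _ _ UNIV]) auto
      fix g :: "'a \<Rightarrow> real" and l
      assume g: "continuous_on UNIV g" and l: "(\<lambda>n. \<integral>y. \<kappa> n y *\<^sub>R g y \<partial>\<nu>) \<longlonglongrightarrow> l"
      have "compact (g ` K)" using g K(1) by (intro compact_continuous_image) (auto intro: continuous_on_subset)
      then have "bounded (g ` K)" by (rule compact_imp_bounded)
      then obtain B where B: "\<And>y. y \<in> K \<Longrightarrow> norm (g y) \<le> B"
        unfolding bounded_iff by blast
      have "(\<lambda>n. \<integral>y. \<kappa> n y *\<^sub>R g y \<partial>\<nu>) \<longlonglongrightarrow> 0"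
      proof (rule Lim_null_comparison)
        have "(\<lambda>n. B * m n) \<longlonglongrightarrow> B * c" using m by (intro tendsto_intros)
        then show "(\<lambda>n. B * m n) \<longlonglongrightarrow> 0" using True by simp
        have gm: "g \<in> borel_measurable \<nu>" unfolding measurable_\<nu> using g by (rule borel_measurable_continuous_onI)
        have "norm (\<integral>y. \<kappa> n y *\<^sub>R g y \<partial>\<nu>) \<le> B * m n" for n
        proof -
          have bd: "AE y in \<nu>. norm (\<kappa> n y *\<^sub>R g y) \<le> B * \<kappa> n y"
            using AE_K
          proof eventually_elim
            case (elim y)
            have "\<kappa> n y * \<bar>g y\<bar> \<le> \<kappa> n y * B" using B[OF elim] \<kappa>(2) by (intro mult_left_mono) auto
            then show ?case using \<kappa>(2)[of n y] by (simp add: abs_mult mult.commute)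
          qed
          have iB: "integrable \<nu> (\<lambda>y. B * \<kappa> n y)" using \<kappa>(1) by simp
          have i: "integrable \<nu> (\<lambda>y. \<kappa> n y *\<^sub>R g y)"
          proof (rule Bochner_Integration.integrable_bound[OF iB])
            show "(\<lambda>y. \<kappa> n y *\<^sub>R g y) \<in> borel_measurable \<nu>" using \<kappa>m gm by (rule borel_measurable_scaleR)
            show "AE y in \<nu>. norm (\<kappa> n y *\<^sub>R g y) \<le> norm (B * \<kappa> n y)" using bd by eventually_elim simp
          qed
          have "norm (\<integral>y. \<kappa> n y *\<^sub>R g y \<partial>\<nu>) \<le> (\<integral>y. norm (\<kappa> n y *\<^sub>R g y) \<partial>\<nu>)" by (rule integral_norm_bound)
          also have "\<dots> \<le> (\<integral>y. B * \<kappa> n y \<partial>\<nu>)" by (rule integral_mono_AE[OF integrable_norm[OF i] iB bd])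
          also have "\<dots> = B * m n" by (simp add: m_def)
          finally show ?thesis .
        qed
        then show "eventually (\<lambda>n. norm (\<integral>y. \<kappa> n y *\<^sub>R g y \<partial>\<nu>) \<le> B * m n) sequentially" by simp
      qed
      then have "l = 0" using l LIMSEQ_unique by blast
      then show "(\<integral>y. g y \<partial>null_measure borel) = l"
        by (simp add: integral_eq_zero_AE AE_I[of _ _ UNIV])
    qed simp
  next
    case False
    with c0 have c: "0 < c" by simp
    have "eventually (\<lambda>n. 0 < m n) sequentially" using m c by (rule order_tendstoD)
    then obtain n0 where n0: "\<And>n. n \<ge> n0 \<Longrightarrow> 0 < m n" by (auto simp: eventually_sequentially)
    define d where "d n y = \<kappa> (n + n0) y / m (n + n0)" for n y
    have mp: "0 < m (n + n0)" for n using n0 by simp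
    have d: "d n \<in> borel_measurable \<nu>" "0 \<le> d n y" for n y
      unfolding d_def using \<kappa>m \<kappa>(2) mp by (simp_all add: less_imp_le)
    define p where "p n = density \<nu> (\<lambda>y. ennreal (d n y))" for n
    have prob: "prob_space (p n)" for n
    proof
      have "emeasure (p n) (space (p n)) = (\<integral>\<^sup>+ y. ennreal (d n y) \<partial>\<nu>)"
        unfolding p_def using d sets.top[of \<nu>] by (subst emeasure_density) (auto simp: space_density)
      also have "\<dots> = ennreal (\<integral>y. d n y \<partial>\<nu>)"
        using d(2) \<kappa>(1) by (intro nn_integral_eq_integral) (auto simp: d_def)
      also have "(\<integral>y. d n y \<partial>\<nu>) = 1" using mp[of n] by (simp add: d_def m_def)
      finally show "emeasure (p n) (space (p n)) = 1" by simp
    qed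
    have setsp: "sets (p n) = sets borel" for n by (simp add: p_def sets_\<nu>)
    have pK: "AE y in p n. y \<in> K" for n
      unfolding p_def using AE_K d(1) by (subst AE_density) auto
    obtain r and L :: "'a measure" where r: "strict_mono (r :: nat \<Rightarrow> nat)" and L: "prob_space L" "sets L = sets borel"
      "AE y in L. norm y \<le> R"
      and Lg: "\<And>g :: 'a \<Rightarrow> real. continuous_on UNIV g \<Longrightarrow> (\<lambda>n. \<integral>y. g y \<partial>p (r n)) \<longlonglongrightarrow> (\<integral>y. g y \<partial>L)"
      by (rule compact_weak_subsequence[where m=p, OF K R prob setsp pK]) blast
    interpret L: prob_space L by fact
    show ?thesis
    proof (intro exI[of _ "density L (\<lambda>_. ennreal c)"] conjI allI impI)
      show "finite_measure (density L (\<lambda>_. ennreal c))"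
        by (intro finite_measureI) (simp add: emeasure_density_const space_density ennreal_mult_eq_top_iff)
      show "sets (density L (\<lambda>_. ennreal c)) = sets borel" using L(2) by simp
      show "AE y in density L (\<lambda>_. ennreal c). norm y \<le> R" using L(3) by (subst AE_density) auto
      fix g :: "'a \<Rightarrow> real" and l
      assume g: "continuous_on UNIV g" and l: "(\<lambda>n. \<integral>y. \<kappa> n y *\<^sub>R g y \<partial>\<nu>) \<longlonglongrightarrow> l"
      have gb: "g \<in> borel_measurable borel" using g by (rule borel_measurable_continuous_onI)
      have gm: "g \<in> borel_measurable \<nu>" unfolding measurable_\<nu> by (rule gb)
      have gL: "g \<in> borel_measurable L" using gb L(2) by (simp cong: measurable_cong_sets)
      have pg: "(\<integral>y. g y \<partial>p n) = (\<integral>y. \<kappa> (n + n0) y *\<^sub>R g y \<partial>\<nu>) / m (n + n0)" for n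
      proof -
        have "(\<integral>y. g y \<partial>p n) = (\<integral>y. d n y *\<^sub>R g y \<partial>\<nu>)"
          unfolding p_def using d gm by (intro integral_density) auto
        also have "\<dots> = (\<integral>y. (\<kappa> (n + n0) y *\<^sub>R g y) / m (n + n0) \<partial>\<nu>)" by (simp add: d_def)
        also have "\<dots> = (\<integral>y. \<kappa> (n + n0) y *\<^sub>R g y \<partial>\<nu>) / m (n + n0)" by (rule integral_divide_zero)
        finally show ?thesis .
      qed
      have "(\<lambda>n. (\<integral>y. \<kappa> (n + n0) y *\<^sub>R g y \<partial>\<nu>) / m (n + n0)) \<longlonglongrightarrow> l / c"
        using LIMSEQ_ignore_initial_segment[OF l, of n0] LIMSEQ_ignore_initial_segment[OF m, of n0] c
        by (intro tendsto_divide) auto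
      then have "(\<lambda>n. \<integral>y. g y \<partial>p n) \<longlonglongrightarrow> l / c" unfolding pg .
      from LIMSEQ_subseq_LIMSEQ[OF this r] have "(\<lambda>n. \<integral>y. g y \<partial>p (r n)) \<longlonglongrightarrow> l / c" by (simp add: o_def)
      then have "(\<integral>y. g y \<partial>L) = l / c" using Lg[OF g] LIMSEQ_unique by blast
      moreover have "(\<integral>y. g y \<partial>density L (\<lambda>_. ennreal c)) = (\<integral>y. c *\<^sub>R g y \<partial>L)"
        using gL c by (intro integral_density) auto
      ultimately show "(\<integral>y. g y \<partial>density L (\<lambda>_. ennreal c)) = l" using c by simp
    qed
  qed
qed

text \<open>Apply the Komlos-type lemma on the product of \<open>\<mu>\<close> with a probability measure on the indices \<open>j\<close> that
  charges each index, so that almost everywhere convergence on the product means convergence for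
  all \<open>j\<close> at almost every \<open>x\<close>. By Fatou's lemma the masses do not tend to infinity on a set of positive measure,
  so the integrals themselves converge, not only their exponentials.\<close>

lemma barycentric_sequence:
  fixes g :: "nat \<Rightarrow> 'a \<Rightarrow> real"
  assumes phc: "phc_le \<mu> \<nu>"
    and g: "g 0 = (\<lambda>_. 1)" "\<And>j. g j \<in> borel_measurable borel" "\<And>j y. 0 \<le> g j y \<and> g j y \<le> 1"
  shows "\<exists>k. (\<forall>n. k n \<in> near_barycentric ((1/2)^n)) \<and>
    (AE x in \<mu>. (\<forall>j. convergent (\<lambda>n. \<integral>y. k n x y *\<^sub>R g j y \<partial>\<nu>)) \<and> (\<lambda>n. bary (k n) x) \<longlonglongrightarrow> x)"
proof -
  define T where "T k p = (case p of (j, x) \<Rightarrow> \<integral>y. k x y *\<^sub>R g j y \<partial>\<nu>)" for k :: "'a \<Rightarrow> 'a \<Rightarrow> real" and p :: "nat \<times> 'a"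
  define P where "P = measure_pmf (geometric_pmf (1/2))"
  interpret P: prob_space P unfolding P_def by (rule prob_space_measure_pmf)
  have pp: "pair_prob_space P \<mu>"
    by unfold_locales
  interpret PM: pair_prob_space P \<mu> by (rule pp)
  have g1: "AE y in \<nu>. norm (g j y) \<le> 1" for j using g(3) by (intro AE_I2) simp
  have sec: "integrable \<nu> (\<lambda>y. k x y *\<^sub>R g j y)" "(\<lambda>x. \<integral>y. k x y *\<^sub>R g j y \<partial>\<nu>) \<in> borel_measurable borel"
    "0 \<le> (\<integral>y. k x y *\<^sub>R g j y \<partial>\<nu>)" "(\<integral>y. k x y *\<^sub>R g j y \<partial>\<nu>) \<le> (\<integral>y. k x y \<partial>\<nu>)"
    if "bounded_density k" for k x j
  proof -
    show i: "integrable \<nu> (\<lambda>y. k x y *\<^sub>R g j y)" by (rule density_section(1)[OF that g(2) g1]) simp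
    show "(\<lambda>x. \<integral>y. k x y *\<^sub>R g j y \<partial>\<nu>) \<in> borel_measurable borel" by (rule density_section(3)[OF that g(2) g1]) simp
    show "0 \<le> (\<integral>y. k x y *\<^sub>R g j y \<partial>\<nu>)"
      using that g(3) by (intro integral_nonneg_AE) (simp add: bounded_density_def)
    show "(\<integral>y. k x y *\<^sub>R g j y \<partial>\<nu>) \<le> (\<integral>y. k x y \<partial>\<nu>)"
      using that g(3) by (intro integral_mono i density_mass_integrable(1)[OF that])
        (simp add: bounded_density_def mult_left_le)
  qed
  have bd: "bounded_density k" if "k \<in> near_barycentric e" for k e using that by (simp add: near_barycentric_def)
  define C where "C n = T ` near_barycentric ((1/2)^n)" for n :: nat
  have "\<exists>a. (\<forall>n. a n \<in> C n) \<and> (AE p in P \<Otimes>\<^sub>M \<mu>. convergent (\<lambda>n. exp (- a n p / 2)))"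
  proof (rule komlos_type_convergence)
    show "prob_space (P \<Otimes>\<^sub>M \<mu>)" by (rule PM.prob_space_axioms)
    show "C n \<noteq> {}" for n unfolding C_def using near_barycentric_nonempty[OF phc, of "(1/2)^n"] by simp
    show "a \<in> borel_measurable (P \<Otimes>\<^sub>M \<mu>)" if aC: "a \<in> C n" for a n
    proof -
      obtain k where k: "k \<in> near_barycentric ((1/2)^n)" and a: "a = T k" using aC unfolding C_def by blast
      have "T k \<in> borel_measurable (count_space UNIV \<Otimes>\<^sub>M \<mu>)"
        using sec(2)[OF bd[OF k]]
        by (intro measurable_pair_measure_countable1) (auto simp: T_def measurable_\<mu>)
      moreover have "sets (P \<Otimes>\<^sub>M \<mu>) = sets (count_space UNIV \<Otimes>\<^sub>M \<mu>)"
        by (intro sets_pair_measure_cong) (simp_all add: P_def)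
      ultimately show ?thesis unfolding a by (simp cong: measurable_cong_sets)
    qed
    show "0 \<le> a p" if "a \<in> C n" for a n p
      using that sec(3)[OF bd] by (auto simp: C_def T_def split: prod.split)
    have "near_barycentric ((1/2)^Suc n) \<subseteq> near_barycentric ((1/2)^n)" for n :: nat
    proof -
      have "(1/2)^Suc n \<le> (1/2 :: real)^n" by simp
      then show ?thesis unfolding near_barycentric_def by (blast intro: order_trans)
    qed
    then show "decseq C" unfolding decseq_Suc_iff C_def by (intro allI image_mono)
    show "(\<lambda>p. (a p + b p) / 2) \<in> C n" if ab: "a \<in> C n" "b \<in> C n" for a b n
    proof -
      obtain k k' where k: "k \<in> near_barycentric ((1/2)^n)" "k' \<in> near_barycentric ((1/2)^n)"
        and a: "a = T k" "b = T k'" using ab unfolding C_def by blast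
      have "(\<lambda>p. (a p + b p) / 2) = T (\<lambda>x y. (k x y + k' x y) / 2)"
      proof
        fix p :: "nat \<times> 'a"
        obtain j x where p: "p = (j, x)" by (cases p)
        have "(\<integral>y. ((k x y + k' x y) / 2) *\<^sub>R g j y \<partial>\<nu>) = (\<integral>y. (k x y *\<^sub>R g j y + k' x y *\<^sub>R g j y) / 2 \<partial>\<nu>)"
          by (simp add: algebra_simps add_divide_distrib)
        also have "\<dots> = ((\<integral>y. k x y *\<^sub>R g j y \<partial>\<nu>) + (\<integral>y. k' x y *\<^sub>R g j y \<partial>\<nu>)) / 2"
          using Bochner_Integration.integral_add[OF sec(1)[OF bd[OF k(1)], of x j] sec(1)[OF bd[OF k(2)], of x j]]
          by simp
        finally show "(a p + b p) / 2 = T (\<lambda>x y. (k x y + k' x y) / 2) p" by (simp add: a T_def p)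
      qed
      then show ?thesis unfolding C_def using near_barycentric_midpoint[OF k] by blast
    qed
  qed
  then obtain a where a: "\<And>n. a n \<in> C n" and conv: "AE p in P \<Otimes>\<^sub>M \<mu>. convergent (\<lambda>n. exp (- a n p / 2))"
    by blast
  have "\<forall>n. \<exists>k. k \<in> near_barycentric ((1/2)^n) \<and> a n = T k" using a unfolding C_def by blast
  then obtain k where k: "\<And>n. k n \<in> near_barycentric ((1/2)^n)" and ak: "\<And>n. a n = T (k n)" by metis
  have kb: "bounded_density (k n)" for n using k by (rule bd)
  have "AE j in P. AE x in \<mu>. convergent (\<lambda>n. exp (- a n (j, x) / 2))"
    using conv by (rule PM.AE_pair)
  then have "\<forall>j. AE x in \<mu>. convergent (\<lambda>n. exp (- a n (j, x) / 2))"
    unfolding P_def AE_measure_pmf_iff by (simp add: set_pmf_geometric)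
  then have E: "AE x in \<mu>. \<forall>j. convergent (\<lambda>n. exp (- (\<integral>y. k n x y *\<^sub>R g j y \<partial>\<nu>) / 2))"
    by (simp add: AE_all_countable ak T_def)
  define S where "S n x = (\<integral>y. k n x y \<partial>\<nu>)" for n x
  have Sm: "S n \<in> borel_measurable borel" for n unfolding S_def[abs_def] by (rule density_mass_integrable(2)[OF kb])
  have one: "(\<integral>\<^sup>+ x. ennreal (S n x) \<partial>\<mu>) = 1" for n
  proof -
    have "(\<integral>\<^sup>+ x. ennreal (S n x) \<partial>\<mu>) = (\<integral>\<^sup>+ x. \<integral>\<^sup>+ y. ennreal (k n x y * 1) \<partial>\<nu> \<partial>\<mu>)"
      unfolding S_def using density_mass_integrable(1)[OF kb] kb
      by (intro nn_integral_cong) (simp add: nn_integral_eq_integral bounded_density_def)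
    also have "\<dots> = (\<integral>\<^sup>+ y. ennreal 1 \<partial>\<nu>)" by (rule nn_integral_density_swap[OF k]) auto
    finally show ?thesis using \<nu>.emeasure_space_1 by simp
  qed
  have "(\<integral>\<^sup>+ x. liminf (\<lambda>n. ennreal (S n x)) \<partial>\<mu>) \<le> liminf (\<lambda>n. \<integral>\<^sup>+ x. ennreal (S n x) \<partial>\<mu>)"
    using Sm by (intro nn_integral_liminf) (simp add: measurable_\<mu>)
  also have "\<dots> = 1" unfolding one by (simp add: Liminf_const)
  finally have "(\<integral>\<^sup>+ x. liminf (\<lambda>n. ennreal (S n x)) \<partial>\<mu>) \<noteq> \<infinity>"
    by (auto simp: top_unique)
  then have fin: "AE x in \<mu>. liminf (\<lambda>n. ennreal (S n x)) \<noteq> \<infinity>"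
    using Sm by (intro nn_integral_PInf_AE) (simp_all add: measurable_\<mu>)
  \<comment> \<open>The errors \<open>(1/2)^n\<close> are summable, hence the barycenters converge without a further subsequence.\<close>
  have "AE x in \<mu>. summable (\<lambda>n. \<bar>norm (bary (k n) x - x)\<bar>)"
  proof (rule AE_summable_of_summable_integrals[where c="\<lambda>n. (1/2)^n"])
    fix n
    show "(\<lambda>x. norm (bary (k n) x - x)) \<in> borel_measurable \<mu>" using integrable_bary_error(1)[OF kb] by simp
    have "(\<integral>\<^sup>+ x. ennreal \<bar>norm (bary (k n) x - x)\<bar> \<partial>\<mu>) = ennreal (\<integral>x. norm (bary (k n) x - x) \<partial>\<mu>)"
      using integrable_bary_error(1)[OF kb] by (simp add: nn_integral_eq_integral)
    also have "\<dots> \<le> ennreal ((1/2)^n)" using k[of n] by (intro ennreal_leI) (simp add: near_barycentric_def)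
    finally show "(\<integral>\<^sup>+ x. ennreal \<bar>norm (bary (k n) x - x)\<bar> \<partial>\<mu>) \<le> ennreal ((1/2)^n)" .
  qed (auto intro: summable_geometric)
  then have b: "AE x in \<mu>. (\<lambda>n. bary (k n) x) \<longlonglongrightarrow> x"
  proof eventually_elim
    case (elim x)
    then have "(\<lambda>n. norm (bary (k n) x - x)) \<longlonglongrightarrow> 0" using summable_LIMSEQ_zero by force
    then have "(\<lambda>n. bary (k n) x - x) \<longlonglongrightarrow> 0" by (rule tendsto_norm_zero_cancel)
    then show ?case by (rule LIM_zero_cancel)
  qed
  have "AE x in \<mu>. (\<forall>j. convergent (\<lambda>n. \<integral>y. k n x y *\<^sub>R g j y \<partial>\<nu>)) \<and> (\<lambda>n. bary (k n) x) \<longlonglongrightarrow> x"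
    using E fin b
  proof eventually_elim
    case (elim x)
    have nz: "\<not> (\<lambda>n. exp (- S n x / 2)) \<longlonglongrightarrow> 0"
    proof
      assume z: "(\<lambda>n. exp (- S n x / 2)) \<longlonglongrightarrow> 0"
      have "filterlim (\<lambda>n. S n x) at_top sequentially"
        unfolding filterlim_at_top_dense
      proof
        fix Z :: real
        have "eventually (\<lambda>n. exp (- S n x / 2) < exp (- Z / 2)) sequentially"
          using z by (rule order_tendstoD) simp
        then show "eventually (\<lambda>n. Z < S n x) sequentially" by eventually_elim simp
      qed
      then have "(\<lambda>n. ennreal (S n x)) \<longlonglongrightarrow> \<infinity>"
        unfolding infinity_ennreal_def ennreal_tendsto_top_eq_at_top .
      then have "liminf (\<lambda>n. ennreal (S n x)) = \<infinity>" by (intro lim_imp_Liminf) auto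
      with elim(2) show False by simp
    qed
    have "convergent (\<lambda>n. \<integral>y. k n x y *\<^sub>R g j y \<partial>\<nu>)" for j
    proof (rule convergent_of_exp_convergent)
      show "convergent (\<lambda>n. exp (- (\<integral>y. k n x y *\<^sub>R g j y \<partial>\<nu>) / 2))" using elim(1) by blast
      show "\<not> (\<lambda>n. exp (- (\<integral>y. k n x y *\<^sub>R g j y \<partial>\<nu>) / 2)) \<longlonglongrightarrow> 0"
      proof
        assume z: "(\<lambda>n. exp (- (\<integral>y. k n x y *\<^sub>R g j y \<partial>\<nu>) / 2)) \<longlonglongrightarrow> 0"
        have "(\<lambda>n. exp (- S n x / 2)) \<longlonglongrightarrow> 0"
        proof (rule tendsto_sandwich[OF _ _ tendsto_const z])
          show "eventually (\<lambda>n. 0 \<le> exp (- S n x / 2)) sequentially" by simp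
          show "eventually (\<lambda>n. exp (- S n x / 2) \<le> exp (- (\<integral>y. k n x y *\<^sub>R g j y \<partial>\<nu>) / 2)) sequentially"
            using sec(4)[OF kb, of _ x j] by (intro always_eventually allI) (simp add: S_def)
        qed
        with nz show False by simp
      qed
    qed
    with elim(3) show ?case by blast
  qed
  with k show ?thesis by blast
qed

end

section \<open>Restoring the lost mass\<close>

lemma AE_norm_le_of_dominated:
  fixes X \<nu> :: "'a::euclidean_space measure"
  assumes "sets X = sets borel" "sets \<nu> = sets borel"
    and le: "\<And>A. A \<in> sets borel \<Longrightarrow> emeasure X A \<le> emeasure \<nu> A"
    and AE: "AE y in \<nu>. norm y \<le> R"
  shows "AE y in X. norm y \<le> R"
proof -
  have spaces: "space X = UNIV" "space \<nu> = UNIV"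
    using assms(1,2) by (auto dest: sets_eq_imp_space_eq)
  have A: "{y. \<not> norm y \<le> R} \<in> sets borel" by measurable
  then have "emeasure \<nu> {y. \<not> norm y \<le> R} = 0"
    using AE assms(2) AE_iff_measurable[of "{y. \<not> norm y \<le> R}" \<nu> "\<lambda>y. norm y \<le> R"] by (simp add: spaces)
  then have "emeasure X {y. \<not> norm y \<le> R} = 0" using le[OF A] by simp
  then show ?thesis
    using A assms(1) AE_iff_measurable[of "{y. \<not> norm y \<le> R}" X "\<lambda>y. norm y \<le> R"] by (simp add: spaces)
qed

lemma integrable_inner_of_bounded:
  fixes L :: "'a::euclidean_space measure"
  assumes "finite_measure L" "sets L = sets borel" "AE y in L. norm y \<le> R"
  shows "integrable L (\<lambda>y. y \<bullet> b)"
proof -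
  have "integrable L (\<lambda>y. y)"
    using assms(2,3) by (intro finite_measure.integrable_const_bound[OF assms(1), of _ R])
      (simp_all cong: measurable_cong_sets)
  then show ?thesis by simp
qed

text \<open>The missing mass \<open>S = \<nu> - \<mu>q\<close> has barycenter \<open>0\<close>: the barycenter of \<open>\<mu>q\<close> is that of \<open>\<mu>\<close>, which is
  that of \<open>\<nu>\<close>. The kernel \<open>q x + S\<close> has the required properties since \<open>\<mu>\<close> has mass \<open>1\<close>.\<close>

lemma barycentric_kernel_of_subkernel:
  fixes \<mu> \<nu> :: "'a::euclidean_space measure"
  assumes \<mu>: "prob_space \<mu>" "sets \<mu> = sets borel"
    and \<nu>: "prob_space \<nu>" "sets \<nu> = sets borel"
    and R: "AE y in \<nu>. norm y \<le> R"
    and bary_eq: "\<And>b. (\<integral>x. x \<bullet> b \<partial>\<mu>) = (\<integral>y. y \<bullet> b \<partial>\<nu>)"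
    and q: "nonneg_kernel q"
    and le: "\<And>A. A \<in> sets borel \<Longrightarrow> (\<integral>\<^sup>+ x. emeasure (q x) A \<partial>\<mu>) \<le> emeasure \<nu> A"
    and bary: "AE x in \<mu>. has_bochner_integral (q x) (\<lambda>y. y) x"
  shows "has_barycentric_kernel \<mu> \<nu>"
proof -
  interpret \<nu>: prob_space \<nu> by fact
  interpret \<mu>: prob_space \<mu> by fact
  have sp\<nu>: "space \<nu> = UNIV" using sets_eq_imp_space_eq[OF \<nu>(2)] by simp
  have fin: "finite_measure (q x)" and sets: "sets (q x) = sets borel"
    and qm: "A \<in> sets borel \<Longrightarrow> (\<lambda>x. emeasure (q x) A) \<in> borel_measurable borel" for x A
    using q by (auto simp: nonneg_kernel_def)
  define Q where "Q = kernel_comp \<mu> q"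
  have setsQ: "sets Q = sets borel" by (simp add: Q_def)
  have emQ: "emeasure Q A = (\<integral>\<^sup>+ x. emeasure (q x) A \<partial>\<mu>)" if "A \<in> sets borel" for A
    unfolding Q_def by (rule emeasure_kernel_comp[OF q \<mu>(2) that])
  have leQ: "emeasure Q A \<le> emeasure \<nu> A" if "A \<in> sets borel" for A using le[OF that] emQ[OF that] by simp
  have finQ: "finite_measure Q"
  proof (rule finite_measureI)
    have "emeasure Q (space Q) \<le> emeasure \<nu> UNIV" using leQ[of UNIV] sets_eq_imp_space_eq[OF setsQ] by simp
    then show "emeasure Q (space Q) \<noteq> \<infinity>" using \<nu>.emeasure_space_1 by (auto simp: sp\<nu> top_unique)
  qed
  define S where "S = diff_measure \<nu> Q"
  have setsS: "sets S = sets borel" by (simp add: S_def \<nu>(2))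
  have emS: "emeasure S A = emeasure \<nu> A - emeasure Q A" if "A \<in> sets borel" for A
    unfolding S_def using that leQ finQ \<nu>.finite_measure_axioms
    by (intro emeasure_diff_measure) (simp_all add: \<nu>(2) setsQ)
  have leS: "emeasure S A \<le> emeasure \<nu> A" if "A \<in> sets borel" for A
    unfolding emS[OF that] by (rule diff_le_self_ennreal)
  have finS: "finite_measure S"
  proof (rule finite_measureI)
    have "emeasure S (space S) \<le> emeasure \<nu> UNIV" using leS[of UNIV] sets_eq_imp_space_eq[OF setsS] by simp
    then show "emeasure S (space S) \<noteq> \<infinity>" using \<nu>.emeasure_space_1 by (auto simp: sp\<nu> top_unique)
  qed
  have QS: "emeasure Q A + emeasure S A = emeasure \<nu> A" if "A \<in> sets borel" for A
    unfolding emS[OF that] using leQ[OF that] by (simp add: diff_add_cancel_ennreal add.commute)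
  have add: "add_measure Q S = \<nu>"
    using QS by (intro measure_eqI) (simp_all add: emeasure_add_measure setsQ setsS \<nu>(2))
  have Qb: "integrable Q (\<lambda>y. y \<bullet> b)" for b
    by (rule integrable_inner_of_bounded[OF finQ setsQ AE_norm_le_of_dominated[OF setsQ \<nu>(2) leQ R]])
  have Sb: "integrable S (\<lambda>y. y \<bullet> b)" for b
    by (rule integrable_inner_of_bounded[OF finS setsS AE_norm_le_of_dominated[OF setsS \<nu>(2) leS R]])
  have Q0: "(\<integral>y. y \<bullet> b \<partial>Q) = (\<integral>x. x \<bullet> b \<partial>\<mu>)" for b
  proof -
    note mix = integral_is_mixture(2)[OF is_mixture_kernel_comp[OF q \<mu>(2)] Qb[unfolded Q_def], of b]
    have "(\<integral>y. y \<bullet> b \<partial>Q) = (\<integral>x. (\<integral>y. y \<bullet> b \<partial>q x) \<partial>\<mu>)"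
      using has_bochner_integral_integral_eq[OF mix] by (simp add: Q_def)
    also have "\<dots> = (\<integral>x. x \<bullet> b \<partial>\<mu>)"
    proof (rule integral_cong_AE)
      show "(\<lambda>x. \<integral>y. y \<bullet> b \<partial>q x) \<in> borel_measurable \<mu>"
        by (rule borel_measurable_has_bochner_integral[OF mix])
      show "(\<lambda>x. x \<bullet> b) \<in> borel_measurable \<mu>" using \<mu>(2) by (simp cong: measurable_cong_sets)
      show "AE x in \<mu>. (\<integral>y. y \<bullet> b \<partial>q x) = x \<bullet> b"
        using bary by eventually_elim
          (rule has_bochner_integral_integral_eq[OF has_bochner_integral_inner_left])
    qed
    finally show ?thesis .
  qed
  have S0: "(\<integral>y. y \<bullet> b \<partial>S) = 0" for b
  proof -
    have "has_bochner_integral (add_measure Q S) (\<lambda>y. y \<bullet> b) ((\<integral>y. y \<bullet> b \<partial>Q) + (\<integral>y. y \<bullet> b \<partial>S))"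
      by (rule has_bochner_integral_add_measure[OF _ Qb Sb]) (simp add: setsQ setsS)
    then have "(\<integral>y. y \<bullet> b \<partial>\<nu>) = (\<integral>y. y \<bullet> b \<partial>Q) + (\<integral>y. y \<bullet> b \<partial>S)"
      unfolding add by (rule has_bochner_integral_integral_eq)
    then show ?thesis using Q0[of b] bary_eq[of b] by simp
  qed
  define q' where "q' x = add_measure (q x) S" for x
  have sets': "sets (q' x) = sets borel" for x by (simp add: q'_def sets)
  have em': "emeasure (q' x) A = emeasure (q x) A + emeasure S A" if "A \<in> sets borel" for x A
    unfolding q'_def using that by (simp add: emeasure_add_measure sets setsS)
  have q': "nonneg_kernel q'"
    unfolding nonneg_kernel_def
  proof (intro conjI allI ballI sets')
    show "finite_measure (q' x)" for x
    proof (rule finite_measureI)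
      have "emeasure (q' x) (space (q' x)) = emeasure (q x) UNIV + emeasure S UNIV"
        using sets_eq_imp_space_eq[OF sets'] by (simp add: em')
      then show "emeasure (q' x) (space (q' x)) \<noteq> \<infinity>"
        using finite_measure.emeasure_finite[OF fin[of x]] finite_measure.emeasure_finite[OF finS]
        by simp
    qed
    show "(\<lambda>x. emeasure (q' x) A) \<in> borel_measurable borel" if "A \<in> sets borel" for A
      using qm[OF that] by (simp add: em'[OF that])
  qed
  have "kernel_comp \<mu> q' = \<nu>"
  proof (rule measure_eqI)
    fix A assume "A \<in> sets (kernel_comp \<mu> q')"
    then have A: "A \<in> sets borel" by simp
    have qA: "(\<lambda>x. emeasure (q x) A) \<in> borel_measurable \<mu>"
      using qm[OF A] \<mu>(2) by (simp cong: measurable_cong_sets)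
    have "emeasure (kernel_comp \<mu> q') A = (\<integral>\<^sup>+ x. emeasure (q x) A + emeasure S A \<partial>\<mu>)"
      by (simp add: emeasure_kernel_comp[OF q' \<mu>(2) A] em'[OF A])
    also have "\<dots> = emeasure Q A + emeasure S A"
      using qA by (subst nn_integral_add) (auto simp: emQ[OF A] \<mu>.emeasure_space_1)
    finally show "emeasure (kernel_comp \<mu> q') A = emeasure \<nu> A" by (simp add: QS[OF A])
  qed (simp add: \<nu>(2))
  moreover have "AE x in \<mu>. has_bochner_integral (q' x) (\<lambda>y. y) x"
    using bary
  proof eventually_elim
    case (elim x)
    show ?case
    proof (rule has_bochner_integral_componentwise)
      fix b :: 'a
      have b: "has_bochner_integral (q x) (\<lambda>y. y \<bullet> b) (x \<bullet> b)"
        using elim by (rule has_bochner_integral_inner_left)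
      have "has_bochner_integral (q' x) (\<lambda>y. y \<bullet> b) ((\<integral>y. y \<bullet> b \<partial>q x) + (\<integral>y. y \<bullet> b \<partial>S))"
        unfolding q'_def using b Sb
        by (intro has_bochner_integral_add_measure) (simp_all add: sets setsS has_bochner_integral_iff)
      then show "has_bochner_integral (q' x) (\<lambda>y. y \<bullet> b) (x \<bullet> b)"
        using has_bochner_integral_integral_eq[OF b] by (simp add: S0)
    qed
  qed
  ultimately show ?thesis using q' unfolding has_barycentric_kernel_def by blast
qed

section \<open>Equivalence of the three conditions\<close>

context transport_setting
begin

text \<open>For almost every \<open>x\<close> the approximating kernels converge on all test functions, and the limit is
  given by a measure \<open>q x\<close> with barycenter \<open>x\<close>. The test functions approximate indicators of open
  sets, which gives measurability in \<open>x\<close> and, by Fatou's lemma and outer regularity,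
  \<open>\<mu>q \<le> \<nu>\<close>.\<close>

lemma phc_le_imp_barycentric_kernel:
  assumes phc: "phc_le \<mu> \<nu>"
  shows "has_barycentric_kernel \<mu> \<nu>"
proof -
  obtain g :: "nat \<Rightarrow> 'a \<Rightarrow> real" where g0: "g 0 = (\<lambda>_. 1)" and gc: "\<And>j. continuous_on UNIV (g j)"
    and g01: "\<And>j y. 0 \<le> g j y \<and> g j y \<le> 1"
    and gU: "\<And>U. open U \<Longrightarrow> \<exists>j. (\<forall>n y. g (j n) y \<le> indicator U y) \<and> (\<forall>y. (\<lambda>n. g (j n) y) \<longlonglongrightarrow> indicator U y)"
    by (rule countable_open_tests) blast
  have gm: "g j \<in> borel_measurable borel" for j using gc by (rule borel_measurable_continuous_onI)
  define S where "S k j x = (\<integral>y. k x y *\<^sub>R g j y \<partial>\<nu>)" for k :: "'a \<Rightarrow> 'a \<Rightarrow> real" and j x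
  obtain k where k: "\<And>n. k n \<in> near_barycentric ((1/2)^n)"
    and kAE: "AE x in \<mu>. (\<forall>j. convergent (\<lambda>n. S (k n) j x)) \<and> (\<lambda>n. bary (k n) x) \<longlonglongrightarrow> x"
    using barycentric_sequence[where g=g, OF phc g0 gm g01] unfolding S_def by blast
  have kb: "bounded_density (k n)" for n using k by (simp add: near_barycentric_def)
  have k0: "0 \<le> k n x y" for n x y using kb[of n] by (simp add: bounded_density_def)
  have g1: "AE y in \<nu>. norm (g j y) \<le> 1" for j using g01 by (intro AE_I2) simp
  have Sm: "S (k n) j \<in> borel_measurable borel" for n j
    unfolding S_def[abs_def] by (rule density_section(3)[OF kb gm g1]) simp
  have Sint: "integrable \<nu> (\<lambda>y. k n x y *\<^sub>R g j y)" for n j x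
    by (rule density_section(1)[OF kb gm g1]) simp
  obtain Z where Z: "Z \<in> null_sets \<mu>"
    and good: "\<And>x. x \<notin> Z \<Longrightarrow> (\<forall>j. convergent (\<lambda>n. S (k n) j x)) \<and> (\<lambda>n. bary (k n) x) \<longlonglongrightarrow> x"
    using kAE unfolding eventually_ae_filter by auto
  have Zb: "Z \<in> sets borel" using Z sets_\<mu> by auto
  have AE_Z: "AE x in \<mu>. x \<notin> Z" using Z by (rule AE_not_in)
  have "\<exists>L. finite_measure L \<and> sets L = sets borel \<and> (AE y in L. norm y \<le> R) \<and>
      (\<forall>j. (\<lambda>n. S (k n) j x) \<longlonglongrightarrow> (\<integral>y. g j y \<partial>L)) \<and> has_bochner_integral L (\<lambda>y. y) x"
    if x: "x \<notin> Z" for x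
  proof -
    have "convergent (\<lambda>n. S (k n) 0 x)" using good[OF x] by blast
    then have "convergent (\<lambda>n. \<integral>y. k n x y \<partial>\<nu>)" by (simp add: S_def g0)
    then obtain c where c: "(\<lambda>n. \<integral>y. k n x y \<partial>\<nu>) \<longlonglongrightarrow> c" by (auto simp: convergent_def)
    from limit_measure_exists[OF density_mass_integrable(1)[OF kb] k0 c]
    obtain L where L: "finite_measure L" "sets L = sets borel" "AE y in L. norm y \<le> R"
      and Lg: "\<And>f l. continuous_on UNIV f \<Longrightarrow> (\<lambda>n. \<integral>y. k n x y *\<^sub>R f y \<partial>\<nu>) \<longlonglongrightarrow> l \<Longrightarrow> (\<integral>y. f y \<partial>L) = (l :: real)"
      by blast
    have "(\<lambda>n. S (k n) j x) \<longlonglongrightarrow> (\<integral>y. g j y \<partial>L)" for j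
    proof -
      obtain l where l: "(\<lambda>n. S (k n) j x) \<longlonglongrightarrow> l" using good[OF x] by (auto simp: convergent_def)
      then have "(\<integral>y. g j y \<partial>L) = l" unfolding S_def by (rule Lg[OF gc])
      with l show ?thesis by simp
    qed
    moreover have "has_bochner_integral L (\<lambda>y. y) x"
    proof (rule has_bochner_integral_componentwise)
      fix b :: 'a
      have "(\<integral>y. y \<bullet> b \<partial>L) = x \<bullet> b"
      proof (rule Lg)
        show "continuous_on UNIV (\<lambda>y. y \<bullet> b)" by (intro continuous_intros)
        have "(\<lambda>n. bary (k n) x \<bullet> b) \<longlonglongrightarrow> x \<bullet> b" using good[OF x] by (intro tendsto_intros) auto
        moreover have "bary (k n) x \<bullet> b = (\<integral>y. k n x y *\<^sub>R (y \<bullet> b) \<partial>\<nu>)" for n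
          unfolding bary_def using integral_inner_left[of b \<nu> "\<lambda>y. k n x y *\<^sub>R y"] integrable_bary_error(2)[OF kb]
          by simp
        ultimately show "(\<lambda>n. \<integral>y. k n x y *\<^sub>R (y \<bullet> b) \<partial>\<nu>) \<longlonglongrightarrow> x \<bullet> b" by simp
      qed
      moreover have "integrable L (\<lambda>y. y \<bullet> b)" by (rule integrable_inner_of_bounded[OF L])
      ultimately show "has_bochner_integral L (\<lambda>y. y \<bullet> b) (x \<bullet> b)" by (simp add: has_bochner_integral_iff)
    qed
    ultimately show ?thesis using L by blast
  qed
  moreover have "finite_measure (null_measure borel :: 'a measure)" by (intro finite_measureI) simp
  ultimately have "\<forall>x. \<exists>L. finite_measure L \<and> sets L = sets borel \<and> (x \<in> Z \<longrightarrow> L = null_measure borel) \<and>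
      (x \<notin> Z \<longrightarrow> (\<forall>j. (\<lambda>n. S (k n) j x) \<longlonglongrightarrow> (\<integral>y. g j y \<partial>L)) \<and> has_bochner_integral L (\<lambda>y. y) x)"
    by (metis sets_null_measure)
  then obtain q where fin: "\<And>x. finite_measure (q x)" and sets: "\<And>x. sets (q x) = sets borel"
    and qZ: "\<And>x. x \<in> Z \<Longrightarrow> q x = null_measure borel"
    and qlim: "\<And>x j. x \<notin> Z \<Longrightarrow> (\<lambda>n. S (k n) j x) \<longlonglongrightarrow> (\<integral>y. g j y \<partial>q x)"
    and qbary: "\<And>x. x \<notin> Z \<Longrightarrow> has_bochner_integral (q x) (\<lambda>y. y) x"
    by metis
  have gq: "g j \<in> borel_measurable (q x)" for j x using gm sets by (simp cong: measurable_cong_sets)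
  define h where "h j x = (\<integral>y. g j y \<partial>q x)" for j x
  have h0: "0 \<le> h j x" for j x unfolding h_def using g01 by (intro integral_nonneg_AE) simp
  \<comment> \<open>The measures \<open>q x\<close> are chosen for each \<open>x\<close> separately, but their integrals against the test
    functions are limits of measurable functions.\<close>
  have hm: "h j \<in> borel_measurable borel" for j
  proof (rule borel_measurable_LIMSEQ_real)
    show "(\<lambda>x. indicator (- Z) x * S (k n) j x) \<in> borel_measurable borel" for n
      using Sm Zb by (intro borel_measurable_times borel_measurable_indicator) auto
    show "(\<lambda>n. indicator (- Z) x * S (k n) j x) \<longlonglongrightarrow> h j x" for x
    proof (cases "x \<in> Z")
      case True
      have "(\<integral>y. g j y \<partial>null_measure borel) = 0" by (simp add: integral_eq_zero_AE AE_I[of _ _ UNIV])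
      then show ?thesis using True by (simp add: h_def qZ)
    next
      case False
      then show ?thesis using qlim by (simp add: h_def)
    qed
  qed
  have hU: "(\<lambda>n. h (j n) x) \<longlonglongrightarrow> measure (q x) U"
    if U: "open U" and j: "\<And>y. (\<lambda>n. g (j n) y) \<longlonglongrightarrow> indicator U y" for U j x
  proof -
    interpret finite_measure "q x" by (rule fin)
    have "(\<lambda>n. \<integral>y. g (j n) y \<partial>q x) \<longlonglongrightarrow> (\<integral>y. indicator U y \<partial>q x)"
    proof (rule integral_dominated_convergence[where w="\<lambda>_. 1"])
      show "AE y in q x. (\<lambda>n. g (j n) y) \<longlonglongrightarrow> indicator U y" using j by simp
      show "AE y in q x. norm (g (j n) y) \<le> 1" for n using g01 by simp
      show "(indicator U :: 'a \<Rightarrow> real) \<in> borel_measurable (q x)"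
        using U by (intro borel_measurable_indicator) (simp add: sets)
    qed (use gq in auto)
    moreover have "(\<integral>y. indicator U y \<partial>q x) = measure (q x) U"
      using sets_eq_imp_space_eq[OF sets[of x]] by simp
    ultimately show ?thesis by (simp add: h_def)
  qed
  have q: "nonneg_kernel q"
  proof (rule kernel_measurable_of_open[OF fin sets])
    fix U :: "'a set" assume U: "open U"
    obtain j where j: "\<And>y. (\<lambda>n. g (j n) y) \<longlonglongrightarrow> indicator U y" using gU[OF U] by blast
    have "(\<lambda>x. measure (q x) U) \<in> borel_measurable borel"
      by (rule borel_measurable_LIMSEQ_real[OF hU[OF U j] hm])
    then show "(\<lambda>x. emeasure (q x) U) \<in> borel_measurable borel"
      by (simp add: finite_measure.emeasure_eq_measure[OF fin])
  qed
  have hle: "(\<integral>\<^sup>+ x. ennreal (h j x) \<partial>\<mu>) \<le> (\<integral>\<^sup>+ y. ennreal (g j y) \<partial>\<nu>)" for j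
  proof -
    have Sj: "(\<integral>\<^sup>+ x. ennreal (S (k n) j x) \<partial>\<mu>) = (\<integral>\<^sup>+ y. ennreal (g j y) \<partial>\<nu>)" for n
    proof -
      have "ennreal (S (k n) j x) = (\<integral>\<^sup>+ y. ennreal (k n x y * g j y) \<partial>\<nu>)" for x
        unfolding S_def using Sint[of n x j] k0 g01 by (simp add: nn_integral_eq_integral)
      then show ?thesis using nn_integral_density_swap[OF k gm, of j n] g01 by simp
    qed
    have "(\<integral>\<^sup>+ x. ennreal (h j x) \<partial>\<mu>) = (\<integral>\<^sup>+ x. liminf (\<lambda>n. ennreal (S (k n) j x)) \<partial>\<mu>)"
    proof (rule nn_integral_cong_AE)
      show "AE x in \<mu>. ennreal (h j x) = liminf (\<lambda>n. ennreal (S (k n) j x))"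
        using AE_Z
      proof eventually_elim
        case (elim x)
        have "(\<lambda>n. ennreal (S (k n) j x)) \<longlonglongrightarrow> ennreal (h j x)"
          using qlim[OF elim] unfolding h_def by (rule tendsto_ennrealI)
        then show ?case by (intro lim_imp_Liminf[symmetric]) auto
      qed
    qed
    also have "\<dots> \<le> liminf (\<lambda>n. \<integral>\<^sup>+ x. ennreal (S (k n) j x) \<partial>\<mu>)"
      using Sm by (intro nn_integral_liminf) (simp add: measurable_\<mu>)
    also have "\<dots> = (\<integral>\<^sup>+ y. ennreal (g j y) \<partial>\<nu>)" unfolding Sj by (simp add: Liminf_const)
    finally show ?thesis .
  qed
  have le_open: "(\<integral>\<^sup>+ x. emeasure (q x) U \<partial>\<mu>) \<le> emeasure \<nu> U" if U: "open U" for U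
  proof -
    obtain j where jle: "\<And>n y. g (j n) y \<le> indicator U y"
      and j: "\<And>y. (\<lambda>n. g (j n) y) \<longlonglongrightarrow> indicator U y" using gU[OF U] by blast
    have "(\<integral>\<^sup>+ x. emeasure (q x) U \<partial>\<mu>) = (\<integral>\<^sup>+ x. liminf (\<lambda>n. ennreal (h (j n) x)) \<partial>\<mu>)"
    proof (rule nn_integral_cong)
      fix x
      have "(\<lambda>n. ennreal (h (j n) x)) \<longlonglongrightarrow> ennreal (measure (q x) U)"
        by (rule tendsto_ennrealI[OF hU[OF U j]])
      then show "emeasure (q x) U = liminf (\<lambda>n. ennreal (h (j n) x))"
        by (simp add: finite_measure.emeasure_eq_measure[OF fin] lim_imp_Liminf)
    qed
    also have "\<dots> \<le> liminf (\<lambda>n. \<integral>\<^sup>+ x. ennreal (h (j n) x) \<partial>\<mu>)"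
      using hm by (intro nn_integral_liminf) (simp add: measurable_\<mu>)
    also have "\<dots> \<le> liminf (\<lambda>n. emeasure \<nu> U)"
    proof (intro Liminf_mono always_eventually allI)
      fix n
      have "(\<integral>\<^sup>+ x. ennreal (h (j n) x) \<partial>\<mu>) \<le> (\<integral>\<^sup>+ y. ennreal (g (j n) y) \<partial>\<nu>)" by (rule hle)
      also have "\<dots> \<le> (\<integral>\<^sup>+ y. indicator U y \<partial>\<nu>)"
      proof (rule nn_integral_mono)
        show "ennreal (g (j n) y) \<le> indicator U y" for y
          using ennreal_leI[OF jle[of n y]] by (simp add: ennreal_indicator)
      qed
      also have "\<dots> = emeasure \<nu> U" using U by (simp add: sets_\<nu>)
      finally show "(\<integral>\<^sup>+ x. ennreal (h (j n) x) \<partial>\<mu>) \<le> emeasure \<nu> U" .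
    qed
    also have "\<dots> = emeasure \<nu> U" by (simp add: Liminf_const)
    finally show ?thesis .
  qed
  have le: "(\<integral>\<^sup>+ x. emeasure (q x) A \<partial>\<mu>) \<le> emeasure \<nu> A" if A: "A \<in> sets borel" for A
  proof -
    have "emeasure \<nu> A = (INF U \<in> {U. A \<subseteq> U \<and> open U}. emeasure \<nu> U)"
      using A sets_\<nu> by (intro outer_regular) auto
    moreover have "(\<integral>\<^sup>+ x. emeasure (q x) A \<partial>\<mu>) \<le> emeasure \<nu> U" if U: "A \<subseteq> U" "open U" for U
    proof -
      have "(\<integral>\<^sup>+ x. emeasure (q x) A \<partial>\<mu>) \<le> (\<integral>\<^sup>+ x. emeasure (q x) U \<partial>\<mu>)"
        using U sets by (intro nn_integral_mono emeasure_mono) auto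
      then show ?thesis using le_open[OF U(2)] by simp
    qed
    ultimately show ?thesis by (auto intro: INF_greatest)
  qed
  have bary: "AE x in \<mu>. has_bochner_integral (q x) (\<lambda>y. y) x"
    using AE_Z by eventually_elim (rule qbary)
  show ?thesis
    by (rule barycentric_kernel_of_subkernel[OF prob_\<mu> sets_\<mu> prob_\<nu> sets_\<nu> AE_R
          phc_le_barycenter_eq[OF phc] q le bary])
qed

end

lemma integrable_of_compact_support:
  fixes \<mu> :: "'a::euclidean_space measure"
  assumes "prob_space \<mu>" "sets \<mu> = sets borel" "compact (measure_support \<mu>)"
  shows "integrable \<mu> (\<lambda>x. norm x)"
proof -
  obtain B where B: "\<And>x. x \<in> measure_support \<mu> \<Longrightarrow> norm x \<le> B"
    using compact_imp_bounded[OF assms(3)] unfolding bounded_iff by blast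
  have "AE x in \<mu>. norm x \<le> B" using AE_measure_support[OF assms(2)] by eventually_elim (rule B)
  then show ?thesis
    using assms(2) prob_space.finite_measure[OF assms(1)]
    by (intro finite_measure.integrable_const_bound[of \<mu> _ B]) (simp_all cong: measurable_cong_sets)
qed

lemma phc_kernel_coupling_equivalence:
  fixes \<mu> \<nu> :: "'a::euclidean_space measure"
  assumes "prob_space \<mu>" and "sets \<mu> = sets borel"
    and "prob_space \<nu>" and "sets \<nu> = sets borel"
    and cpt: "compact (measure_support \<nu>)" and int: "integrable \<mu> (\<lambda>x. norm x)"
  shows "(phc_le \<mu> \<nu> \<longleftrightarrow> has_barycentric_kernel \<mu> \<nu>) \<and>
    (has_barycentric_kernel \<mu> \<nu> \<longleftrightarrow> has_density_coupling \<mu> \<nu>)"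
proof -
  obtain B where B: "\<And>y. y \<in> measure_support \<nu> \<Longrightarrow> norm y \<le> B"
    using compact_imp_bounded[OF cpt] unfolding bounded_iff by blast
  have K: "measure_support \<nu> \<subseteq> cball 0 (max 0 B)" using B by force
  have id: "integrable \<mu> (\<lambda>x. x)"
    using int assms(2) by (subst integrable_norm_iff[symmetric]) (simp_all cong: measurable_cong_sets)
  interpret transport_setting \<mu> \<nu> "measure_support \<nu>" "max 0 B"
    by (rule transport_setting.intro[OF assms(1,2) id assms(3,4) cpt K max.cobounded1
          AE_measure_support[OF assms(4)]])
  have "has_barycentric_kernel \<mu> \<nu>" if "phc_le \<mu> \<nu>" using that by (rule phc_le_imp_barycentric_kernel)
  moreover have "has_density_coupling \<mu> \<nu>" if "has_barycentric_kernel \<mu> \<nu>"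
    by (rule barycentric_kernel_imp_density_coupling[OF assms(1-4) AE_R that])
  moreover have "phc_le \<mu> \<nu>" if "has_density_coupling \<mu> \<nu>"
    by (rule density_coupling_imp_phc_le[OF assms(2) cpt AE_K that])
  ultimately show ?thesis by blast
qed

theorem theorem5p2:
  fixes \<mu> \<nu> :: "'a::euclidean_space measure"
  assumes "prob_space \<mu>" and "sets \<mu> = sets borel"
    and "prob_space \<nu>" and "sets \<nu> = sets borel"
    and "compact (measure_support \<nu>)"
  shows "(compact (measure_support \<mu>) \<longrightarrow>
            (phc_le \<mu> \<nu> \<longleftrightarrow> has_barycentric_kernel \<mu> \<nu>) \<and>
            (has_barycentric_kernel \<mu> \<nu> \<longleftrightarrow> has_density_coupling \<mu> \<nu>)) \<and>
         (integrable \<mu> (\<lambda>x. norm x) \<and> 0 \<notin> convex hull (measure_support \<nu>) \<longrightarrow>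
            (phc_le \<mu> \<nu> \<longleftrightarrow> has_barycentric_kernel \<mu> \<nu>) \<and>
            (has_barycentric_kernel \<mu> \<nu> \<longleftrightarrow> has_density_coupling \<mu> \<nu>))"
proof -
  note equivalence = phc_kernel_coupling_equivalence[OF assms]
  show ?thesis
    using equivalence integrable_of_compact_support[OF assms(1,2)] by blast
qed

end
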